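(* Let $k\ge1$, $\alpha,\beta>0$, $I_{2k}$ with multiplicity $(\alpha,\beta)$, $z=|z|e^{i\phi_1},w=|w|e^{i\phi_2}\in\mathbb{C}$, and let $E_\kappa(z,w,t):=t^{k(\alpha+\beta)}E_\kappa(tz,w)$ for $t\ge0$. Then for real $s>|z||w|$, $$\int_0^\infty e^{-st}E_\kappa(z,w,t)\,dt=\Gamma(k(\alpha+\beta)+1)\int_{-1}^1\int_{-1}^1\frac{(1+u)(1+v)-\frac{2}{\alpha+\beta}\big(\alpha u(1+v)+\beta v(1+u)\big)}{B(s,z,w)\,[A(s,|zw|,q_{u,v}(k\phi_1,k\phi_2))]^{\alpha+\beta}}\,d\nu^\alpha(u)\,d\nu^\beta(v),$$ where $B(s,z,w)=s-\mathrm{Re}(z\bar w)$ and $A(s,b,q)=\prod_{\ell=0}^{k-1}\big(s-b\cos\frac{q+2\pi\ell}{k}\big)$.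
   Context: Identify $\mathbb{R}^2$ with $\mathbb{C}$, $\langle z,w\rangle=\mathrm{Re}(z\bar w)$. The dihedral group $I_{2k}$ (order $4k$) contains the reflections $z\mapsto\bar ze^{ij\pi/k}$, $j=0,\dots,2k-1$, forming two conjugacy classes ($j$ even, containing $z\mapsto\bar z$; $j$ odd); $\kappa=(\alpha,\beta)$ is $\alpha$ on the class with $j$ even and $\beta$ on the class with $j$ odd. The Dunkl kernel is $E_\kappa(z,w)=V_\kappa(e^{\langle\cdot,w\rangle})(z)$ (joint eigenfunction of the Dunkl operators in $z$ with eigenvalues the coordinates of $w$, $E_\kappa(0,w)=1$). $d\nu^\alpha(u)=\frac{\Gamma(\alpha+1/2)}{\sqrt\pi\Gamma(\alpha)}(1-u^2)^{\alpha-1}du$ on $[-1,1]$. $\xi_{u,v}(\theta_1,\theta_2)=v\cos\theta_1\cos\theta_2+u\sin\theta_1\sin\theta_2$, $q_{u,v}=\arccos\xi_{u,v}\in[0,\pi]$. *)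

theory Defs
  imports "HOL-Analysis.Analysis"
begin

text \<open>Dihedral group I_{2k} acting on R^2 = C. Reflections z -> cnj z * exp(i j pi/k),
  j = 0..2k-1; a root orthogonal to the mirror of the j-th reflection.\<close>

definition dih_refl :: "nat \<Rightarrow> nat \<Rightarrow> complex \<Rightarrow> complex" where
  "dih_refl k j z = cnj z * exp (\<i> * of_real (real j * pi / real k))"

definition dih_root :: "nat \<Rightarrow> nat \<Rightarrow> complex" where
  "dih_root k j = \<i> * exp (\<i> * of_real (real j * pi / (2 * real k)))"

definition cinner :: "complex \<Rightarrow> complex \<Rightarrow> real" where
  "cinner z w = Re (z * cnj w)"

definition dih_mult :: "real \<Rightarrow> real \<Rightarrow> nat \<Rightarrow> real" where
  "dih_mult a b j = (if even j then a else b)"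

text \<open>f is a (differentiable) joint eigenfunction of the Dunkl operators
  T_xi f(x) = d_xi f(x) + sum_j kappa_j <r_j,xi> (f x - f(sigma_j x))/<r_j,x>
  with eigenvalues <xi,w>, normalised by f 0 = 1. The eigen-equation is required
  at all points off the mirrors (at mirror points the Dunkl operator is defined by
  continuity).\<close>
definition dunkl_eigenfunction ::
  "nat \<Rightarrow> real \<Rightarrow> real \<Rightarrow> complex \<Rightarrow> (complex \<Rightarrow> real) \<Rightarrow> bool" where
  "dunkl_eigenfunction k a b w f \<longleftrightarrow>
     f 0 = 1 \<and>
     (\<forall>x. \<exists>D. (f has_derivative D) (at x) \<and>
        ((\<forall>j<2*k. cinner (dih_root k j) x \<noteq> 0) \<longrightarrow>
          (\<forall>\<xi>. D \<xi> + (\<Sum>j<2*k. dih_mult a b j * cinner (dih_root k j) \<xi> *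
                 (f x - f (dih_refl k j x)) / cinner (dih_root k j) x)
               = cinner \<xi> w * f x)))"

definition dunkl_kernel :: "nat \<Rightarrow> real \<Rightarrow> real \<Rightarrow> complex \<Rightarrow> complex \<Rightarrow> real" where
  "dunkl_kernel k a b z w = (THE f. dunkl_eigenfunction k a b w f) z"

definition nu :: "real \<Rightarrow> real measure" where
  "nu a = density lborel (\<lambda>u. ennreal (indicator {-1..1} u *
      (Gamma (a + 1/2) / (sqrt pi * Gamma a)) * (1 - u\<^sup>2) powr (a - 1)))"

definition xi_uv :: "real \<Rightarrow> real \<Rightarrow> real \<Rightarrow> real \<Rightarrow> real" where
  "xi_uv u v \<theta>1 \<theta>2 = v * cos \<theta>1 * cos \<theta>2 + u * sin \<theta>1 * sin \<theta>2"

definition q_uv :: "real \<Rightarrow> real \<Rightarrow> real \<Rightarrow> real \<Rightarrow> real" where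
  "q_uv u v \<theta>1 \<theta>2 = arccos (xi_uv u v \<theta>1 \<theta>2)"

definition A_fun :: "nat \<Rightarrow> real \<Rightarrow> real \<Rightarrow> real \<Rightarrow> real" where
  "A_fun k s b q = (\<Prod>l<k. s - b * cos ((q + 2 * pi * real l) / real k))"

definition B_fun :: "real \<Rightarrow> complex \<Rightarrow> complex \<Rightarrow> real" where
  "B_fun s z w = s - Re (z * cnj w)"

end

theory Submission
  imports Defs
begin

text \<open>
  Write \<open>\<sigma> = a + b\<close>, \<open>\<gamma> = k \<sigma>\<close>. After rescaling \<open>s\<close> to 1 the right-hand side is
  \<open>\<Phi>(z) / (1 - \<langle>z, w\<rangle>)\<close>, where \<open>\<Phi>\<close> integrates \<open>h(u, v) A\<^sub>u\<^sub>v(z)\<^bsup>-\<sigma>\<^esup>\<close> and \<open>A\<^sub>u\<^sub>v\<close> is a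
  polynomial which is affine in \<open>(u, v)\<close>. Let \<open>c\<^sub>n\<close> be its homogeneous components. A reflection of
  \<open>z\<close> changes the sign of \<open>u\<close> or of \<open>v\<close>, and the corner values \<open>A\<^bsub>-1,1\<^esub>\<close>, \<open>A\<^bsub>1,-1\<^esub>\<close> are the
  products of \<open>1 - \<langle>\<rho> z, w\<rangle>\<close> over the two classes of reflections \<open>\<rho>\<close>. Integration by parts in
  \<open>u\<close> and \<open>v\<close> then reduces the identity
  \<open>T\<^sub>\<xi> c\<^sub>n = (\<gamma> + n) \<langle>\<xi>, w\<rangle> c\<^bsub>n-1\<^esub>\<close> to a polynomial identity that holds for each \<open>(u, v)\<close>. Hence
  \<open>\<Sum>\<^sub>n c\<^sub>n / (\<gamma> + 1)\<^sub>n\<close> is a normalised joint eigenfunction of the Dunkl operators; these are unique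
  by an energy estimate along rays, so the sum is the Dunkl kernel, and its Laplace
  transform is computed term by term. The components \<open>c\<^sub>n\<close> are handled as the coefficients of
  formal power series in a scaling variable.
\<close>

text \<open>The Dunkl difference quotient of 1 / (1 - <z, w>) at a reflection rho leaves a
  denominator 1 - <rho z, w>, and no such denominator occurs in the desired equation. The numerator
  removes them: integrating the reflected h against A^(-sigma) produces the corner product of that
  class as a factor, which contains every such denominator. The slope of A in u is a multiple of Im
  (z^k) and the slope in v a multiple of Re (z^k); these vanish on the mirrors of the two classes,
  which is how integration by parts also absorbs the singular quotients <r, xi> / <r, z>. The
  divisor (gamma + 1)_n is read off from the Laplace integral of t^(gamma + n), which is Gamma
  (gamma + 1) (gamma + 1)_n / s^(gamma + n + 1). It also makes the sum over n converge everywhere,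
  whereas the expansion of the integrals is controlled only for |z| |w| < 1. Working with
  coefficients keeps the identities valid for every z; convergence enters when the kernel and its
  transform are formed.\<close>

unbundle no vec_syntax
unbundle fps_syntax

section \<open>Uniqueness of the eigenfunction\<close>

lemma cinner_diff_left: "cinner (x - y) w = cinner x w - cinner y w"
  by (simp add: cinner_def algebra_simps)

lemma cinner_of_real_mult_left: "cinner (of_real t * x) w = t * cinner x w"
  by (simp add: cinner_def algebra_simps)

lemma cinner_eq_inner: "cinner x w = x \<bullet> w"
  by (simp add: cinner_def inner_complex_def)

lemma abs_cinner_le: "\<bar>cinner x w\<bar> \<le> cmod x * cmod w"
  by (simp add: cinner_eq_inner Cauchy_Schwarz_ineq2)

lemma has_derivative_cinner [derivative_intros]: "((\<lambda>x. cinner x w) has_derivative (\<lambda>\<xi>. cinner \<xi> w)) F"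
  unfolding cinner_eq_inner by (auto intro!: derivative_eq_intros)

lemma dih_refl_of_real_mult: "dih_refl k j (of_real t * z) = of_real t * dih_refl k j z"
  by (simp add: dih_refl_def)

lemma dih_refl_refl [simp]: "dih_refl k j (dih_refl k j z) = z"
  unfolding dih_refl_def cis_conv_exp[symmetric] complex_cnj_mult complex_cnj_cnj mult.assoc cis_cnj cis_mult
  by simp

lemma dih_refl_power: "k > 0 \<Longrightarrow> dih_refl k j z ^ k = (-1) ^ j * cnj z ^ k"
proof -
  assume k: "k > 0"
  have "exp (\<i> * of_real (real j * pi / real k)) ^ k = exp (of_nat j * (\<i> * pi))"
    using k by (simp add: mult.commute mult.left_commute flip: exp_of_nat_mult)
  also have "\<dots> = (-1) ^ j"
    by (simp only: exp_of_nat_mult) simp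
  finally show ?thesis
    by (simp add: dih_refl_def power_mult_distrib)
qed

text \<open>The root has norm 1 and is orthogonal to the mirror, the line at half the angle j pi /
  k; hence the reflection formula without a divisor <r, r>.\<close>

lemma dih_refl_eq: "dih_refl k j x = x - of_real (2 * cinner (dih_root k j) x) * dih_root k j"
proof -
  define e where "e = exp (\<i> * of_real (real j * pi / (2 * real k)))"
  have e: "cnj e * e = 1" "e * cnj e = 1" unfolding e_def
    by (simp_all add: exp_cnj flip: exp_add)
  have e2: "exp (\<i> * of_real (real j * pi / real k)) = e * e"
    unfolding e_def by (simp flip: exp_add)
  have c: "of_real (2 * cinner (dih_root k j) x) = \<i> * e * cnj x - \<i> * cnj e * x"
    unfolding cinner_def dih_root_def e_def[symmetric]
    by (simp add: complex_eq_iff)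
  have "x - (\<i> * e * cnj x - \<i> * cnj e * x) * (\<i> * e) = x - (\<i> * \<i>) * (e * e * cnj x) + (\<i> * \<i>) * ((e * cnj e) * x)"
    by (simp only: algebra_simps)
  also have "\<dots> = cnj x * (e * e)"
    unfolding e by simp
  finally show ?thesis
    unfolding c unfolding dih_root_def dih_refl_def e2 e_def[symmetric] by (rule sym)
qed

lemma cinner_dih_refl: "cinner (dih_refl k j x) w = cinner x w - 2 * cinner (dih_root k j) x * cinner (dih_root k j) w"
  by (simp only: dih_refl_eq cinner_diff_left cinner_of_real_mult_left)

text \<open>A point orthogonal to a root is fixed by that reflection, so x^k agrees with its
  conjugate up to sign and x^(2k) is real. Testing x^(2k) excludes all mirrors at once and is stable
  under scaling and along orbits.\<close>

lemma dih_root_cinner_nonzero: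
  assumes "k > 0" "Im (x ^ (2 * k)) \<noteq> 0"
  shows "cinner (dih_root k j) x \<noteq> 0"
proof
  assume "cinner (dih_root k j) x = 0"
  then have "dih_refl k j x = x" by (simp add: dih_refl_eq)
  then have "(x ^ k)\<^sup>2 = (cnj x ^ k)\<^sup>2"
    using dih_refl_power[OF assms(1), of j x]
    by (simp add: power_mult_distrib flip: power_mult[of "-1"])
  then have "x ^ (2 * k) = cnj (x ^ (2 * k))"
    by (simp add: power_mult mult.commute[of 2])
  then show False using assms(2) by (metis Im_complex_of_real Reals_cnj_iff complex_is_Real_iff)
qed

text \<open>The orbit of z under the dihedral group: rotations multiply by 2k-th roots of unity and
  reflections conjugate in addition. In this form finiteness and invariance come from facts about
  powers.\<close>

definition dih_orbit :: "nat \<Rightarrow> complex \<Rightarrow> complex set" where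
  "dih_orbit k z = {y. y ^ (2 * k) = z ^ (2 * k)} \<union> {y. y ^ (2 * k) = cnj (z ^ (2 * k))}"

lemma finite_dih_orbit: "k > 0 \<Longrightarrow> finite (dih_orbit k z)"
  unfolding dih_orbit_def by (intro finite_UnI finite_nth_roots) auto

lemma dih_refl_in_orbit:
  assumes "k > 0" "y \<in> dih_orbit k z" shows "dih_refl k j y \<in> dih_orbit k z"
proof -
  have "dih_refl k j y ^ (2 * k) = (dih_refl k j y ^ k)\<^sup>2"
    by (simp add: power_mult mult.commute[of 2])
  also have "\<dots> = ((-1) ^ j)\<^sup>2 * (cnj y ^ k)\<^sup>2"
    by (simp only: dih_refl_power[OF assms(1)] power_mult_distrib)
  also have "\<dots> = cnj (y ^ (2 * k))"
    by (simp flip: power_mult) (simp add: mult.commute)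
  finally have "dih_refl k j y ^ (2 * k) = cnj (y ^ (2 * k))" .
  then show ?thesis using assms(2) by (auto simp: dih_orbit_def simp del: complex_cnj_power)
qed

lemma sum_dih_orbit_refl:
  assumes "k > 0"
  shows "(\<Sum>y\<in>dih_orbit k z. g (dih_refl k j y)) = (\<Sum>y\<in>dih_orbit k z. g y)"
  by (rule sum.reindex_bij_witness[of _ "dih_refl k j" "dih_refl k j"])
     (auto simp: dih_refl_in_orbit assms)

lemma dih_orbit_nonreal:
  assumes "Im (z ^ (2 * k)) \<noteq> 0" "y \<in> dih_orbit k z"  "t \<noteq> 0"
  shows "Im ((of_real t * y) ^ (2 * k)) \<noteq> 0"
proof -
  have "Im (y ^ (2 * k)) \<noteq> 0"
    using assms(1,2) unfolding dih_orbit_def by (auto simp del: complex_cnj_power)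
  then show ?thesis using assms(3)
    by (simp add: power_mult_distrib flip: of_real_power)
qed

text \<open>Only the equation in the radial direction is used: along a ray it is a regular singular
  linear system for the values on an orbit whose singular part is a graph Laplacian.\<close>

lemma dunkl_radial_zero_generic:
  fixes d :: "complex \<Rightarrow> real"
  assumes k: "k > 0" and ab: "a > 0" "b > 0" and d0: "d 0 = 0"
    and der: "\<And>x. (d has_derivative D x) (at x)"
    and rad: "\<And>x. (\<forall>j<2*k. cinner (dih_root k j) x \<noteq> 0) \<Longrightarrow>
        D x x + (\<Sum>j<2*k. dih_mult a b j * (d x - d (dih_refl k j x))) = cinner x w * d x"
    and z: "Im (z ^ (2 * k)) \<noteq> 0"
  shows "d z = 0"
proof -
  define O' where "O' = dih_orbit k z"
  have fin: "finite O'" using k finite_dih_orbit by (simp add: O'_def)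
  define C where "C = (\<Sum>y\<in>O'. \<bar>cinner y w\<bar>)"
  have C: "cinner y w \<le> C" if "y \<in> O'" for y
    using member_le_sum[of y O' "\<lambda>y. \<bar>cinner y w\<bar>"] that fin by (simp add: C_def)
  \<comment> \<open>The energy on the orbit scaled by t. Summing over a full orbit lets each
    reflection act as a permutation of the summands.\<close>
  define e where "e = (\<lambda>t. \<Sum>y\<in>O'. (d (of_real t * y))\<^sup>2)"
  define e' where "e' = (\<lambda>t. \<Sum>y\<in>O'. 2 * d (of_real t * y) * D (of_real t * y) y)"
  have e_der: "(e has_real_derivative e' t) (at t)" for t
  proof -
    have "((\<lambda>t. d (of_real t * y)) has_derivative (\<lambda>h. D (of_real t * y) (of_real h * y))) (at t)" for y
      by (rule has_derivative_compose[of "\<lambda>t. of_real t * y" _ t UNIV d, OF _ der])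
         (auto intro!: derivative_eq_intros)
    moreover have "D (of_real t * y) (of_real h * y) = h * D (of_real t * y) y" for y h
      using has_derivative_linear[OF der, of "of_real t * y"]
      by (metis linear_cmul real_scaleR_def scaleR_conv_of_real)
    ultimately have "((\<lambda>t. d (of_real t * y)) has_real_derivative D (of_real t * y) y) (at t)" for y
      by (simp add: has_field_derivative_def mult_commute_abs)
    then show ?thesis unfolding e_def e'_def
      by (auto intro!: derivative_eq_intros simp: mult_ac)
  qed
  \<comment> \<open>As the reflection permutes the orbit, this sum is half the sum of the squares of
    the differences.\<close>
  have refl_nonneg: "(\<Sum>y\<in>O'. d (of_real t * y) * (d (of_real t * y) - d (dih_refl k j (of_real t * y)))) \<ge> 0" for t j
  proof -
    let ?f = "\<lambda>y. d (of_real t * y)"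
    have "0 \<le> (\<Sum>y\<in>O'. (?f y - ?f (dih_refl k j y))\<^sup>2)"
      by (intro sum_nonneg) auto
    also have "\<dots> = (\<Sum>y\<in>O'. (?f y)\<^sup>2) + (\<Sum>y\<in>O'. (?f (dih_refl k j y))\<^sup>2) - 2 * (\<Sum>y\<in>O'. ?f y * ?f (dih_refl k j y))"
      by (simp add: power2_diff sum.distrib sum_subtractf sum_distrib_left mult.assoc)
    also have "(\<Sum>y\<in>O'. (?f (dih_refl k j y))\<^sup>2) = (\<Sum>y\<in>O'. (?f y)\<^sup>2)"
      unfolding O'_def by (rule sum_dih_orbit_refl[OF k])
    finally show ?thesis
      by (simp add: dih_refl_of_real_mult right_diff_distrib sum_subtractf power2_eq_square)
  qed
  have e'_le: "e' t \<le> 2 * C * e t" if t: "t > 0" for t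
  proof -
    have "t * e' t = (\<Sum>y\<in>O'. 2 * d (of_real t * y) * D (of_real t * y) (of_real t * y))"
      unfolding e'_def sum_distrib_left
    proof (intro sum.cong refl)
      fix y
      have "D (of_real t * y) (of_real t * y) = t * D (of_real t * y) y"
        using has_derivative_linear[OF der, of "of_real t * y"]
        by (metis linear_cmul real_scaleR_def scaleR_conv_of_real)
      then show "t * (2 * d (of_real t * y) * D (of_real t * y) y) = 2 * d (of_real t * y) * D (of_real t * y) (of_real t * y)"
        by simp
    qed
    also have "\<dots> = (\<Sum>y\<in>O'. 2 * t * cinner y w * (d (of_real t * y))\<^sup>2 -
        2 * (\<Sum>j<2*k. dih_mult a b j * (d (of_real t * y) * (d (of_real t * y) - d (dih_refl k j (of_real t * y))))))"
    proof (intro sum.cong refl)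
      fix y assume y: "y \<in> O'"
      let ?x = "of_real t * y"
      have "D ?x ?x = cinner ?x w * d ?x - (\<Sum>j<2*k. dih_mult a b j * (d ?x - d (dih_refl k j ?x)))"
        using rad[of ?x] dih_root_cinner_nonzero[OF k dih_orbit_nonreal[OF z]] y t
        by (force simp: O'_def)
      then show "2 * d ?x * D ?x ?x = 2 * t * cinner y w * (d ?x)\<^sup>2 -
        2 * (\<Sum>j<2*k. dih_mult a b j * (d ?x * (d ?x - d (dih_refl k j ?x))))"
        by (simp add: cinner_of_real_mult_left[of t y] power2_eq_square right_diff_distrib sum_distrib_left mult.assoc mult.left_commute)
    qed
    also have "\<dots> = (\<Sum>y\<in>O'. 2 * t * cinner y w * (d (of_real t * y))\<^sup>2) -
       2 * (\<Sum>j<2*k. dih_mult a b j * (\<Sum>y\<in>O'. d (of_real t * y) * (d (of_real t * y) - d (dih_refl k j (of_real t * y)))))"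
      unfolding sum_subtractf
      unfolding sum_distrib_left by (subst (2) sum.swap) (rule refl)
    also have "\<dots> \<le> (\<Sum>y\<in>O'. 2 * t * cinner y w * (d (of_real t * y))\<^sup>2) - 0"
      using ab by (intro diff_mono order_refl mult_nonneg_nonneg sum_nonneg refl_nonneg) (auto simp: dih_mult_def)
    also have "\<dots> \<le> (\<Sum>y\<in>O'. 2 * t * C * (d (of_real t * y))\<^sup>2)"
      using C t by (simp, intro sum_mono mult_right_mono mult_left_mono) auto
    also have "\<dots> = t * (2 * C * e t)"
      by (simp add: e_def sum_distrib_left mult_ac)
    finally show ?thesis using t by simp
  qed
  \<comment> \<open>Gronwall: with the exponential weight the energy is nonincreasing on [0, 1], and
    it starts at 0 because \<open>d 0 = 0\<close>.\<close>
  define g where "g = (\<lambda>t. exp (- 2 * C * t) * e t)"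
  have g_der: "(g has_real_derivative exp (- 2 * C * t) * (e' t - 2 * C * e t)) (at t)" for t
    unfolding g_def by (auto intro!: derivative_eq_intros e_der simp: algebra_simps)
  have "g 1 \<le> g 0"
  proof (rule DERIV_nonpos_imp_decreasing_open[of 0 1 g])
    fix t :: real assume "0 < t" "t < 1"
    then show "\<exists>y. (g has_real_derivative y) (at t) \<and> y \<le> 0"
      using g_der[of t] e'_le[of t] by (intro exI conjI) (auto intro!: mult_nonneg_nonpos)
  qed (auto intro!: DERIV_continuous_on[OF has_field_derivative_at_within[OF g_der]])
  also have "g 0 = 0" by (simp add: g_def e_def d0)
  finally have "e 1 \<le> 0" by (simp add: g_def mult_le_0_iff)
  moreover have "e 1 \<ge> 0" by (auto simp: e_def intro!: sum_nonneg)
  ultimately have "e 1 = 0" by simp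
  then have "\<forall>y\<in>O'. (d y)\<^sup>2 = 0" using fin by (simp add: e_def sum_nonneg_eq_0_iff)
  moreover have "z \<in> O'" by (auto simp: O'_def dih_orbit_def)
  ultimately show ?thesis by auto
qed

text \<open>Rotating z by a small positive t turns z^n by n t, an angle in (0, pi), so a real
  nonzero z^n leaves the real axis. For exponent 2k this shows that points off the mirrors are
  dense.\<close>

lemma nonreal_power_approx:
  assumes "n > 0" "\<epsilon> > 0" "z \<noteq> 0"
  shows "\<exists>y. Im (y ^ n) \<noteq> 0 \<and> dist y z < \<epsilon>"
proof -
  have "((\<lambda>t. z * cis t) \<longlongrightarrow> z * cis 0) (at_right 0)"
    by (intro tendsto_intros)
  then have "\<forall>\<^sub>F t in at_right 0. dist (z * cis t) z < \<epsilon>"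
    using tendstoD[OF _ assms(2)] by fastforce
  moreover have "\<forall>\<^sub>F t in at_right 0. t \<in> {0<..<pi / real n}"
    using assms by (intro eventually_at_right_real) auto
  ultimately have "\<forall>\<^sub>F t in at_right 0. dist (z * cis t) z < \<epsilon> \<and> t \<in> {0<..<pi / real n}"
    by eventually_elim auto
  then obtain t where t: "dist (z * cis t) z < \<epsilon>" "t \<in> {0<..<pi / real n}"
    using eventually_happens'[OF trivial_limit_at_right_real] by blast
  have s: "sin (real n * t) > 0"
    using t assms by (intro sin_gt_zero) (auto simp: field_simps)
  have "Im ((z * cis t) ^ n) = Im (z ^ n) * cos (real n * t) + Re (z ^ n) * sin (real n * t)"
    unfolding power_mult_distrib Complex.DeMoivre by simp
  moreover have "Im (z ^ n) = 0 \<Longrightarrow> Re (z ^ n) \<noteq> 0"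
    using assms(3) by (metis complex_eqI power_not_zero zero_complex.simps)
  ultimately have "Im (z ^ n) = 0 \<Longrightarrow> Im ((z * cis t) ^ n) \<noteq> 0"
    using s by auto
  then show ?thesis using t(1) assms(2) by (metis dist_self)
qed

lemma dunkl_eigenfunctionE:
  assumes "dunkl_eigenfunction k a b w f"
  obtains D where "\<And>x. (f has_derivative D x) (at x)"
    "\<And>x \<xi>. (\<forall>j<2*k. cinner (dih_root k j) x \<noteq> 0) \<Longrightarrow> D x \<xi> + (\<Sum>j<2*k. dih_mult a b j * cinner (dih_root k j) \<xi> *
                 (f x - f (dih_refl k j x)) / cinner (dih_root k j) x)
               = cinner \<xi> w * f x"
  using choice[OF assms[unfolded dunkl_eigenfunction_def, THEN conjunct2]] that by blast

lemma dunkl_eigenfunction_unique: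
  assumes k: "k > 0" and ab: "a > 0" "b > 0"
    and f: "dunkl_eigenfunction k a b w f" and g: "dunkl_eigenfunction k a b w g"
  shows "f = g"
proof
  fix z
  obtain Df where Df: "\<And>x. (f has_derivative Df x) (at x)"
    "\<And>x \<xi>. (\<forall>j<2*k. cinner (dih_root k j) x \<noteq> 0) \<Longrightarrow> Df x \<xi> + (\<Sum>j<2*k. dih_mult a b j * cinner (dih_root k j) \<xi> *
                 (f x - f (dih_refl k j x)) / cinner (dih_root k j) x)
               = cinner \<xi> w * f x"
    using dunkl_eigenfunctionE[OF f] by blast
  obtain Dg where Dg: "\<And>x. (g has_derivative Dg x) (at x)"
    "\<And>x \<xi>. (\<forall>j<2*k. cinner (dih_root k j) x \<noteq> 0) \<Longrightarrow> Dg x \<xi> + (\<Sum>j<2*k. dih_mult a b j * cinner (dih_root k j) \<xi> *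
                 (g x - g (dih_refl k j x)) / cinner (dih_root k j) x)
               = cinner \<xi> w * g x"
    using dunkl_eigenfunctionE[OF g] by blast
  define d where "d = (\<lambda>x. f x - g x)"
  define D where "D = (\<lambda>x \<xi>. Df x \<xi> - Dg x \<xi>)"
  have der: "(d has_derivative D x) (at x)" for x
    unfolding d_def D_def by (intro has_derivative_diff Df Dg)
  have d0: "d 0 = 0" using f g by (simp add: d_def dunkl_eigenfunction_def)
  have gen: "d z = 0" if "Im (z ^ (2 * k)) \<noteq> 0" for z
  proof (rule dunkl_radial_zero_generic[OF k ab d0 der _ that])
    fix x assume x: "\<forall>j<2*k. cinner (dih_root k j) x \<noteq> 0"
    have "Df x x + (\<Sum>j<2*k. dih_mult a b j * (f x - f (dih_refl k j x))) = cinner x w * f x"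
      using Df(2)[OF x, of x] x by simp
    moreover have "Dg x x + (\<Sum>j<2*k. dih_mult a b j * (g x - g (dih_refl k j x))) = cinner x w * g x"
      using Dg(2)[OF x, of x] x by simp
    ultimately show "D x x + (\<Sum>j<2*k. dih_mult a b j * (d x - d (dih_refl k j x))) = cinner x w * d x"
      by (simp add: D_def d_def algebra_simps sum.distrib sum_subtractf)
  qed
  have "d z = 0"
  proof (cases "z = 0")
    case False
    show ?thesis
    proof (rule ccontr)
      assume nz: "d z \<noteq> 0"
      \<comment> \<open>The eigen-equation says nothing at mirror points; continuity carries the
        zero over from nearby points off the mirrors.\<close>
      have "isCont d z" using der has_derivative_continuous by blast
      then obtain \<epsilon> where \<epsilon>: "\<epsilon> > 0" "\<And>y. dist y z < \<epsilon> \<Longrightarrow> dist (d y) (d z) < \<bar>d z\<bar>"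
        using nz unfolding continuous_at_eps_delta by (metis zero_less_abs_iff)
      obtain y where "Im (y ^ (2 * k)) \<noteq> 0" "dist y z < \<epsilon>"
        using nonreal_power_approx[of "2 * k" \<epsilon> z] k \<epsilon> False by auto
      then show False using gen[of y] \<epsilon>(2)[of y] by (simp add: dist_real_def)
    qed
  qed (simp add: d0)
  then show "f z = g z" by (simp add: d_def)
qed

section \<open>The measures\<close>

definition nu_density :: "real \<Rightarrow> real \<Rightarrow> real" where
  "nu_density a u = indicator {-1..1} u * (Gamma (a + 1/2) / (sqrt pi * Gamma a)) * (1 - u\<^sup>2) powr (a - 1)"

lemma nu_eq: "nu a = density lborel (\<lambda>u. ennreal (nu_density a u))"
  by (simp add: nu_def nu_density_def)

lemma nu_density_nonneg: "a > 0 \<Longrightarrow> nu_density a u \<ge> 0"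
  by (auto simp: nu_density_def intro!: mult_nonneg_nonneg divide_nonneg_nonneg less_imp_le[OF Gamma_real_pos])

lemma borel_measurable_nu_density [measurable]: "nu_density a \<in> borel_measurable borel"
  unfolding nu_density_def by measurable

text \<open>Legendre's duplication formula eliminates Gamma (2 a). It is applied at a complex
  argument and read back through the embedding of the reals.\<close>

lemma Beta_diagonal:
  fixes a :: real assumes "a > 0"
  shows "Beta a a = 2 powr (1 - 2 * a) * (sqrt pi * Gamma a / Gamma (a + 1/2))"
proof -
  have "of_real a \<notin> (\<int>\<^sub>\<le>\<^sub>0 :: complex set)" "of_real a + 1/2 \<notin> (\<int>\<^sub>\<le>\<^sub>0 :: complex set)"
    using assms by (auto elim!: nonpos_Ints_cases simp: complex_eq_iff)
  from Gamma_legendre_duplication[OF this]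
  have "of_real (Gamma a * Gamma (a + 1/2)) =
     (of_real (exp ((1 - 2 * a) * ln 2) * sqrt pi * Gamma (2 * a)) :: complex)"
    by (simp flip: Gamma_complex_of_real exp_of_real)
  then have "Gamma a * Gamma (a + 1/2) = exp ((1 - 2 * a) * ln 2) * sqrt pi * Gamma (2 * a)"
    by (simp only: of_real_eq_iff)
  moreover have "Gamma (2 * a) > 0" "Gamma (a + 1/2) > 0" "Gamma a > 0"
    using assms by (auto intro!: Gamma_real_pos)
  ultimately show ?thesis
    by (simp add: Beta_def powr_def field_simps mult_2[symmetric])
qed

text \<open>Substitute t = (u + 1) / 2 in the Beta integral: then 1 - u^2 = 4 t (1 - t), and the
  powers of 2 cancel against the one in \<open>Beta_diagonal\<close>.\<close>

lemma has_integral_one_minus_square_powr: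
  fixes a :: real assumes "a > 0"
  shows "((\<lambda>u. (1 - u\<^sup>2) powr (a - 1)) has_integral (sqrt pi * Gamma a / Gamma (a + 1/2))) {-1..1}"
proof -
  have "((\<lambda>u. (1/2 * u + 1/2) powr (a - 1) * (1 - (1/2 * u + 1/2)) powr (a - 1)) has_integral (2 * Beta a a)) {-1..1}"
    using has_integral_affinity'[of "\<lambda>t. t powr (a - 1) * (1 - t) powr (a - 1)" "Beta a a" 0 1 "1/2" "1/2"]
      has_integral_Beta_real[of a a] assms by simp
  then have "((\<lambda>u. 4 powr (a - 1) * ((1/2 * u + 1/2) powr (a - 1) * (1 - (1/2 * u + 1/2)) powr (a - 1)))
     has_integral (4 powr (a - 1) * (2 * Beta a a))) {-1..1}"
    by (rule has_integral_mult_right)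
  moreover have "4 powr (a - 1) * ((1/2 * u + 1/2) powr (a - 1) * (1 - (1/2 * u + 1/2)) powr (a - 1)) = (1 - u\<^sup>2) powr (a - 1)"
    if "u \<in> {-1..1}" for u
  proof -
    have "4 powr (a - 1) * ((1/2 * u + 1/2) powr (a - 1) * (1 - (1/2 * u + 1/2)) powr (a - 1))
      = (4 * ((1/2 * u + 1/2) * (1 - (1/2 * u + 1/2)))) powr (a - 1)"
      by (simp only: powr_mult)
    also have "4 * ((1/2 * u + 1/2) * (1 - (1/2 * u + 1/2))) = 1 - u\<^sup>2"
      by (simp add: power2_eq_square field_simps)
    finally show ?thesis .
  qed
  moreover have "4 powr (a - 1) * (2 * Beta a a) = sqrt pi * Gamma a / Gamma (a + 1/2)"
  proof -
    have "4 powr (a - 1) * 2 * 2 powr (1 - 2 * a) = (1::real)"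
    proof -
      have "(4::real) powr (a - 1) = 2 powr (2 * (a - 1))"
        using powr_powr[of 2 2 "a - 1"] by simp
      then have "4 powr (a - 1) * 2 * 2 powr (1 - 2 * a) = 2 powr (2 * (a - 1)) * 2 powr 1 * (2::real) powr (1 - 2 * a)"
        by simp
      also have "\<dots> = 1" unfolding powr_add[symmetric] by simp
      finally show ?thesis .
    qed
    then show ?thesis unfolding Beta_diagonal[OF assms]
      by (metis (no_types, opaque_lifting) mult.assoc mult_1)
  qed
  ultimately show ?thesis
    by (metis (no_types, lifting) has_integral_eq)
qed

lemma nu_density_integral:
  assumes "a > 0"
  shows "integrable lborel (nu_density a)" "(\<integral>u. nu_density a u \<partial>lborel) = 1"
proof -
  have pos: "Gamma a > 0" "Gamma (a + 1/2) > 0" using assms by (auto intro!: Gamma_real_pos)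
  let ?c = "Gamma (a + 1/2) / (sqrt pi * Gamma a)"
  have "((\<lambda>u. ?c * (1 - u\<^sup>2) powr (a - 1)) has_integral (?c * (sqrt pi * Gamma a / Gamma (a + 1/2)))) {-1..1}"
    by (intro has_integral_mult_right has_integral_one_minus_square_powr assms)
  also have "?c * (sqrt pi * Gamma a / Gamma (a + 1/2)) = 1"
    using pos by simp
  finally have "((\<lambda>u. ?c * (1 - u\<^sup>2) powr (a - 1)) has_integral 1) {-1..1}" .
  then have "((\<lambda>u. if u \<in> {-1..1} then ?c * (1 - u\<^sup>2) powr (a - 1) else 0) has_integral 1) UNIV"
    by (simp only: has_integral_restrict_UNIV)
  also have "(\<lambda>u. if u \<in> {-1..1} then ?c * (1 - u\<^sup>2) powr (a - 1) else 0) = nu_density a"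
    by (auto simp: nu_density_def indicator_def fun_eq_iff)
  finally have "(nu_density a has_integral 1) UNIV" .
  then have "(\<integral>\<^sup>+x. nu_density a x \<partial>lborel) = ennreal 1"
    using nn_integral_has_integral_lborel[of "nu_density a" 1] nu_density_nonneg[OF assms] by auto
  then have "integrable lborel (nu_density a) \<and> integral\<^sup>L lborel (nu_density a) = 1"
    using nn_integral_eq_integrable[of "nu_density a" lborel 1] nu_density_nonneg[OF assms] by auto
  then show "integrable lborel (nu_density a)" "(\<integral>u. nu_density a u \<partial>lborel) = 1" by auto
qed

lemma space_nu [simp]: "space (nu a) = UNIV" and sets_nu [simp, measurable_cong]: "sets (nu a) = sets borel"
  by (simp_all add: nu_eq)

lemma emeasure_nu_UNIV: assumes "a > 0" shows "emeasure (nu a) UNIV = 1"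
proof -
  have "emeasure (nu a) UNIV = (\<integral>\<^sup>+x. nu_density a x \<partial>lborel)"
    unfolding nu_eq by (subst emeasure_density) auto
  also have "\<dots> = 1"
    using nn_integral_eq_integral[OF nu_density_integral(1)[OF assms]] nu_density_nonneg[OF assms] nu_density_integral(2)[OF assms]
    by simp
  finally show ?thesis .
qed

lemma finite_measure_nu: "a > 0 \<Longrightarrow> finite_measure (nu a)"
  by (rule finite_measureI) (simp add: emeasure_nu_UNIV)

lemma AE_nu: "AE u in nu a. u \<in> {-1..1}"
  unfolding nu_eq by (subst AE_density) (auto simp: nu_density_def indicator_def)

lemma integrable_nu_iff:
  assumes "a > 0" "f \<in> borel_measurable borel"
  shows "integrable (nu a) f \<longleftrightarrow> integrable lborel (\<lambda>u. nu_density a u * f u)"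
  unfolding nu_eq using integrable_density[of f lborel "nu_density a"] assms nu_density_nonneg by auto

lemma integral_nu:
  fixes f :: "real \<Rightarrow> real"
  assumes "a > 0" "f \<in> borel_measurable borel"
  shows "(\<integral>u. f u \<partial>nu a) = (\<integral>u. nu_density a u * f u \<partial>lborel)"
  unfolding nu_eq using integral_density[of f lborel "nu_density a"] assms nu_density_nonneg by auto

lemma integrable_nu_continuous:
  fixes f :: "real \<Rightarrow> real"
  assumes a: "a > 0" and f: "continuous_on UNIV f"
  shows "integrable (nu a) f"
proof -
  interpret finite_measure "nu a" by (rule finite_measure_nu[OF a])
  have "compact (f ` {-1..1})"
    by (intro compact_continuous_image continuous_on_subset[OF f]) auto
  then obtain B where B: "\<And>u. u \<in> {-1..1} \<Longrightarrow> norm (f u) \<le> B"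
    using compact_imp_bounded bounded_iff by (metis imageI)
  show ?thesis
  proof (rule integrable_const_bound)
    show "AE u in nu a. norm (f u) \<le> B" using AE_nu by eventually_elim (rule B)
    show "f \<in> borel_measurable (nu a)"
      using borel_measurable_continuous_onI[OF f] by simp
  qed
qed

text \<open>The weight is even. Later this moves the sign change caused by a reflection of z from
  the series to the numerator.\<close>

lemma integral_nu_reflect:
  fixes f :: "real \<Rightarrow> real"
  assumes a: "a > 0" and [measurable]: "f \<in> borel_measurable borel"
  shows "(\<integral>u. f (- u) \<partial>nu a) = (\<integral>u. f u \<partial>nu a)"
proof -
  have "(\<integral>u. f u \<partial>nu a) = (\<integral>u. nu_density a u * f u \<partial>lborel)"
    using a by (intro integral_nu) auto
  also have "\<dots> = (\<integral>u. nu_density a (- u) * f (- u) \<partial>lborel)"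
    using lborel_integral_real_affine[of "-1" "\<lambda>u. nu_density a u * f u" 0] by simp
  also have "\<dots> = (\<integral>u. nu_density a u * f (- u) \<partial>lborel)"
    by (intro Bochner_Integration.integral_cong) (auto simp: nu_density_def indicator_def)
  also have "\<dots> = (\<integral>u. f (- u) \<partial>nu a)"
    using a by (intro integral_nu[symmetric]) auto
  finally show ?thesis ..
qed

text \<open>The density times (1 - u^2) f' - 2 a u f is the derivative of a multiple of (1 - u^2)^a
  f, which tends to 0 at both ends because a > 0. For a < 1 the density blows up there, so the
  fundamental theorem is used on the open interval with limits at the ends.\<close>

lemma integral_nu_by_parts:
  fixes f f' :: "real \<Rightarrow> real"
  assumes a: "a > 0" and f: "\<And>u. (f has_real_derivative f' u) (at u)" and f': "continuous_on UNIV f'"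
  shows "2 * a * (\<integral>u. u * f u \<partial>nu a) = (\<integral>u. (1 - u\<^sup>2) * f' u \<partial>nu a)"
proof -
  have fc: "continuous_on UNIV f"
    by (rule DERIV_continuous_on[OF has_field_derivative_at_within[OF f]])
  have [measurable]: "f \<in> borel_measurable borel" "f' \<in> borel_measurable borel"
    using fc f' by (auto intro!: borel_measurable_continuous_onI)
  let ?c = "Gamma (a + 1/2) / (sqrt pi * Gamma a)"
  define F where "F = (\<lambda>u. ?c * ((1 - u\<^sup>2) powr a * f u))"
  define G where "G = (\<lambda>u. ?c * ((1 - u\<^sup>2) powr (a - 1)) * ((1 - u\<^sup>2) * f' u - 2 * a * (u * f u)))"
  have i1: "integrable (nu a) (\<lambda>u. u * f u)" "integrable (nu a) (\<lambda>u. (1 - u\<^sup>2) * f' u)"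
    by (intro integrable_nu_continuous a continuous_intros fc f')+
  then have int: "integrable (nu a) (\<lambda>u. (1 - u\<^sup>2) * f' u - 2 * a * (u * f u))"
    by auto
  \<comment> \<open>Integrability is inherited from \<open>nu a\<close>, for which the bracket is a
    continuous integrand, since \<open>G\<close> itself may be unbounded near the ends.\<close>
  then have intl: "integrable lborel (\<lambda>u. nu_density a u * ((1 - u\<^sup>2) * f' u - 2 * a * (u * f u)))"
    using integrable_nu_iff[OF a, of "\<lambda>u. (1 - u\<^sup>2) * f' u - 2 * a * (u * f u)"] by simp
  have neg1: "(- 1 :: ereal) = ereal (- 1)" by (simp add: one_ereal_def)
  have ei: "einterval (- 1) 1 = {-1<..<1::real}"
    unfolding neg1 one_ereal_def by (auto simp: einterval_def)
  have pos: "1 - u\<^sup>2 > 0" if "- 1 < ereal u" "ereal u < 1" for u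
    using that unfolding neg1 one_ereal_def ereal_less_eq by (simp add: abs_square_less_1 abs_less_iff)
  have eq: "indicator {-1<..<1} u * G u = nu_density a u * ((1 - u\<^sup>2) * f' u - 2 * a * (u * f u))"
    if "u \<notin> {-1, 1}" for u
    using that by (auto simp: G_def nu_density_def indicator_def)
  have AE: "AE u in lborel. indicator {-1<..<1} u * G u = nu_density a u * ((1 - u\<^sup>2) * f' u - 2 * a * (u * f u))"
    using AE_lborel_singleton[of "-1::real"] AE_lborel_singleton[of "1::real"]
    by eventually_elim (rule eq, simp)
  have [measurable]: "G \<in> borel_measurable borel" unfolding G_def by measurable
  \<comment> \<open>Both end points satisfy x^2 = 1, so one limit serves for both; the condition on
    \<open>S\<close> keeps the base of \<open>powr\<close> nonnegative.\<close>
  have lim: "((\<lambda>u. F u) \<longlongrightarrow> 0) (at x within S)" if x: "x\<^sup>2 = 1" and S: "\<And>u. u \<in> S \<Longrightarrow> u\<^sup>2 \<le> 1" for x S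
  proof -
    have "((\<lambda>u. (1 - u\<^sup>2)) \<longlongrightarrow> 1 - x\<^sup>2) (at x within S)"
      by (intro tendsto_intros)
    then have "((\<lambda>u. (1 - u\<^sup>2) powr a) \<longlongrightarrow> 0) (at x within S)"
      using S x a by (intro tendsto_zero_powrI[where b = a]) (auto simp: eventually_at_filter intro!: always_eventually)
    moreover have "(f \<longlongrightarrow> f x) (at x within S)"
      using f[of x] by (metis DERIV_isCont continuous_at_imp_continuous_at_within continuous_within)
    ultimately have "((\<lambda>u. ?c * ((1 - u\<^sup>2) powr a * f u)) \<longlongrightarrow> ?c * (0 * f x)) (at x within S)"
      by (intro tendsto_mult tendsto_const)
    then show ?thesis using x a by (simp add: F_def)
  qed
  have "(LBINT u=-1..1. G u) = 0 - 0"
  proof (rule interval_integral_FTC_integrable)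
    show "(F has_vector_derivative G u) (at u)" if "- 1 < ereal u" "ereal u < 1" for u
    proof -
      have "1 - u\<^sup>2 > 0" by (rule pos[OF that])
      have "((\<lambda>u. (1 - u\<^sup>2) powr a) has_real_derivative (a * (1 - u\<^sup>2) powr (a - 1) * (- 2 * u))) (at u)"
      proof -
        have "((\<lambda>u. 1 - u\<^sup>2) has_real_derivative (- 2 * u)) (at u)"
          by (auto intro!: derivative_eq_intros)
        from DERIV_fun_powr[OF this \<open>1 - u\<^sup>2 > 0\<close>, of a] show ?thesis by simp
      qed
      then have "(F has_real_derivative (?c * ((a * (1 - u\<^sup>2) powr (a - 1) * (- 2 * u)) * f u + (1 - u\<^sup>2) powr a * f' u))) (at u)"
        unfolding F_def using DERIV_cmult[OF DERIV_mult[OF _ f], of _ _ u ?c] by (simp only: mult.commute[of "_ powr a" "f' u"])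
      moreover have "(1 - u\<^sup>2) powr a = (1 - u\<^sup>2) powr (a - 1) * (1 - u\<^sup>2)"
        using \<open>1 - u\<^sup>2 > 0\<close> powr_mult_base[of "1 - u\<^sup>2" "a - 1"] by (simp add: mult.commute)
      ultimately have "(F has_real_derivative (?c * ((a * (1 - u\<^sup>2) powr (a - 1) * (- 2 * u)) * f u + (1 - u\<^sup>2) powr (a - 1) * (1 - u\<^sup>2) * f' u))) (at u)"
        by simp
      then have "(F has_real_derivative G u) (at u)"
        unfolding G_def by (rule DERIV_cong) (simp add: algebra_simps add_divide_distrib diff_divide_distrib)
      then show ?thesis by (simp add: has_real_derivative_iff_has_vector_derivative)
    qed
    show "isCont G u" if "- 1 < ereal u" "ereal u < 1" for u
    proof -
      have "1 - u\<^sup>2 > 0" by (rule pos[OF that])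
      then show ?thesis unfolding G_def
        using fc f' by (intro continuous_intros) (auto simp: continuous_on_eq_continuous_at)
    qed
    show "set_integrable lborel (einterval (- 1) 1) G"
      unfolding set_integrable_def ei real_scaleR_def
      by (rule integrable_cong_AE_imp[OF intl _ ]) (use AE in auto)
    show "((F \<circ> real_of_ereal) \<longlongrightarrow> 0) (at_right (- 1))"
      unfolding neg1 ereal_tendsto_simps1
      by (rule Lim_transform_within_set[OF lim[of "-1" "{-1<..<1}"]])
         (auto simp: abs_square_le_1 eventually_at intro!: exI[of _ 1] simp: dist_real_def)
    show "((F \<circ> real_of_ereal) \<longlongrightarrow> 0) (at_left 1)"
      unfolding one_ereal_def ereal_tendsto_simps1
      by (rule Lim_transform_within_set[OF lim[of "1" "{-1<..<1}"]])
         (auto simp: abs_square_le_1 eventually_at intro!: exI[of _ 1] simp: dist_real_def)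
  qed (simp add: neg1 one_ereal_def)
  then have "0 = (\<integral>u. indicator {-1<..<1} u * G u \<partial>lborel)"
    unfolding interval_lebesgue_integral_def set_lebesgue_integral_def ei
    by (simp add: neg1 one_ereal_def split: if_splits)
  also have "\<dots> = (\<integral>u. nu_density a u * ((1 - u\<^sup>2) * f' u - 2 * a * (u * f u)) \<partial>lborel)"
    using AE by (intro integral_cong_AE) auto
  also have "\<dots> = (\<integral>u. (1 - u\<^sup>2) * f' u - 2 * a * (u * f u) \<partial>nu a)"
    using a by (intro integral_nu[symmetric]) auto
  also have "\<dots> = (\<integral>u. (1 - u\<^sup>2) * f' u \<partial>nu a) - 2 * a * (\<integral>u. u * f u \<partial>nu a)"
    using i1 by simp
  finally show ?thesis by simp
qed

section \<open>The product measure on the square\<close>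

definition nu2 :: "real \<Rightarrow> real \<Rightarrow> (real \<times> real) measure" where
  "nu2 a b = nu a \<Otimes>\<^sub>M nu b"

lemma sets_nu2 [simp, measurable_cong]: "sets (nu2 a b) = sets (borel :: (real \<times> real) measure)" and space_nu2 [simp]: "space (nu2 a b) = UNIV"
proof -
  have "sets (nu2 a b) = sets (borel \<Otimes>\<^sub>M (borel :: real measure))"
    unfolding nu2_def by (intro sets_pair_measure_cong) auto
  also have "\<dots> = sets (borel :: (real \<times> real) measure)" by (subst borel_prod) (rule refl)
  finally show "sets (nu2 a b) = sets borel" .
qed (simp add: nu2_def space_pair_measure)

lemma pair_sigma_finite_nu: "a > 0 \<Longrightarrow> b > 0 \<Longrightarrow> pair_sigma_finite (nu a) (nu b)"
  by (simp add: pair_sigma_finite_def finite_measure_nu finite_measure.axioms)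

lemma emeasure_nu2_UNIV:
  assumes "a > 0" "b > 0" shows "emeasure (nu2 a b) UNIV = 1"
proof -
  interpret B: finite_measure "nu b" using assms by (intro finite_measure_nu)
  have "emeasure (nu2 a b) (UNIV \<times> UNIV) = 1"
    unfolding nu2_def by (subst B.emeasure_pair_measure_Times) (auto simp: emeasure_nu_UNIV assms)
  then show ?thesis by simp
qed

lemma finite_measure_nu2: "a > 0 \<Longrightarrow> b > 0 \<Longrightarrow> finite_measure (nu2 a b)"
  by (rule finite_measureI) (simp add: emeasure_nu2_UNIV)

lemma AE_nu2:
  assumes "a > 0" "b > 0" shows "AE p in nu2 a b. p \<in> {-1..1} \<times> {-1..1}"
proof -
  interpret pair_sigma_finite "nu a" "nu b" using assms by (rule pair_sigma_finite_nu)
  have "AE u in nu a. AE v in nu b. (u, v) \<in> {-1..1} \<times> {-1..1}"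
    using AE_nu[of a]
  proof eventually_elim
    case (elim u)
    show ?case using AE_nu[of b] by eventually_elim (use elim in auto)
  qed
  moreover have "{p \<in> space (nu a \<Otimes>\<^sub>M nu b). p \<in> {-1..1} \<times> {-1..1}} \<in> sets (nu a \<Otimes>\<^sub>M nu b)"
    by measurable
  ultimately show ?thesis unfolding nu2_def
    using AE_pair_measure[of "\<lambda>p. p \<in> {-1..1} \<times> {-1..1}"] by simp
qed

lemma integrable_nu2_bounded:
  fixes g :: "real \<times> real \<Rightarrow> real"
  assumes "a > 0" "b > 0" "g \<in> borel_measurable borel" "\<And>p. p \<in> {-1..1} \<times> {-1..1} \<Longrightarrow> \<bar>g p\<bar> \<le> B"
  shows "integrable (nu2 a b) g"
proof -
  interpret finite_measure "nu2 a b" using assms by (intro finite_measure_nu2)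
  have "AE p in nu2 a b. norm (g p) \<le> B"
    using AE_nu2[OF assms(1,2)] by eventually_elim (use assms(4) in auto)
  then show ?thesis using assms(3) by (intro integrable_const_bound[where B = B]) auto
qed

lemma integrable_nu2_continuous:
  fixes g :: "real \<times> real \<Rightarrow> real"
  assumes "a > 0" "b > 0" "continuous_on UNIV g"
  shows "integrable (nu2 a b) g"
proof -
  have "compact (g ` ({-1..1} \<times> {-1..1}))"
    by (intro compact_continuous_image continuous_on_subset[OF assms(3)] compact_Times) auto
  then obtain B where "\<And>p. p \<in> {-1..1} \<times> {-1..1} \<Longrightarrow> norm (g p) \<le> B"
    using compact_imp_bounded bounded_iff by (metis imageI)
  then show ?thesis
    using assms by (intro integrable_nu2_bounded[where B = B] borel_measurable_continuous_onI) auto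
qed

lemma integral_nu2_bound:
  fixes g :: "real \<times> real \<Rightarrow> real"
  assumes "a > 0" "b > 0" "\<And>p. p \<in> {-1..1} \<times> {-1..1} \<Longrightarrow> \<bar>g p\<bar> \<le> B"
  shows "\<bar>\<integral>p. g p \<partial>nu2 a b\<bar> \<le> B"
proof (cases "integrable (nu2 a b) g")
  case True
  interpret finite_measure "nu2 a b" using assms by (intro finite_measure_nu2)
  have "\<bar>\<integral>p. g p \<partial>nu2 a b\<bar> \<le> (\<integral>p. \<bar>g p\<bar> \<partial>nu2 a b)"
    by (rule integral_abs_bound)
  also have "\<dots> \<le> (\<integral>p. B \<partial>nu2 a b)"
    using True AE_nu2[OF assms(1,2)] assms(3) by (intro integral_mono_AE) (auto elim!: eventually_mono)
  also have "\<dots> = B"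
    using emeasure_nu2_UNIV[OF assms(1,2)] by (simp add: measure_def)
  finally show ?thesis .
next
  case False
  \<comment> \<open>A non-integrable function has integral 0 by convention, so it remains to see
    that \<open>B\<close> is nonnegative; any point of the square shows this.\<close>
  have "0 \<le> B" using assms(3)[of "(0,0)"] by auto
  then show ?thesis using False by (simp add: not_integrable_integral_eq)
qed

lemma integral_nu2_fst:
  fixes g :: "real \<times> real \<Rightarrow> real"
  assumes "a > 0" "b > 0" "integrable (nu2 a b) g"
  shows "(\<integral>p. g p \<partial>nu2 a b) = (\<integral>u. (\<integral>v. g (u, v) \<partial>nu b) \<partial>nu a)"
proof -
  interpret pair_sigma_finite "nu a" "nu b" using assms by (intro pair_sigma_finite_nu)
  show ?thesis using assms(3) unfolding nu2_def by (rule integral_fst'[symmetric])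
qed

text \<open>Reduces statements about the first coordinate to those about the second, with
  \<open>a\<close> and \<open>b\<close> exchanged.\<close>

lemma integral_nu2_swap:
  fixes g :: "real \<times> real \<Rightarrow> real"
  assumes "a > 0" "b > 0" "continuous_on UNIV g"
  shows "(\<integral>p. g (prod.swap p) \<partial>nu2 b a) = (\<integral>p. g p \<partial>nu2 a b)"
proof -
  interpret pair_sigma_finite "nu a" "nu b" using assms by (intro pair_sigma_finite_nu)
  have "g \<in> borel_measurable (nu2 a b)"
    using borel_measurable_continuous_onI[OF assms(3)] by simp
  then show ?thesis
    using integral_product_swap[of g] unfolding nu2_def by (simp add: case_prod_unfold prod.swap_def)
qed

lemma continuous_on_Pair_section:
  assumes "continuous_on UNIV g"
  shows "continuous_on UNIV (\<lambda>v. g (u, v))" "continuous_on UNIV (\<lambda>u. g (u, v))"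
  by (rule continuous_on_compose2[OF assms], auto intro!: continuous_intros)+

lemma integral_nu2_reflect_snd:
  fixes g :: "real \<times> real \<Rightarrow> real"
  assumes "a > 0" "b > 0" and g: "continuous_on UNIV g"
  shows "(\<integral>p. g (fst p, - snd p) \<partial>nu2 a b) = (\<integral>p. g p \<partial>nu2 a b)"
proof -
  have "continuous_on UNIV (\<lambda>p. g (fst p, - snd p))"
    by (rule continuous_on_compose2[OF g]) (auto intro!: continuous_intros)
  then have "(\<integral>p. g (fst p, - snd p) \<partial>nu2 a b) = (\<integral>u. (\<integral>v. g (u, - v) \<partial>nu b) \<partial>nu a)"
    using assms by (subst integral_nu2_fst) (auto intro!: integrable_nu2_continuous)
  also have "\<dots> = (\<integral>u. (\<integral>v. g (u, v) \<partial>nu b) \<partial>nu a)"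
    using assms by (intro Bochner_Integration.integral_cong refl integral_nu_reflect[of b "\<lambda>v. g (u, v)" for u]
      borel_measurable_continuous_onI continuous_on_Pair_section)
  also have "\<dots> = (\<integral>p. g p \<partial>nu2 a b)"
    using assms by (intro integral_nu2_fst[symmetric] integrable_nu2_continuous)
  finally show ?thesis .
qed

lemma continuous_on_swap:
  assumes "continuous_on UNIV g" shows "continuous_on UNIV (\<lambda>p. g (prod.swap p))"
  by (rule continuous_on_compose2[OF assms]) (auto simp: prod.swap_def intro!: continuous_intros)

lemma integral_nu2_reflect_fst:
  fixes g :: "real \<times> real \<Rightarrow> real"
  assumes "a > 0" "b > 0" and g: "continuous_on UNIV g"
  shows "(\<integral>p. g (- fst p, snd p) \<partial>nu2 a b) = (\<integral>p. g p \<partial>nu2 a b)"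
proof -
  have "continuous_on UNIV (\<lambda>p. g (- fst p, snd p))"
    by (rule continuous_on_compose2[OF g]) (auto intro!: continuous_intros)
  from integral_nu2_swap[OF assms(1,2) this] show ?thesis
    using integral_nu2_reflect_snd[OF assms(2,1) continuous_on_swap[OF g]] integral_nu2_swap[OF assms] by simp
qed

lemma integral_nu2_by_parts_snd:
  fixes g g' :: "real \<times> real \<Rightarrow> real"
  assumes "a > 0" "b > 0" and g: "continuous_on UNIV g" and g': "continuous_on UNIV g'"
    and der: "\<And>u v. ((\<lambda>v. g (u, v)) has_real_derivative g' (u, v)) (at v)"
  shows "2 * b * (\<integral>p. snd p * g p \<partial>nu2 a b) = (\<integral>p. (1 - (snd p)\<^sup>2) * g' p \<partial>nu2 a b)"
proof -
  have "continuous_on UNIV (\<lambda>p. snd p * g p)" "continuous_on UNIV (\<lambda>p. (1 - (snd p)\<^sup>2) * g' p)"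
    by (intro continuous_intros g g')+
  then have i: "integrable (nu2 a b) (\<lambda>p. snd p * g p)" "integrable (nu2 a b) (\<lambda>p. (1 - (snd p)\<^sup>2) * g' p)"
    using assms by (auto intro!: integrable_nu2_continuous)
  have "2 * b * (\<integral>p. snd p * g p \<partial>nu2 a b) = (\<integral>u. 2 * b * (\<integral>v. v * g (u, v) \<partial>nu b) \<partial>nu a)"
    using integral_nu2_fst[OF assms(1,2) i(1)] by simp
  also have "\<dots> = (\<integral>u. (\<integral>v. (1 - v\<^sup>2) * g' (u, v) \<partial>nu b) \<partial>nu a)"
    using assms by (intro Bochner_Integration.integral_cong refl integral_nu_by_parts continuous_on_Pair_section)
  also have "\<dots> = (\<integral>p. (1 - (snd p)\<^sup>2) * g' p \<partial>nu2 a b)"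
    using integral_nu2_fst[OF assms(1,2) i(2)] by simp
  finally show ?thesis .
qed

lemma integral_nu2_by_parts_fst:
  fixes g g' :: "real \<times> real \<Rightarrow> real"
  assumes "a > 0" "b > 0" and g: "continuous_on UNIV g" and g': "continuous_on UNIV g'"
    and der: "\<And>u v. ((\<lambda>u. g (u, v)) has_real_derivative g' (u, v)) (at u)"
  shows "2 * a * (\<integral>p. fst p * g p \<partial>nu2 a b) = (\<integral>p. (1 - (fst p)\<^sup>2) * g' p \<partial>nu2 a b)"
proof -
  have "continuous_on UNIV (\<lambda>p. fst p * g p)" "continuous_on UNIV (\<lambda>p. (1 - (fst p)\<^sup>2) * g' p)"
    by (intro continuous_intros g g')+
  note sw = this[THEN integral_nu2_swap[OF assms(1,2)]]
  have "2 * a * (\<integral>p. snd p * g (prod.swap p) \<partial>nu2 b a) = (\<integral>p. (1 - (snd p)\<^sup>2) * g' (prod.swap p) \<partial>nu2 b a)"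
    using der by (intro integral_nu2_by_parts_snd assms(1,2) continuous_on_swap g g') simp
  then show ?thesis using sw by simp
qed

section \<open>Powers of formal power series\<close>

text \<open>This is \<open>A\<^bsup>-s\<^esup>\<close>; it is meaningful only if \<open>A\<close> has constant term 1.\<close>

definition fps_negpow :: "real \<Rightarrow> real fps \<Rightarrow> real fps" where
  "fps_negpow s A = fps_binomial (- s) oo (A - 1)"

lemma fps_negpow_nth_0 [simp]: "fps_negpow s A $ 0 = 1"
  by (simp add: fps_negpow_def)

lemma fps_negpow_add:
  assumes "A $ 0 = 1"
  shows "fps_negpow (s + t) A = fps_negpow s A * fps_negpow t A"
  using fps_binomial_add_mult[of "- s" "- t"] assms
  by (simp add: fps_negpow_def fps_compose_mult_distrib)

lemma fps_negpow_0 [simp]: "fps_negpow 0 A = 1"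
  by (simp add: fps_negpow_def)

lemma fps_negpow_minus_1:
  assumes "A $ 0 = 1" shows "fps_negpow (- 1) A = A"
  using assms by (simp add: fps_negpow_def fps_binomial_1 fps_compose_add_distrib)

lemma fps_mult_negpow:
  assumes "A $ 0 = 1" shows "A * fps_negpow (s + 1) A = fps_negpow s A"
  using fps_negpow_add[OF assms, of "-1" "s + 1"] by (simp add: fps_negpow_minus_1[OF assms])

text \<open>The binomial series solves (1 + X) F' = - s F. Substituting A - 1 and applying the chain
  rule gives the logarithmic derivative of A^(-s).\<close>

lemma fps_deriv_negpow:
  assumes "A $ 0 = 1"
  shows "A * fps_deriv (fps_negpow s A) = fps_const (- s) * fps_deriv A * fps_negpow s A"
proof -
  have 1: "(1 + fps_X) * fps_deriv (fps_binomial (- s)) = fps_const (- s) * fps_binomial (- s)"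
    unfolding fps_binomial_deriv by (subst fps_divide_unit) (auto simp: mult.left_commute inverse_mult_eq_1')
  have "fps_deriv (fps_negpow s A) = (fps_deriv (fps_binomial (- s)) oo (A - 1)) * fps_deriv A"
    unfolding fps_negpow_def using assms by (subst fps_compose_deriv) auto
  moreover have "A = (1 + fps_X) oo (A - 1)"
    using assms by (simp add: fps_compose_add_distrib)
  ultimately have "A * fps_deriv (fps_negpow s A) = (((1 + fps_X) * fps_deriv (fps_binomial (- s))) oo (A - 1)) * fps_deriv A"
    using assms by (simp add: fps_compose_mult_distrib mult.assoc)
  then show ?thesis using assms unfolding 1
    by (simp add: fps_compose_mult_distrib fps_negpow_def mult_ac)
qed

text \<open>The Wronskian of two solutions is annihilated by the nonzero series A, hence vanishes in
  an integral domain. So G / H has derivative 0 and equals its constant term 1.\<close>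

lemma fps_linear_ODE_unique:
  fixes G H A C :: "real fps"
  assumes "A $ 0 = 1" "A * fps_deriv G = C * G" "A * fps_deriv H = C * H" "G $ 0 = 1" "H $ 0 = 1"
  shows "G = H"
proof -
  have "A * (fps_deriv G * H - G * fps_deriv H) = (A * fps_deriv G) * H - G * (A * fps_deriv H)"
    by (simp add: algebra_simps)
  also have "\<dots> = 0" unfolding assms(2,3) by (simp add: algebra_simps)
  finally have 0: "fps_deriv G * H - G * fps_deriv H = 0"
    using assms(1) by (metis fps_zero_nth mult_eq_0_iff zero_neq_one)
  have "fps_deriv (G / H) = 0"
    using 0 assms(5) fps_divide_deriv[of H G] by (simp add: fps_divide_deriv)
  then have "G / H = fps_const ((G / H) $ 0)"
    using fps_deriv_eq_0_iff by blast
  also have "\<dots> = 1"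
    using assms(4,5) by (simp add: fps_divide_unit)
  finally have "G / H = 1" .
  then show ?thesis using assms(5)
    by (metis dvd_div_mult_self fps_is_unit_iff mult_1 one_neq_zero unit_imp_dvd)
qed

text \<open>Both sides solve (A B) Y' = - s (A B)' Y with constant term 1.\<close>

lemma fps_negpow_mult:
  assumes "A $ 0 = 1" "B $ 0 = 1"
  shows "fps_negpow s (A * B) = fps_negpow s A * fps_negpow s B"
proof (rule fps_linear_ODE_unique)
  show "(A * B) $ 0 = 1" using assms by simp
  then show "(A * B) * fps_deriv (fps_negpow s (A * B)) = (fps_const (- s) * fps_deriv (A * B)) * fps_negpow s (A * B)"
    by (rule fps_deriv_negpow)
  have "(A * B) * fps_deriv (fps_negpow s A * fps_negpow s B) =
     A * (B * fps_deriv (fps_negpow s B)) * fps_negpow s A + B * (A * fps_deriv (fps_negpow s A)) * fps_negpow s B"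
    by (simp add: algebra_simps)
  also have "\<dots> = (fps_const (- s) * fps_deriv (A * B)) * (fps_negpow s A * fps_negpow s B)"
    unfolding fps_deriv_negpow[OF assms(1)] fps_deriv_negpow[OF assms(2)] by (simp add: algebra_simps)
  finally show "(A * B) * fps_deriv (fps_negpow s A * fps_negpow s B) = (fps_const (- s) * fps_deriv (A * B)) * (fps_negpow s A * fps_negpow s B)" .
qed (auto simp: assms)

lemma fps_prod_nth_0: "finite I \<Longrightarrow> (\<And>i. i \<in> I \<Longrightarrow> F i $ 0 = (1::real)) \<Longrightarrow> (\<Prod>i\<in>I. F i) $ 0 = 1"
  by (induction I rule: finite_induct) auto

lemma fps_negpow_one [simp]: "fps_negpow s 1 = 1"
  by (simp add: fps_negpow_def fps_eq_iff fps_compose_nth power_0_left if_distrib cong: if_cong)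

lemma fps_negpow_prod:
  assumes "finite I" "\<And>i. i \<in> I \<Longrightarrow> F i $ 0 = 1"
  shows "fps_negpow s (\<Prod>i\<in>I. F i) = (\<Prod>i\<in>I. fps_negpow s (F i))"
  using assms by (induction I rule: finite_induct) (auto simp: fps_negpow_mult fps_prod_nth_0)

lemma fps_negpow_linear_nth:
  "fps_negpow s (1 - fps_const c * fps_X) $ n = pochhammer s n / fact n * c ^ n"
proof -
  have "fps_negpow s (1 - fps_const c * fps_X) = fps_binomial (- s) oo (fps_const (- c) * fps_X)"
    by (simp add: fps_negpow_def flip: fps_const_neg)
  then show ?thesis
    by (simp add: fps_compose_linear gbinomial_pochhammer power_minus[of c])
qed

lemma fps_negpow_one_inverse:
  assumes "A $ 0 = 1" shows "fps_negpow 1 A = inverse A"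
  using fps_mult_negpow[OF assms, of 0] assms
  by (metis add_0 fps_inverse_unique fps_negpow_0 mult.commute)

lemma fps_negpow_scale:
  assumes "A $ 0 = 1"
  shows "fps_negpow s (A oo (fps_const t * fps_X)) = fps_negpow s A oo (fps_const t * fps_X)"
proof -
  have "fps_negpow s A oo (fps_const t * fps_X) = fps_binomial (- s) oo ((A - 1) oo (fps_const t * fps_X))"
    unfolding fps_negpow_def using assms by (intro fps_compose_assoc[symmetric]) auto
  then show ?thesis by (simp add: fps_negpow_def fps_compose_sub_distrib)
qed

section \<open>Coefficientwise majorants\<close>

definition fps_maj :: "real fps \<Rightarrow> real fps \<Rightarrow> bool" where
  "fps_maj F G \<longleftrightarrow> (\<forall>n. \<bar>F $ n\<bar> \<le> G $ n)"

lemma fps_maj_mult: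
  assumes "fps_maj F G" "fps_maj F' G'" shows "fps_maj (F * F') (G * G')"
  unfolding fps_maj_def fps_mult_nth
proof (intro allI order.trans[OF sum_abs] sum_mono)
  fix n i
  have "0 \<le> G $ m" for m using assms(1) unfolding fps_maj_def by (meson abs_ge_zero order_trans)
  then show "\<bar>F $ i * F' $ (n - i)\<bar> \<le> G $ i * G' $ (n - i)"
    using assms unfolding fps_maj_def abs_mult by (intro mult_mono) auto
qed

lemma fps_maj_one [simp]: "fps_maj 1 1"
  by (simp add: fps_maj_def)

text \<open>For s >= 0 the coefficients of (1 - c X)^(-s) are nonnegative multiples of c^n, so
  replacing every \<open>c i\<close> by the bound \<open>C\<close> dominates each factor; the equal
  factors then merge into one power.\<close>

lemma fps_maj_prod_negpow:
  assumes "finite I" "\<And>i. i \<in> I \<Longrightarrow> \<bar>c i\<bar> \<le> C" "s \<ge> 0"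
  shows "fps_maj (fps_negpow s (\<Prod>i\<in>I. 1 - fps_const (c i) * fps_X)) (fps_negpow (real (card I) * s) (1 - fps_const C * fps_X))"
proof -
  have "fps_maj (\<Prod>i\<in>I. fps_negpow s (1 - fps_const (c i) * fps_X)) (fps_negpow (real (card I) * s) (1 - fps_const C * fps_X))"
    using assms(1,2)
  proof (induction I rule: finite_induct)
    case (insert i I)
    have "fps_maj (fps_negpow s (1 - fps_const (c i) * fps_X)) (fps_negpow s (1 - fps_const C * fps_X))"
      unfolding fps_maj_def fps_negpow_linear_nth abs_mult
    proof (intro allI mult_mono)
      fix n
      have "pochhammer s n \<ge> 0"
        using \<open>s \<ge> 0\<close> by (auto simp: pochhammer_prod intro!: prod_nonneg)
      then show "\<bar>pochhammer s n / fact n\<bar> \<le> pochhammer s n / fact n" "0 \<le> pochhammer s n / fact n" by auto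
      show "\<bar>c i ^ n\<bar> \<le> C ^ n" using insert.prems[of i] by (auto simp: power_abs intro!: power_mono)
    qed auto
    from fps_maj_mult[OF this insert.IH] insert show ?case
      by (simp add: distrib_right fps_negpow_add)
  qed auto
  then show ?thesis using assms(1) by (subst fps_negpow_prod) auto
qed

section \<open>Evaluation of absolutely convergent series\<close>

definition fps_abs_sums :: "real fps \<Rightarrow> real \<Rightarrow> real \<Rightarrow> bool" where
  "fps_abs_sums F t x \<longleftrightarrow> summable (\<lambda>n. \<bar>F $ n * t ^ n\<bar>) \<and> (\<lambda>n. F $ n * t ^ n) sums x"

lemma fps_abs_sums_one [simp]: "fps_abs_sums 1 t 1"
proof -
  have eq: "(\<lambda>n. (1 :: real fps) $ n * t ^ n) = (\<lambda>n. if n = 0 then 1 else 0)" by auto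
  have "(\<lambda>n. \<bar>(1 :: real fps) $ n * t ^ n\<bar>) = (\<lambda>n. if n = 0 then 1 else 0)" by auto
  then show ?thesis unfolding fps_abs_sums_def eq
    using sums_single[of 0 "\<lambda>n. 1::real"] by (simp add: sums_iff)
qed

text \<open>The Cauchy product of absolutely convergent series converges to the product of the
  values, which is why \<open>fps_abs_sums\<close> carries absolute convergence along; the triangle
  inequality passes it on to the product.\<close>

lemma fps_abs_sums_mult:
  assumes "fps_abs_sums F t x" "fps_abs_sums G t y"
  shows "fps_abs_sums (F * G) t (x * y)"
proof -
  have F: "summable (\<lambda>n. norm (F $ n * t ^ n))" "(\<Sum>n. F $ n * t ^ n) = x"
    and G: "summable (\<lambda>n. norm (G $ n * t ^ n))" "(\<Sum>n. G $ n * t ^ n) = y"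
    using assms by (auto simp: fps_abs_sums_def sums_iff)
  have eq: "(\<Sum>i\<le>n. (F $ i * t ^ i) * (G $ (n - i) * t ^ (n - i))) = (F * G) $ n * t ^ n" for n
    unfolding fps_mult_nth sum_distrib_right atMost_atLeast0
  proof (intro sum.cong refl)
    fix i assume "i \<in> {0..n}"
    then have "t ^ n = t ^ i * t ^ (n - i)" by (simp flip: power_add)
    then show "(F $ i * t ^ i) * (G $ (n - i) * t ^ (n - i)) = F $ i * G $ (n - i) * t ^ n" by simp
  qed
  have 1: "(\<lambda>n. (F * G) $ n * t ^ n) sums (x * y)"
    using Cauchy_product_sums[OF F(1) G(1)] unfolding eq F(2) G(2) .
  have "summable (\<lambda>n. \<Sum>i\<le>n. norm (F $ i * t ^ i) * norm (G $ (n - i) * t ^ (n - i)))"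
    using F(1) G(1) by (intro summable_Cauchy_product) auto
  then have "summable (\<lambda>n. \<bar>(F * G) $ n * t ^ n\<bar>)"
  proof (rule summable_comparison_test'[where N = 0])
    fix n
    have "\<bar>(F * G) $ n * t ^ n\<bar> = \<bar>\<Sum>i\<le>n. (F $ i * t ^ i) * (G $ (n - i) * t ^ (n - i))\<bar>"
      unfolding eq ..
    also have "\<dots> \<le> (\<Sum>i\<le>n. norm (F $ i * t ^ i) * norm (G $ (n - i) * t ^ (n - i)))"
      by (rule order.trans[OF sum_abs]) (simp add: abs_mult)
    finally show "norm \<bar>(F * G) $ n * t ^ n\<bar> \<le> (\<Sum>i\<le>n. norm (F $ i * t ^ i) * norm (G $ (n - i) * t ^ (n - i)))"
      by simp
  qed
  then show ?thesis using 1 by (simp add: fps_abs_sums_def)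
qed

lemma fps_abs_sums_negpow_linear:
  assumes "\<bar>c * t\<bar> < 1"
  shows "fps_abs_sums (fps_negpow s (1 - fps_const c * fps_X)) t ((1 - c * t) powr (- s))"
proof -
  have eq: "fps_negpow s (1 - fps_const c * fps_X) $ n * t ^ n = ((- s) gchoose n) * (- (c * t)) ^ n" for n
    by (simp add: fps_negpow_linear_nth gbinomial_pochhammer power_minus[of "c * t"] power_mult_distrib)
  have "(\<lambda>n. ((- s) gchoose n) * (- (c * t)) ^ n) sums (1 + - (c * t)) powr (- s)"
    using assms by (intro gen_binomial_real) auto
  moreover have "summable (\<lambda>n. norm (((- s) gchoose n) * (- (c * t)) ^ n))"
  \<comment> \<open>Convergence at a point strictly between |c t| and 1, here the midpoint, gives
    absolute convergence at c t.\<close>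
  proof (rule powser_insidea)
    show "summable (\<lambda>n. ((- s) gchoose n) * ((\<bar>c * t\<bar> + 1) / 2) ^ n)"
      using assms gen_binomial_real[of "(\<bar>c * t\<bar> + 1) / 2" "- s"] by (auto simp: sums_iff)
    show "norm (- (c * t)) < norm ((\<bar>c * t\<bar> + 1) / 2)" using assms by simp
  qed
  ultimately show ?thesis unfolding fps_abs_sums_def eq by simp
qed

lemma fps_abs_sums_negpow_prod:
  assumes "finite I" "\<And>i. i \<in> I \<Longrightarrow> \<bar>c i * t\<bar> < 1"
  shows "fps_abs_sums (fps_negpow s (\<Prod>i\<in>I. 1 - fps_const (c i) * fps_X)) t ((\<Prod>i\<in>I. 1 - c i * t) powr (- s))"
proof -
  have "fps_abs_sums (\<Prod>i\<in>I. fps_negpow s (1 - fps_const (c i) * fps_X)) t ((\<Prod>i\<in>I. 1 - c i * t) powr (- s))"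
    using assms
    by (induction I rule: finite_induct)
       (auto simp: powr_mult intro!: fps_abs_sums_mult fps_abs_sums_negpow_linear)
  then show ?thesis using assms(1) by (subst fps_negpow_prod) auto
qed

section \<open>Coefficientwise Frechet derivatives of series in a parameter\<close>

definition fps_has_derivative :: "('p::real_normed_vector \<Rightarrow> real fps) \<Rightarrow> ('p \<Rightarrow> real fps) \<Rightarrow> 'p \<Rightarrow> bool" where
  "fps_has_derivative F D x \<longleftrightarrow> (\<forall>n. ((\<lambda>y. F y $ n) has_derivative (\<lambda>h. D h $ n)) (at x))"

lemma fps_has_derivative_const: "fps_has_derivative (\<lambda>y. C) (\<lambda>h. 0) x"
  by (simp add: fps_has_derivative_def)

lemma fps_has_derivative_fps_const:
  "(f has_derivative D) (at x) \<Longrightarrow> fps_has_derivative (\<lambda>y. fps_const (f y)) (\<lambda>h. fps_const (D h)) x"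
  unfolding fps_has_derivative_def
proof
  fix n assume "(f has_derivative D) (at x)"
  then show "((\<lambda>y. fps_const (f y) $ n) has_derivative (\<lambda>h. fps_const (D h) $ n)) (at x)"
    by (cases "n = 0") auto
qed

lemma fps_has_derivative_diff:
  "fps_has_derivative F D x \<Longrightarrow> fps_has_derivative G E x \<Longrightarrow> fps_has_derivative (\<lambda>y. F y - G y) (\<lambda>h. D h - E h) x"
  unfolding fps_has_derivative_def by (auto intro!: has_derivative_diff)

lemma fps_has_derivative_mult:
  "fps_has_derivative F D x \<Longrightarrow> fps_has_derivative G E x \<Longrightarrow>
     fps_has_derivative (\<lambda>y. F y * G y) (\<lambda>h. F x * E h + D h * G x) x"
  unfolding fps_has_derivative_def fps_mult_nth fps_add_nth sum.distrib[symmetric]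
  by (auto intro!: has_derivative_sum has_derivative_mult)

lemma fps_has_derivative_power:
  "fps_has_derivative F D x \<Longrightarrow>
     fps_has_derivative (\<lambda>y. F y ^ n) (\<lambda>h. of_nat n * F x ^ (n - 1) * D h) x"
proof (induction n)
  case 0 then show ?case by (simp add: fps_has_derivative_const)
next
  case (Suc n)
  from fps_has_derivative_mult[OF Suc.prems Suc.IH[OF Suc.prems]]
  have "fps_has_derivative (\<lambda>y. F y ^ Suc n) (\<lambda>h. F x * (of_nat n * F x ^ (n - 1) * D h) + D h * F x ^ n) x"
    by simp
  also have "(\<lambda>h. F x * (of_nat n * F x ^ (n - 1) * D h) + D h * F x ^ n) = (\<lambda>h. of_nat (Suc n) * F x ^ (Suc n - 1) * D h)"
    by (cases n) (auto simp: algebra_simps)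
  finally show ?case .
qed

lemma fps_has_derivative_prod:
  assumes "finite I" "\<And>i. i \<in> I \<Longrightarrow> fps_has_derivative (F i) (D i) x"
  shows "fps_has_derivative (\<lambda>y. \<Prod>i\<in>I. F i y) (\<lambda>h. \<Sum>i\<in>I. D i h * (\<Prod>j\<in>I - {i}. F j x)) x"
  using assms
proof (induction I rule: finite_induct)
  case empty then show ?case by (simp add: fps_has_derivative_const)
next
  case (insert i I)
  have "fps_has_derivative (\<lambda>y. F i y * (\<Prod>i\<in>I. F i y))
    (\<lambda>h. F i x * (\<Sum>i\<in>I. D i h * (\<Prod>j\<in>I - {i}. F j x)) + D i h * (\<Prod>i\<in>I. F i x)) x"
    using insert by (intro fps_has_derivative_mult insert.IH) auto
  also have "(\<lambda>h. F i x * (\<Sum>i\<in>I. D i h * (\<Prod>j\<in>I - {i}. F j x)) + D i h * (\<Prod>i\<in>I. F i x))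
    = (\<lambda>h. \<Sum>l\<in>insert i I. D l h * (\<Prod>j\<in>insert i I - {l}. F j x))"
  proof
    fix h
    have "(\<Sum>l\<in>I. D l h * (\<Prod>j\<in>insert i I - {l}. F j x)) = (\<Sum>l\<in>I. F i x * (D l h * (\<Prod>j\<in>I - {l}. F j x)))"
    proof (intro sum.cong refl)
      fix l assume "l \<in> I"
      then have "insert i I - {l} = insert i (I - {l})" using insert by auto
      then show "D l h * (\<Prod>j\<in>insert i I - {l}. F j x) = F i x * (D l h * (\<Prod>j\<in>I - {l}. F j x))"
        using insert by (simp add: mult_ac)
    qed
    moreover have "insert i I - {i} = I" using insert by auto
    ultimately show "F i x * (\<Sum>i\<in>I. D i h * (\<Prod>j\<in>I - {i}. F j x)) + D i h * (\<Prod>i\<in>I. F i x)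
      = (\<Sum>l\<in>insert i I. D l h * (\<Prod>j\<in>insert i I - {l}. F j x))"
      using insert by (simp add: sum_distrib_left add.commute)
  qed
  finally show ?case using insert by simp
qed

lemma fps_has_derivative_unique:
  "fps_has_derivative F D x \<Longrightarrow> fps_has_derivative F E x \<Longrightarrow> D h = E h"
  unfolding fps_has_derivative_def fps_eq_iff using has_derivative_unique by metis

text \<open>N^i starts in degree at least i, so every coefficient of the composition up to degree n
  may be summed over all i up to n. With this common range the two sums can be exchanged.\<close>

lemma fps_compose_mult_nth:
  fixes A N H :: "real fps"
  assumes "N $ 0 = 0"
  shows "((A oo N) * H) $ n = (\<Sum>i=0..n. A $ i * (N ^ i * H) $ n)"
proof -
  have "((A oo N) * H) $ n = (\<Sum>j=0..n. (\<Sum>i=0..n. A $ i * N ^ i $ j) * H $ (n - j))"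
    unfolding fps_mult_nth
  proof (intro sum.cong refl arg_cong2[where f = "(*)"])
    fix j assume j: "j \<in> {0..n}"
    show "(A oo N) $ j = (\<Sum>i=0..n. A $ i * N ^ i $ j)"
      unfolding fps_compose_nth using j assms
      by (intro sum.mono_neutral_left) (auto simp: startsby_zero_power_prefix)
  qed
  also have "\<dots> = (\<Sum>i=0..n. A $ i * (N ^ i * H) $ n)"
    unfolding fps_mult_nth sum_distrib_right sum_distrib_left
    by (subst sum.swap) (simp add: mult_ac)
  finally show ?thesis .
qed

text \<open>Chain rule. Each coefficient of A^(-s) is a finite sum of coefficients of powers of A -
  1, so it is differentiated term by term and the result resummed as A^(-s-1).\<close>

lemma fps_has_derivative_negpow:
  assumes A: "\<And>y. A y $ 0 = 1" and D: "fps_has_derivative A D x"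
  shows "fps_has_derivative (\<lambda>y. fps_negpow s (A y)) (\<lambda>h. fps_const (- s) * fps_negpow (s + 1) (A x) * D h) x"
  unfolding fps_has_derivative_def
proof
  fix n
  \<comment> \<open>The constant term of \<open>A y\<close> is 1 for all y, so its derivative is 0.
    This raises the order of N^n D h above n, which removes the summand i = n below.\<close>
  have D0: "D h $ 0 = 0" for h
  proof -
    have "((\<lambda>y. A y $ 0) has_derivative (\<lambda>h. D h $ 0)) (at x)"
      using D unfolding fps_has_derivative_def by blast
    then have "(\<lambda>h. D h $ 0) = (\<lambda>h. 0)"
      unfolding A by (rule has_derivative_unique[OF _ has_derivative_const])
    then show ?thesis by (rule fun_cong)
  qed
  have pow: "fps_has_derivative (\<lambda>y. (A y - 1) ^ i) (\<lambda>h. of_nat i * (A x - 1) ^ (i - 1) * (D h - 0)) x" for i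
    by (intro fps_has_derivative_power fps_has_derivative_diff D fps_has_derivative_const)
  have "((\<lambda>y. fps_negpow s (A y) $ n) has_derivative
     (\<lambda>h. \<Sum>i=0..n. ((- s) gchoose i) * (of_nat i * (A x - 1) ^ (i - 1) * (D h - 0)) $ n)) (at x)"
    unfolding fps_negpow_def fps_compose_nth fps_binomial_nth
    using pow unfolding fps_has_derivative_def by (intro has_derivative_sum has_derivative_mult_right) auto
  also have "(\<lambda>h. \<Sum>i=0..n. ((- s) gchoose i) * (of_nat i * (A x - 1) ^ (i - 1) * (D h - 0)) $ n) =
    (\<lambda>h. (fps_const (- s) * fps_negpow (s + 1) (A x) * D h) $ n)"
  proof
    fix h
    let ?N = "A x - 1"
    have N0: "?N $ 0 = 0" using A by simp
    have "(fps_const (- s) * fps_negpow (s + 1) (A x) * D h) $ n = - s * (fps_negpow (s + 1) (A x) * D h) $ n"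
      by (simp add: mult.assoc)
    also have "\<dots> = - s * (\<Sum>i=0..n. ((- s - 1) gchoose i) * (?N ^ i * D h) $ n)"
      unfolding fps_negpow_def fps_compose_mult_nth[OF N0] by simp
    also have "(\<Sum>i=0..n. ((- s - 1) gchoose i) * (?N ^ i * D h) $ n) = (\<Sum>i<n. ((- s - 1) gchoose i) * (?N ^ i * D h) $ n)"
    proof -
      have "(?N ^ n * D h) $ n = (\<Sum>i=0..n. ?N ^ n $ i * D h $ (n - i))" by (simp add: fps_mult_nth)
      also have "\<dots> = 0"
        using D0 N0 by (intro sum.neutral) (metis atLeastAtMost_iff diff_self_eq_0 le_neq_implies_less mult_eq_0_iff startsby_zero_power_prefix)
      finally show ?thesis by (simp add: atLeast0AtMost lessThan_Suc_atMost[symmetric])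
    qed
    also have "- s * \<dots> = (\<Sum>i<n. ((- s) gchoose Suc i) * (of_nat (Suc i) * ?N ^ i * D h) $ n)"
      unfolding sum_distrib_left
    proof (intro sum.cong refl)
      fix i
      \<comment> \<open>The absorption identity lowers the upper index to - s - 1, which is where
        the exponent s + 1 comes from.\<close>
      have "((- s) gchoose Suc i) * of_nat (Suc i) = - s * ((- s - 1) gchoose i)"
        using gbinomial_absorption[of i "- s"] by (simp add: mult.commute)
      moreover have "(of_nat (Suc i) * ?N ^ i * D h) $ n = of_nat (Suc i) * (?N ^ i * D h) $ n"
        by (metis fps_mult_left_const_nth fps_of_nat mult.assoc)
      ultimately show "- s * (((- s - 1) gchoose i) * (?N ^ i * D h) $ n) = ((- s) gchoose Suc i) * (of_nat (Suc i) * ?N ^ i * D h) $ n"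
        by (metis mult.assoc)
    qed
    also have "\<dots> = (\<Sum>i=0..n. ((- s) gchoose i) * (of_nat i * ?N ^ (i - 1) * (D h - 0)) $ n)"
      by (simp add: atLeast0AtMost lessThan_Suc_atMost[symmetric] sum.lessThan_Suc_shift del: sum.lessThan_Suc)
    finally show "(\<Sum>i=0..n. ((- s) gchoose i) * (of_nat i * ?N ^ (i - 1) * (D h - 0)) $ n) = (fps_const (- s) * fps_negpow (s + 1) (A x) * D h) $ n" ..
  qed
  finally show "((\<lambda>y. fps_negpow s (A y) $ n) has_derivative (\<lambda>h. (fps_const (- s) * fps_negpow (s + 1) (A x) * D h) $ n)) (at x)" .
qed

section \<open>Chebyshev products and geometric bounds\<close>

text \<open>As polynomials in x both sides are monic of degree k, and they agree at the k points y
  times a k-th root of unity.\<close>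

lemma prod_minus_roots:
  fixes x y :: complex
  assumes k: "k > 0" and y: "y \<noteq> 0"
  shows "(\<Prod>l<k. x - y * cis (2 * pi * real l / real k)) = x ^ k - y ^ k"
proof -
  let ?r = "\<lambda>l. y * cis (2 * pi * real l / real k)"
  define p where "p = (\<Prod>l<k. [:- ?r l, 1:])"
  define q where "q = monom 1 k - [:y ^ k:]"
  have bij: "bij_betw (\<lambda>l. cis (2 * pi * real l / real k)) {..<k} {z. z ^ k = 1}"
    by (rule Complex.bij_betw_roots_unity[OF k])
  have deg_p: "degree p = k" unfolding p_def by (subst degree_prod_eq_sum_degree) auto
  have deg_q: "degree q \<le> k" unfolding q_def by (intro degree_diff_le degree_monom_le) auto
  have "lead_coeff p = 1" unfolding p_def by (subst lead_coeff_prod) auto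
  then have lead: "coeff p k = coeff q k"
    using deg_p k by (simp add: q_def coeff_pCons split: nat.split)
  have card: "card ((*) y ` {z. z ^ k = 1}) = k"
    using y bij_betw_same_card[OF bij] by (subst card_image) (auto simp: inj_on_def)
  have "p = q"
  proof (rule poly_eqI_degree_lead_coeff[OF lead _ _ deg_q])
    show "card ((*) y ` {z. z ^ k = 1}) \<ge> k" using card by simp
    show "degree p \<le> k" using deg_p by simp
    fix z assume "z \<in> (*) y ` {z. z ^ k = 1}"
    then obtain v where v: "z = y * v" "v ^ k = 1" by auto
    then obtain l where l: "l < k" "v = cis (2 * pi * real l / real k)"
      using bij by (auto simp: bij_betw_def image_iff set_eq_iff)
    have "poly p z = 0" unfolding p_def poly_prod using l v(1) by (intro prod_zero) auto
    moreover have "poly q z = 0" using v by (simp add: q_def poly_monom power_mult_distrib)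
    ultimately show "poly p z = poly q z" by simp
  qed
  then have "poly p x = poly q x" by simp
  then show ?thesis by (simp add: p_def q_def poly_prod poly_monom algebra_simps)
qed

lemma two_cos_diff_cis:
  "of_real (2 * (cos \<psi> - cos \<theta>)) = cis (- \<psi>) * ((cis \<psi> - cis \<theta>) * (cis \<psi> - cis (- \<theta>)))"
proof -
  have "cis (- \<psi>) * ((cis \<psi> - cis \<theta>) * (cis \<psi> - cis (- \<theta>))) =
    (cis (- \<psi>) * cis \<psi>) * cis \<psi> - (cis (- \<psi>) * cis \<psi>) * (cis \<theta> + cis (- \<theta>)) + cis (- \<psi>) * (cis \<theta> * cis (- \<theta>))"
    by (simp only: algebra_simps)
  also have "\<dots> = cis \<psi> + cis (- \<psi>) - (cis \<theta> + cis (- \<theta>))" by (simp add: cis_mult)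
  also have "\<dots> = of_real (2 * (cos \<psi> - cos \<theta>))" by (simp add: complex_eq_iff)
  finally show ?thesis ..
qed

text \<open>This is T_k(x) - cos q = 2^(k-1) prod (x - cos ((q + 2 pi l) / k)) at x = cos psi. Every
  cosine difference splits into two factors on the unit circle, and each of the two products runs
  over rotated k-th roots of unity.\<close>

lemma prod_cos_diff:
  assumes k: "k > 0"
  shows "(\<Prod>l<k. cos \<psi> - cos ((q + 2 * pi * real l) / real k)) = 2 / 2 ^ k * (cos (real k * \<psi>) - cos q)"
proof -
  let ?\<theta> = "\<lambda>l. (q + 2 * pi * real l) / real k"
  have k0: "real k \<noteq> 0" using k by simp
  have e: "cis (?\<theta> l) = cis (q / k) * cis (2 * pi * real l / real k)" for l
    by (simp add: cis_mult add_divide_distrib)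
  have c1: "(\<Prod>l<k. cis \<psi> - cis (?\<theta> l)) = cis (real k * \<psi>) - cis q"
    unfolding e using prod_minus_roots[OF k, of "cis (q / k)" "cis \<psi>"] k0 by (simp add: Complex.DeMoivre)
  have "(\<Prod>l<k. cis (- \<psi>) - cis (?\<theta> l)) = cis (real k * (- \<psi>)) - cis q"
    unfolding e using prod_minus_roots[OF k, of "cis (q / k)" "cis (- \<psi>)"] k0 by (simp add: Complex.DeMoivre)
  \<comment> \<open>Conjugation changes the signs of both angles, so the second product follows from
    the formula at - psi.\<close>
  then have "cnj (\<Prod>l<k. cis (- \<psi>) - cis (?\<theta> l)) = cnj (cis (real k * (- \<psi>)) - cis q)" by simp
  then have c2: "(\<Prod>l<k. cis \<psi> - cis (- ?\<theta> l)) = cis (real k * \<psi>) - cis (- q)"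
    by (simp add: cis_cnj cnj_prod)
  have "of_real (2 ^ k * (\<Prod>l<k. cos \<psi> - cos (?\<theta> l))) = (\<Prod>l<k. of_real (2 * (cos \<psi> - cos (?\<theta> l))) :: complex)"
    unfolding of_real_prod[symmetric] prod.distrib by simp
  also have "\<dots> = (\<Prod>l<k. cis (- \<psi>)) * ((\<Prod>l<k. cis \<psi> - cis (?\<theta> l)) * (\<Prod>l<k. cis \<psi> - cis (- ?\<theta> l)))"
    unfolding two_cos_diff_cis prod.distrib ..
  also have "\<dots> = cis (- (real k * \<psi>)) * ((cis (real k * \<psi>) - cis q) * (cis (real k * \<psi>) - cis (- q)))"
    unfolding c1 c2 by (simp add: Complex.DeMoivre)
  also have "\<dots> = of_real (2 * (cos (real k * \<psi>) - cos q))"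
    by (rule two_cos_diff_cis[symmetric])
  finally have "2 ^ k * (\<Prod>l<k. cos \<psi> - cos (?\<theta> l)) = 2 * (cos (real k * \<psi>) - cos q)"
    by (simp only: of_real_eq_iff)
  then show ?thesis by (simp add: field_simps)
qed

text \<open>\<open>poly (hcheb n (c\<^sup>2)) x = (c x)\<^sup>n T\<^sub>n (1 / (c x))\<close> for the Chebyshev polynomial \<open>T\<^sub>n\<close>.\<close>

fun hcheb :: "nat \<Rightarrow> real \<Rightarrow> real poly" where
  "hcheb 0 y = 1"
| "hcheb (Suc 0) y = 1"
| "hcheb (Suc (Suc n)) y = smult 2 (hcheb (Suc n) y) - monom y 2 * hcheb n y"

lemma hcheb_zero: "n > 0 \<Longrightarrow> hcheb n 0 = [:2 ^ n / 2:]"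
  by (induction n "0::real" rule: hcheb.induct) (auto simp: one_pCons)

text \<open>The hypothesis says cos psi = 1 / (c x). The recurrence of \<open>hcheb\<close> is then
  the formula for cos ((n + 2) psi) + cos (n psi), multiplied by (c x)^(n + 2).\<close>

lemma poly_hcheb:
  assumes "c * x * cos \<psi> = 1"
  shows "poly (hcheb n (c\<^sup>2)) x = (c * x) ^ n * cos (real n * \<psi>)"
proof (induction n "c\<^sup>2" rule: hcheb.induct)
  case (3 n)
  have "cos (real (Suc (Suc n)) * \<psi>) + cos (real n * \<psi>) = 2 * cos \<psi> * cos (real (Suc n) * \<psi>)"
    by (subst cos_plus_cos) (simp add: algebra_simps add_divide_distrib)
  then have eq: "cos (real (Suc (Suc n)) * \<psi>) = 2 * cos \<psi> * cos (real (Suc n) * \<psi>) - cos (real n * \<psi>)" by simp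
  have "(c * x) ^ Suc (Suc n) * cos (real (Suc (Suc n)) * \<psi>) =
     2 * (c * x * cos \<psi>) * ((c * x) ^ Suc n * cos (real (Suc n) * \<psi>)) - (c * x) ^ 2 * ((c * x) ^ n * cos (real n * \<psi>))"
    unfolding eq by (simp only: power_Suc power2_eq_square right_diff_distrib mult_ac)
  then show ?case
    using 3 assms by (simp add: poly_monom power_mult_distrib)
qed (use assms in auto)

text \<open>For c > 0 and x >= 1/c the quotient 1 / (c x) is a cosine and
  \<open>prod_cos_diff\<close> applies; infinitely many such x determine the polynomial. The shape
  matters later: q enters through a single term, affine in cos q, and the other part depends on c
  through c^2.\<close>

lemma prod_linear_cos_poly:
  assumes k: "k > 0" and c: "c \<ge> 0"
  shows "(\<Prod>l<k. [:1, - (c * cos ((q + 2 * pi * real l) / real k)):]) =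
     smult (2 / 2 ^ k) (hcheb k (c\<^sup>2) - monom (c ^ k * cos q) k)" (is "?L = ?R")
proof (cases "c = 0")
  case True
  then show ?thesis using k by (simp add: hcheb_zero power_0_left flip: one_pCons)
next
  case False
  then have c: "c > 0" using c by simp
  have eq: "poly ?L x = poly ?R x" if x: "x \<ge> 1 / c" for x
  proof -
    define \<psi> where "\<psi> = arccos (1 / (c * x))"
    have cx: "c * x \<ge> 1" using x c by (simp add: field_simps)
    then have "0 \<le> 1 / (c * x)" "1 / (c * x) \<le> 1" by (auto simp: divide_le_eq_1 intro!: divide_nonneg_nonneg)
    then have cos: "cos \<psi> = 1 / (c * x)" unfolding \<psi>_def
      by (intro cos_arccos) linarith+
    moreover have "c * x \<noteq> 0" using cx by linarith
    ultimately have 1: "c * x * cos \<psi> = 1" by simp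
    have "poly ?L x = (\<Prod>l<k. 1 - x * (c * cos ((q + 2 * pi * real l) / real k)))"
      by (simp add: poly_prod)
    also have "\<dots> = (\<Prod>l<k. (c * x) * (cos \<psi> - cos ((q + 2 * pi * real l) / real k)))"
      by (intro prod.cong refl) (use 1 in \<open>simp add: algebra_simps\<close>)
    also have "\<dots> = (c * x) ^ k * (2 / 2 ^ k * (cos (real k * \<psi>) - cos q))"
      unfolding prod.distrib prod_cos_diff[OF k] by (simp add: power_mult_distrib)
    also have "\<dots> = poly ?R x"
      by (simp add: poly_hcheb[OF 1, of k] poly_monom right_diff_distrib)
         (simp add: power_mult_distrib mult_ac)
    finally show ?thesis .
  qed
  show ?thesis
  proof (rule ccontr)
    assume "?L \<noteq> ?R"
    then have "finite {x. poly (?L - ?R) x = 0}" by (intro poly_roots_finite) auto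
    moreover have "{1 / c..} \<subseteq> {x. poly (?L - ?R) x = 0}" using eq by auto
    ultimately have "finite {1 / c..}" by (rule rev_finite_subset)
    then show False by (simp add: infinite_Ici)
  qed
qed

definition cheb :: "nat \<Rightarrow> real \<Rightarrow> real fps" where "cheb n y = fps_of_poly (hcheb n y)"
lemma cheb_rec [simp]:
  "cheb 0 y = 1" "cheb (Suc 0) y = 1"
  "cheb (Suc (Suc n)) y = fps_const 2 * cheb (Suc n) y - fps_const y * fps_X ^ 2 * cheb n y"
  by (simp_all add: cheb_def fps_of_poly_diff fps_of_poly_mult fps_of_poly_smult fps_of_poly_monom)

text \<open>The derivative of \<open>cheb\<close> in its second argument, obtained by
  differentiating the recurrence.\<close>

fun cheb' :: "nat \<Rightarrow> real \<Rightarrow> real fps" where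
  "cheb' 0 y = 0"
| "cheb' (Suc 0) y = 0"
| "cheb' (Suc (Suc n)) y = fps_const 2 * cheb' (Suc n) y - (fps_X ^ 2 * cheb n y + fps_const y * fps_X ^ 2 * cheb' n y)"

lemma prod_linear_cos:
  assumes "k > 0" "c \<ge> 0"
  shows "(\<Prod>l<k. 1 - fps_const (c * cos ((q + 2 * pi * real l) / real k)) * fps_X) =
     fps_const (2 / 2 ^ k) * (cheb k (c\<^sup>2) - fps_const (c ^ k * cos q) * fps_X ^ k)"
  using arg_cong[OF prod_linear_cos_poly[OF assms, of q], of fps_of_poly]
  by (simp add: cheb_def fps_of_poly_prod fps_of_poly_smult fps_of_poly_diff fps_of_poly_monom fps_of_poly_pCons
     mult.commute[of fps_X] flip: fps_const_neg fps_const_mult)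

lemma cheb_nth_0: "k > 0 \<Longrightarrow> cheb k y $ 0 = 2 ^ k / 2"
  by (induction k y rule: hcheb.induct) auto

lemma fps_has_derivative_cheb:
  assumes f: "(f has_derivative D) (at x)"
  shows "fps_has_derivative (\<lambda>x. cheb n (f x)) (\<lambda>h. cheb' n (f x) * fps_const (D h)) x"
proof (induction n "f x" rule: hcheb.induct)
  case (3 n)
  have "fps_has_derivative (\<lambda>x. fps_const 2 * cheb (Suc n) (f x) - fps_const (f x) * fps_X ^ 2 * cheb n (f x))
    (\<lambda>h. (fps_const 2 * (cheb' (Suc n) (f x) * fps_const (D h)) + 0 * cheb (Suc n) (f x)) -
      ((fps_const (f x) * fps_X ^ 2) * (cheb' n (f x) * fps_const (D h)) +
       (fps_const (f x) * 0 + fps_const (D h) * fps_X ^ 2) * cheb n (f x))) x"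
    by (intro fps_has_derivative_diff fps_has_derivative_mult fps_has_derivative_const fps_has_derivative_fps_const 3 f)
  then show ?case by (simp add: algebra_simps)
qed (simp_all add: fps_has_derivative_const)

lemma fps_scale_X: "(fps_X :: real fps) oo (fps_const t * fps_X) = fps_const t * fps_X"
  by (rule fps_X_fps_compose_startby0) simp

lemma cheb_scale: "cheb n (t\<^sup>2 * y) = cheb n y oo (fps_const t * fps_X)"
  by (induction n y rule: hcheb.induct)
     (simp_all add: fps_compose_sub_distrib fps_compose_mult_distrib fps_compose_power[symmetric]
       fps_scale_X power_mult_distrib fps_const_power mult_ac flip: fps_const_mult)

section \<open>Geometric coefficient bounds, uniform over an index set\<close>

definition geo_bounded :: "'i set \<Rightarrow> ('i \<Rightarrow> real fps) \<Rightarrow> bool" where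
  "geo_bounded S F \<longleftrightarrow> (\<exists>C r. C \<ge> 0 \<and> r \<ge> 0 \<and> (\<forall>i\<in>S. \<forall>n. \<bar>F i $ n\<bar> \<le> C * r ^ n))"

text \<open>The n + 1 summands of the Cauchy product cost at most 2^n, absorbed by doubling the
  common rate. Only the existence of some rate is tracked, since the kernel later divides by a
  factor of factorial size.\<close>

lemma geo_bounded_mult:
  assumes "geo_bounded S F" "geo_bounded S G" shows "geo_bounded S (\<lambda>i. F i * G i)"
proof -
  obtain C r where 1: "C \<ge> 0" "r \<ge> 0" "\<And>i n. i \<in> S \<Longrightarrow> \<bar>F i $ n\<bar> \<le> C * r ^ n"
    using assms(1) unfolding geo_bounded_def by blast
  obtain C' r' where 2: "C' \<ge> 0" "r' \<ge> 0" "\<And>i n. i \<in> S \<Longrightarrow> \<bar>G i $ n\<bar> \<le> C' * r' ^ n"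
    using assms(2) unfolding geo_bounded_def by blast
  define m where "m = max r r'"
  have "\<bar>(F i * G i) $ n\<bar> \<le> (C * C') * (2 * m) ^ n" if "i \<in> S" for i n
  proof -
    have "\<bar>(F i * G i) $ n\<bar> \<le> (\<Sum>j=0..n. \<bar>F i $ j * G i $ (n - j)\<bar>)"
      unfolding fps_mult_nth by (rule sum_abs)
    also have "\<dots> \<le> (\<Sum>j=0..n. (C * m ^ j) * (C' * m ^ (n - j)))"
    proof (intro sum_mono)
      fix j
      have "\<bar>F i $ j\<bar> \<le> C * m ^ j"
        by (rule order.trans[OF 1(3)[OF that, of j]]) (use 1 in \<open>auto simp: m_def intro!: mult_left_mono power_mono\<close>)
      moreover have "\<bar>G i $ (n - j)\<bar> \<le> C' * m ^ (n - j)"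
        by (rule order.trans[OF 2(3)[OF that, of "n - j"]]) (use 2 in \<open>auto simp: m_def intro!: mult_left_mono power_mono\<close>)
      ultimately show "\<bar>F i $ j * G i $ (n - j)\<bar> \<le> (C * m ^ j) * (C' * m ^ (n - j))"
        unfolding abs_mult using 1 by (intro mult_mono) (auto simp: m_def)
    qed
    also have "\<dots> = (\<Sum>j=0..n. C * C' * m ^ n)"
      by (intro sum.cong refl) (simp flip: power_add add: mult_ac)
    also have "\<dots> = C * C' * m ^ n * (real n + 1)" by simp
    also have "\<dots> \<le> C * C' * m ^ n * 2 ^ n"
    proof (intro mult_left_mono)
      show "real n + 1 \<le> 2 ^ n" by (induction n) auto
    qed (use 1 2 in \<open>auto simp: m_def\<close>)
    finally show ?thesis by (simp add: power_mult_distrib mult_ac)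
  qed
  then show ?thesis unfolding geo_bounded_def using 1 2
    by (rule_tac exI[of _ "C * C'"], rule_tac exI[of _ "2 * m"]) (auto simp: m_def)
qed

lemma geo_bounded_add:
  assumes "geo_bounded S F" "geo_bounded S G" shows "geo_bounded S (\<lambda>i. F i + G i)"
proof -
  obtain C r where 1: "C \<ge> 0" "r \<ge> 0" "\<And>i n. i \<in> S \<Longrightarrow> \<bar>F i $ n\<bar> \<le> C * r ^ n"
    using assms(1) unfolding geo_bounded_def by blast
  obtain C' r' where 2: "C' \<ge> 0" "r' \<ge> 0" "\<And>i n. i \<in> S \<Longrightarrow> \<bar>G i $ n\<bar> \<le> C' * r' ^ n"
    using assms(2) unfolding geo_bounded_def by blast
  define m where "m = max r r'"
  have "\<bar>(F i + G i) $ n\<bar> \<le> (C + C') * m ^ n" if "i \<in> S" for i n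
  proof -
    have "\<bar>F i $ n\<bar> \<le> C * m ^ n"
      by (rule order.trans[OF 1(3)[OF that, of n]]) (use 1 in \<open>auto simp: m_def intro!: mult_left_mono power_mono\<close>)
    moreover have "\<bar>G i $ n\<bar> \<le> C' * m ^ n"
      by (rule order.trans[OF 2(3)[OF that, of n]]) (use 2 in \<open>auto simp: m_def intro!: mult_left_mono power_mono\<close>)
    ultimately show ?thesis by (simp add: distrib_right)
  qed
  then show ?thesis unfolding geo_bounded_def using 1 2
    by (rule_tac exI[of _ "C + C'"], rule_tac exI[of _ m]) (auto simp: m_def)
qed

lemma geo_bounded_const:
  assumes "\<And>i. i \<in> S \<Longrightarrow> \<bar>f i\<bar> \<le> K" shows "geo_bounded S (\<lambda>i. fps_const (f i))"
  unfolding geo_bounded_def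
proof (intro exI conjI ballI allI)
  fix i n assume "i \<in> S"
  then show "\<bar>fps_const (f i) $ n\<bar> \<le> \<bar>K\<bar> * 1 ^ n" using assms[of i] by auto
qed auto

lemma geo_bounded_X: "geo_bounded S (\<lambda>i. fps_X)"
  unfolding geo_bounded_def by (intro exI[of _ 1]) (auto simp: fps_X_def)

lemma geo_bounded_X_power: "geo_bounded S (\<lambda>i. fps_X ^ n)"
  unfolding geo_bounded_def by (intro exI[of _ 1]) auto

lemma geo_bounded_diff:
  assumes "geo_bounded S F" "geo_bounded S G" shows "geo_bounded S (\<lambda>i. F i - G i)"
proof -
  have "geo_bounded S (\<lambda>i. F i + fps_const (- 1) * G i)"
    using assms by (intro geo_bounded_add geo_bounded_mult geo_bounded_const[where K = 1]) auto
  then show ?thesis by (simp flip: fps_const_neg)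
qed

lemma geo_bounded_cheb:
  assumes "\<And>i. i \<in> S \<Longrightarrow> \<bar>f i\<bar> \<le> K"
  shows "geo_bounded S (\<lambda>i. cheb n (f i))" "geo_bounded S (\<lambda>i. cheb' n (f i))"
proof -
  have 1: "geo_bounded S (\<lambda>i. 1)" using geo_bounded_const[of S "\<lambda>_. 1" 1] by simp
  have 0: "geo_bounded S (\<lambda>i. 0)" using geo_bounded_const[of S "\<lambda>_. 0" 0] by simp
  have *: "geo_bounded S (\<lambda>i. cheb n (f i)) \<and> geo_bounded S (\<lambda>i. cheb' n (f i))"
    \<comment> \<open>The induction rule of \<open>hcheb\<close> also carries its real argument; a
      dummy stands in for it, as the claim is about all \<open>f i\<close> at once.\<close>
    by (induction n "undefined :: real" rule: hcheb.induct)
       (auto intro!: 1 0 geo_bounded_add geo_bounded_diff geo_bounded_mult geo_bounded_X_power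
          geo_bounded_const[where K = 2] geo_bounded_const[OF assms])
  then show "geo_bounded S (\<lambda>i. cheb n (f i))" "geo_bounded S (\<lambda>i. cheb' n (f i))" by auto
qed

text \<open>The quotient is a product of the factors (s + i) / (i + 1), each at most s + 1.\<close>

lemma pochhammer_over_fact_le:
  assumes "(s::real) \<ge> 0" shows "0 \<le> pochhammer s n / fact n" "pochhammer s n / fact n \<le> (s + 1) ^ n"
proof -
  have eq: "pochhammer s n / fact n = (\<Prod>i=0..<n. (s + real i) / real (Suc i))"
    by (simp add: pochhammer_prod fact_prod_Suc prod_dividef)
  show "0 \<le> pochhammer s n / fact n" unfolding eq using assms by (intro prod_nonneg) auto
  have "(\<Prod>i=0..<n. (s + real i) / real (Suc i)) \<le> (\<Prod>i=0..<n. s + 1)"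
    using assms by (intro prod_mono conjI) (auto simp: field_simps)
  then show "pochhammer s n / fact n \<le> (s + 1) ^ n" unfolding eq by simp
qed

lemma geo_bounded_maj:
  assumes "s \<ge> 0" "\<And>i. i \<in> S \<Longrightarrow> 0 \<le> c i" "\<And>i. i \<in> S \<Longrightarrow> c i \<le> C" "C \<ge> 0"
    and "\<And>i. i \<in> S \<Longrightarrow> fps_maj (F i) (fps_negpow s (1 - fps_const (c i) * fps_X))"
  shows "geo_bounded S F"
  unfolding geo_bounded_def
proof (rule exI[of _ 1], rule exI[of _ "(s + 1) * C"], intro conjI ballI allI)
  fix i n assume i: "i \<in> S"
  have "\<bar>F i $ n\<bar> \<le> pochhammer s n / fact n * c i ^ n"
    using assms(5)[OF i] by (simp add: fps_maj_def fps_negpow_linear_nth)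
  also have "\<dots> \<le> (s + 1) ^ n * C ^ n"
    using i assms pochhammer_over_fact_le[of s n] by (intro mult_mono power_mono) auto
  finally show "\<bar>F i $ n\<bar> \<le> 1 * ((s + 1) * C) ^ n" by (simp add: power_mult_distrib)
qed (use assms in auto)

section \<open>Differentiation under the integral\<close>

text \<open>Instantiated twice, with continuity in (u, v) and with \<open>separated\<close>. The
  coefficients of sums, products and \<open>fps_negpow\<close> are polynomials in the coefficients
  of the arguments, so closure under the ring operations suffices.\<close>

locale function_algebra =
  fixes Q :: "('x \<Rightarrow> real) \<Rightarrow> bool"
  assumes const: "Q (\<lambda>x. c)"
    and add: "Q f \<Longrightarrow> Q g \<Longrightarrow> Q (\<lambda>x. f x + g x)"
    and mult: "Q f \<Longrightarrow> Q g \<Longrightarrow> Q (\<lambda>x. f x * g x)"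
begin

definition coeffs_in :: "('x \<Rightarrow> real fps) \<Rightarrow> bool" where
  "coeffs_in F \<longleftrightarrow> (\<forall>n. Q (\<lambda>x. F x $ n))"

lemma sum: "finite I \<Longrightarrow> (\<And>i. i \<in> I \<Longrightarrow> Q (f i)) \<Longrightarrow> Q (\<lambda>x. \<Sum>i\<in>I. f i x)"
  by (induction I rule: finite_induct) (auto intro: const add)

lemma coeffs_constI: "coeffs_in (\<lambda>x. C)"
  by (auto simp: coeffs_in_def const)

lemma coeffs_fps_constI: "Q f \<Longrightarrow> coeffs_in (\<lambda>x. fps_const (f x))"
  unfolding coeffs_in_def
proof
  fix n assume "Q f" then show "Q (\<lambda>x. fps_const (f x) $ n)"
    by (cases "n = 0") (auto intro: const)
qed

lemma coeffs_addI: "coeffs_in F \<Longrightarrow> coeffs_in G \<Longrightarrow> coeffs_in (\<lambda>x. F x + G x)"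
  by (auto simp: coeffs_in_def add)

lemma coeffs_multI: "coeffs_in F \<Longrightarrow> coeffs_in G \<Longrightarrow> coeffs_in (\<lambda>x. F x * G x)"
  by (auto simp: coeffs_in_def fps_mult_nth intro!: sum mult)

lemma coeffs_diffI: "coeffs_in F \<Longrightarrow> coeffs_in G \<Longrightarrow> coeffs_in (\<lambda>x. F x - G x)"
  using coeffs_addI[OF _ coeffs_multI[OF coeffs_constI[of "- 1"]], of F G] by simp

lemma coeffs_powerI: "coeffs_in F \<Longrightarrow> coeffs_in (\<lambda>x. F x ^ n)"
  by (induction n) (auto intro!: coeffs_constI coeffs_multI)

lemma coeffs_negpowI:
  assumes "coeffs_in F" shows "coeffs_in (\<lambda>x. fps_negpow s (F x))"
proof -
  have "coeffs_in (\<lambda>x. (F x - 1) ^ i)" for i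
    by (intro coeffs_powerI coeffs_diffI assms coeffs_constI)
  then show ?thesis
    by (auto simp: coeffs_in_def fps_negpow_def fps_compose_nth intro!: sum mult const)
qed

lemmas coeffs_intros = coeffs_fps_constI coeffs_constI coeffs_addI coeffs_diffI coeffs_multI coeffs_powerI coeffs_negpowI

end

interpretation cont: function_algebra "\<lambda>f :: real \<times> real \<Rightarrow> real. continuous_on UNIV f"
  by standard (auto intro: continuous_intros)

text \<open>Finite sums of products of a differentiable function of z and a continuous function of
  (u, v). Integrating over (u, v) leaves finitely many constants times functions of z, so
  differentiation under the integral becomes linearity.\<close>

inductive separated :: "(complex \<times> (real \<times> real) \<Rightarrow> real) \<Rightarrow> bool" where
  single: "(\<And>z. (f has_derivative f' z) (at z)) \<Longrightarrow> continuous_on UNIV m \<Longrightarrow> separated (\<lambda>x. f (fst x) * m (snd x))"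
| add: "separated F \<Longrightarrow> separated G \<Longrightarrow> separated (\<lambda>x. F x + G x)"

lemma separated_mult_single:
  assumes "separated G" "\<And>z. (f has_derivative f' z) (at z)" "continuous_on UNIV m"
  shows "separated (\<lambda>x. f (fst x) * m (snd x) * G x)"
  using assms(1)
proof induction
  case (single g g' m')
  have "separated (\<lambda>x. (f (fst x) * g (fst x)) * (m (snd x) * m' (snd x)))"
    by (rule separated.single[of "\<lambda>z. f z * g z" _ "\<lambda>p. m p * m' p"])
       (rule has_derivative_mult[OF assms(2) single(1)], intro continuous_intros assms(3) single(2))
  then show ?case by (simp add: mult_ac)
next
  case (add F G)
  from separated.add[OF add.IH] show ?case by (simp add: distrib_left)
qed

interpretation sep: function_algebra separated
proof
  show "separated (\<lambda>x. c)" for c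
    using separated.single[of "\<lambda>_. c" "\<lambda>_ _. 0" "\<lambda>_. 1"] by simp
  show "separated (\<lambda>x. f x + g x)" if "separated f" "separated g" for f g
    using that by (rule separated.add)
  show "separated (\<lambda>x. f x * g x)" if "separated f" "separated g" for f g
    using that
  proof (induction arbitrary: g)
    case (single f f' m)
    then show ?case by (intro separated_mult_single) auto
  next
    case (add F G)
    from separated.add[OF add.IH[OF add.prems]] show ?case by (simp add: distrib_right)
  qed
qed

lemma separated_fst: "(\<And>z. (f has_derivative f' z) (at z)) \<Longrightarrow> separated (\<lambda>x. f (fst x))"
  using separated.single[of f f' "\<lambda>_. 1"] by simp

lemma separated_snd: "continuous_on UNIV m \<Longrightarrow> separated (\<lambda>x. m (snd x))"
  using separated.single[of "\<lambda>_. 1" "\<lambda>_ _. 0" m] by simp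

lemma separated_has_derivative_integral:
  assumes ab: "a > 0" "b > 0" and "separated G"
    and der: "\<And>p. ((\<lambda>z. G (z, p)) has_derivative (\<lambda>h. G' h p)) (at z)"
  shows "((\<lambda>z. \<integral>p. G (z, p) \<partial>nu2 a b) has_derivative (\<lambda>h. \<integral>p. G' h p \<partial>nu2 a b)) (at z)"
proof -
  \<comment> \<open>The induction carries a derivative of its own, together with the continuity in p
    from which additivity of the integrals follows.\<close>
  have "\<exists>D. (\<forall>z p. ((\<lambda>z. G (z, p)) has_derivative (\<lambda>h. D z h p)) (at z)) \<and>
     (\<forall>z. continuous_on UNIV (\<lambda>p. G (z, p))) \<and> (\<forall>z h. continuous_on UNIV (D z h)) \<and>
     (\<forall>z. ((\<lambda>z. \<integral>p. G (z, p) \<partial>nu2 a b) has_derivative (\<lambda>h. \<integral>p. D z h p \<partial>nu2 a b)) (at z))"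
    using assms(3)
  proof induction
    case (single f f' m)
    show ?case
      by (rule exI[of _ "\<lambda>z h p. f' z h * m p"])
         (auto intro!: has_derivative_mult_left single continuous_intros)
  next
    case (add F G)
    then obtain D E where D: "\<And>z p. ((\<lambda>z. F (z, p)) has_derivative (\<lambda>h. D z h p)) (at z)"
      "\<And>z. continuous_on UNIV (\<lambda>p. F (z, p))" "\<And>z h. continuous_on UNIV (D z h)"
      "\<And>z. ((\<lambda>z. \<integral>p. F (z, p) \<partial>nu2 a b) has_derivative (\<lambda>h. \<integral>p. D z h p \<partial>nu2 a b)) (at z)"
      and E: "\<And>z p. ((\<lambda>z. G (z, p)) has_derivative (\<lambda>h. E z h p)) (at z)"
      "\<And>z. continuous_on UNIV (\<lambda>p. G (z, p))" "\<And>z h. continuous_on UNIV (E z h)"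
      "\<And>z. ((\<lambda>z. \<integral>p. G (z, p) \<partial>nu2 a b) has_derivative (\<lambda>h. \<integral>p. E z h p \<partial>nu2 a b)) (at z)"
      by metis
    have "(\<integral>p. F (z, p) + G (z, p) \<partial>nu2 a b) = (\<integral>p. F (z, p) \<partial>nu2 a b) + (\<integral>p. G (z, p) \<partial>nu2 a b)" for z
      by (intro Bochner_Integration.integral_add integrable_nu2_continuous ab D E)
    moreover have "(\<integral>p. D z h p + E z h p \<partial>nu2 a b) = (\<integral>p. D z h p \<partial>nu2 a b) + (\<integral>p. E z h p \<partial>nu2 a b)" for z h
      by (intro Bochner_Integration.integral_add integrable_nu2_continuous ab D E)
    ultimately show ?case
      by (intro exI[of _ "\<lambda>z h p. D z h p + E z h p"] conjI allI) (auto intro!: has_derivative_add continuous_intros D E)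
  qed
  then obtain D where D: "\<And>p. ((\<lambda>z. G (z, p)) has_derivative (\<lambda>h. D z h p)) (at z)"
    "((\<lambda>z. \<integral>p. G (z, p) \<partial>nu2 a b) has_derivative (\<lambda>h. \<integral>p. D z h p \<partial>nu2 a b)) (at z)"
    by blast
  \<comment> \<open>Uniqueness of derivatives identifies the constructed \<open>D\<close> with the
    prescribed \<open>G'\<close>.\<close>
  have "G' h p = D z h p" for h p
    using fun_cong[OF has_derivative_unique[OF der D(1)]] .
  then show ?thesis using D(2) by simp
qed

definition fps_integral :: "'x measure \<Rightarrow> ('x \<Rightarrow> real fps) \<Rightarrow> real fps" where
  "fps_integral M g = Abs_fps (\<lambda>n. \<integral>p. g p $ n \<partial>M)"

lemma fps_integral_nth [simp]: "fps_integral M g $ n = (\<integral>p. g p $ n \<partial>M)"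
  by (simp add: fps_integral_def)

lemma fps_deriv_integral: "fps_deriv (fps_integral M g) = fps_integral M (\<lambda>p. fps_deriv (g p))"
  by (simp add: fps_eq_iff)

text \<open>With one of u, v fixed, \<open>Af\<close> has this form in the other; this supplies the
  derivative for integration by parts.\<close>

lemma fps_negpow_affine_derivative:
  assumes A: "\<And>x. A x = P - fps_const (d + x * m) * fps_X ^ k" and A0: "\<And>x. A x $ 0 = 1"
  shows "((\<lambda>x. (fps_const g * fps_negpow s (A x)) $ n) has_real_derivative
     (fps_const (s * m * g) * fps_X ^ k * fps_negpow (s + 1) (A x)) $ n) (at x)"
proof -
  have "fps_has_derivative A (\<lambda>h. 0 - (fps_const (d + x * m) * 0 + fps_const (h * m) * fps_X ^ k)) x"
    unfolding A
    by (intro fps_has_derivative_diff fps_has_derivative_mult fps_has_derivative_const fps_has_derivative_fps_const)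
       (auto intro!: derivative_eq_intros)
  then have "fps_has_derivative (\<lambda>x. fps_const g * fps_negpow s (A x))
    (\<lambda>h. fps_const g * (fps_const (- s) * fps_negpow (s + 1) (A x) *
       (0 - (fps_const (d + x * m) * 0 + fps_const (h * m) * fps_X ^ k))) + 0 * fps_negpow s (A x)) x"
    by (intro fps_has_derivative_mult fps_has_derivative_const fps_has_derivative_negpow A0)
  also have "(\<lambda>h. fps_const g * (fps_const (- s) * fps_negpow (s + 1) (A x) *
       (0 - (fps_const (d + x * m) * 0 + fps_const (h * m) * fps_X ^ k))) + 0 * fps_negpow s (A x))
     = (\<lambda>h. fps_const h * (fps_const (s * m * g) * fps_X ^ k * fps_negpow (s + 1) (A x)))"
    unfolding fps_const_mult[symmetric] fps_const_neg[symmetric] by (rule ext) algebra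
  finally have "((\<lambda>x. (fps_const g * fps_negpow s (A x)) $ n) has_derivative
     (\<lambda>h. h * (fps_const (s * m * g) * fps_X ^ k * fps_negpow (s + 1) (A x)) $ n)) (at x)"
    unfolding fps_has_derivative_def fps_mult_left_const_nth by blast
  then show ?thesis by (simp only: has_field_derivative_def mult_commute_abs)
qed

locale dihedral_dunkl =
  fixes k :: nat and a b :: real and w :: complex
  assumes k: "k > 0" and a: "a > 0" and b: "b > 0"
begin

abbreviation J :: "(real \<times> real \<Rightarrow> real fps) \<Rightarrow> real fps" where "J \<equiv> fps_integral (nu2 a b)"

lemma coeff_integrable: "cont.coeffs_in g \<Longrightarrow> integrable (nu2 a b) (\<lambda>p. g p $ n)"
  using a b by (auto simp: cont.coeffs_in_def intro: integrable_nu2_continuous)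

lemma J_add: "cont.coeffs_in f \<Longrightarrow> cont.coeffs_in g \<Longrightarrow> J (\<lambda>p. f p + g p) = J f + J g"
  by (simp add: fps_eq_iff coeff_integrable)

lemma J_diff: "cont.coeffs_in f \<Longrightarrow> cont.coeffs_in g \<Longrightarrow> J (\<lambda>p. f p - g p) = J f - J g"
  by (simp add: fps_eq_iff coeff_integrable)

lemma J_mult_left:
  assumes "cont.coeffs_in g" shows "J (\<lambda>p. C * g p) = C * J g"
proof (rule fps_ext)
  fix n
  have "J (\<lambda>p. C * g p) $ n = (\<integral>p. (\<Sum>i=0..n. C $ i * g p $ (n - i)) \<partial>nu2 a b)"
    by (simp add: fps_mult_nth)
  also have "\<dots> = (\<Sum>i=0..n. \<integral>p. C $ i * g p $ (n - i) \<partial>nu2 a b)"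
    using coeff_integrable[OF assms] by (intro Bochner_Integration.integral_sum) auto
  also have "\<dots> = (C * J g) $ n" by (simp add: fps_mult_nth)
  finally show "J (\<lambda>p. C * g p) $ n = (C * J g) $ n" .
qed

text \<open>\<open>Af z (u, v)\<close> is \<open>A\<^sub>u\<^sub>v(\<tau> z)\<close> as a series in \<open>\<tau>\<close>, where \<open>Pf z\<close> is the part that depends on \<open>|z|\<close> only.
  \<open>Ph g\<close> and \<open>Mh g\<close> integrate \<open>g\<close> against \<open>A\<^bsup>-\<sigma>\<^esup>\<close> and \<open>A\<^bsup>-\<sigma>-1\<^esup>\<close>. Later \<open>hf\<close> is the numerator \<open>h\<close>
  and \<open>Cf z\<close> the series \<open>\<Sum>\<^sub>n c\<^sub>n(z) \<tau>\<^sup>n\<close>. A prefix \<open>d\<close> marks the derivative in \<open>z\<close>.\<close>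

definition pc :: "complex \<Rightarrow> real" where "pc z = 2 / 2 ^ k * Re (z ^ k) * Re (w ^ k)"
definition qc :: "complex \<Rightarrow> real" where "qc z = 2 / 2 ^ k * Im (z ^ k) * Im (w ^ k)"
definition dpc :: "complex \<Rightarrow> complex \<Rightarrow> real" where "dpc z h = 2 / 2 ^ k * Re (of_nat k * z ^ (k - 1) * h) * Re (w ^ k)"
definition dqc :: "complex \<Rightarrow> complex \<Rightarrow> real" where "dqc z h = 2 / 2 ^ k * Im (of_nat k * z ^ (k - 1) * h) * Im (w ^ k)"

definition Pf :: "complex \<Rightarrow> real fps" where
  "Pf z = fps_const (2 / 2 ^ k) * cheb k ((cmod z * cmod w)\<^sup>2)"
definition dPf :: "complex \<Rightarrow> complex \<Rightarrow> real fps" where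
  "dPf z h = fps_const (2 / 2 ^ k) * (cheb' k ((cmod z * cmod w)\<^sup>2) * fps_const (2 * (z \<bullet> h) * (cmod w)\<^sup>2))"

definition Af :: "complex \<Rightarrow> real \<times> real \<Rightarrow> real fps" where
  "Af z p = Pf z - fps_const (snd p * pc z + fst p * qc z) * fps_X ^ k"
definition dAf :: "complex \<Rightarrow> complex \<Rightarrow> real \<times> real \<Rightarrow> real fps" where
  "dAf z h p = dPf z h - fps_const (snd p * dpc z h + fst p * dqc z h) * fps_X ^ k"

lemma has_derivative_power_complex:
  "((\<lambda>z :: complex. z ^ k) has_derivative (\<lambda>h. of_nat k * z ^ (k - 1) * h)) (at z)"
  by (auto intro!: derivative_eq_intros simp: mult_ac)

lemma pc_derivative: "(pc has_derivative dpc z) (at z)"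
  unfolding pc_def[abs_def] dpc_def[abs_def]
  by (intro has_derivative_mult_left has_derivative_mult_right has_derivative_Re has_derivative_power_complex)

lemma qc_derivative: "(qc has_derivative dqc z) (at z)"
  unfolding qc_def[abs_def] dqc_def[abs_def]
  by (intro has_derivative_mult_left has_derivative_mult_right has_derivative_Im has_derivative_power_complex)

text \<open>The squared norm is an inner product, hence differentiable at 0 too, where the norm is
  not.\<close>

lemma ym_derivative: "((\<lambda>z. (cmod z * cmod w)\<^sup>2) has_derivative (\<lambda>h. 2 * (z \<bullet> h) * (cmod w)\<^sup>2)) (at z)"
proof -
  have "((\<lambda>z. (z \<bullet> z) * (cmod w)\<^sup>2) has_derivative (\<lambda>h. (z \<bullet> h + h \<bullet> z) * (cmod w)\<^sup>2)) (at z)"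
    by (intro has_derivative_mult_left has_derivative_inner has_derivative_ident)
  then show ?thesis by (simp add: power_mult_distrib power2_norm_eq_inner inner_commute mult.assoc)
qed

lemma Pf_derivative: "fps_has_derivative Pf (dPf z) z"
  using fps_has_derivative_mult[OF fps_has_derivative_const[of "fps_const (2 / 2 ^ k)"]
    fps_has_derivative_cheb[OF ym_derivative[of z], of k]]
  unfolding Pf_def[abs_def] dPf_def[abs_def] by simp

lemma Af_derivative: "fps_has_derivative (\<lambda>z. Af z p) (\<lambda>h. dAf z h p) z"
proof -
  have "fps_has_derivative (\<lambda>z. fps_const (snd p * pc z + fst p * qc z) * fps_X ^ k)
     (\<lambda>h. fps_const (snd p * pc z + fst p * qc z) * 0 + fps_const (snd p * dpc z h + fst p * dqc z h) * fps_X ^ k) z"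
    by (intro fps_has_derivative_mult fps_has_derivative_const fps_has_derivative_fps_const has_derivative_add
      has_derivative_mult_right pc_derivative qc_derivative)
  from fps_has_derivative_diff[OF Pf_derivative this] show ?thesis
    unfolding Af_def[abs_def] dAf_def[abs_def] by simp
qed

lemma Af_nth_0 [simp]: "Af z p $ 0 = 1"
  using k by (simp add: Af_def Pf_def cheb_nth_0)

lemma Af_separated: "sep.coeffs_in (\<lambda>x. Af (fst x) (snd x))"
proof -
  have "sep.coeffs_in (\<lambda>x. Pf (fst x))"
    unfolding sep.coeffs_in_def
  proof
    fix n show "separated (\<lambda>x. Pf (fst x) $ n)"
      using Pf_derivative unfolding fps_has_derivative_def by (intro separated_fst) blast
  qed
  moreover have "separated (\<lambda>x. pc (fst x))" "separated (\<lambda>x. qc (fst x))"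
    by (rule separated_fst, rule pc_derivative qc_derivative)+
  moreover have "separated (\<lambda>x. fst (snd x))" "separated (\<lambda>x. snd (snd x))"
    by (rule separated_snd[of fst] separated_snd[of snd], intro continuous_intros)+
  ultimately show ?thesis unfolding Af_def
    by (intro sep.coeffs_intros sep.add sep.mult)
qed

lemma Af_cont: "cont.coeffs_in (Af z)"
  unfolding Af_def[abs_def] by (intro cont.coeffs_intros continuous_intros)

lemma dAf_cont: "cont.coeffs_in (dAf z h)"
  unfolding dAf_def[abs_def] by (intro cont.coeffs_intros continuous_intros)

definition Ph :: "(real \<times> real \<Rightarrow> real) \<Rightarrow> complex \<Rightarrow> real fps" where
  "Ph g z = J (\<lambda>p. fps_const (g p) * fps_negpow (a + b) (Af z p))"

definition Mh :: "(real \<times> real \<Rightarrow> real fps) \<Rightarrow> complex \<Rightarrow> real fps" where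
  "Mh g z = J (\<lambda>p. g p * fps_negpow (a + b + 1) (Af z p))"

lemma Mh_add: "cont.coeffs_in f \<Longrightarrow> cont.coeffs_in g \<Longrightarrow> Mh (\<lambda>p. f p + g p) z = Mh f z + Mh g z"
  unfolding Mh_def distrib_right by (intro J_add cont.coeffs_intros Af_cont)

lemma Mh_diff: "cont.coeffs_in f \<Longrightarrow> cont.coeffs_in g \<Longrightarrow> Mh (\<lambda>p. f p - g p) z = Mh f z - Mh g z"
  unfolding Mh_def left_diff_distrib by (intro J_diff cont.coeffs_intros Af_cont)

lemma Mh_mult_left: "cont.coeffs_in g \<Longrightarrow> Mh (\<lambda>p. C * g p) z = C * Mh g z"
  unfolding Mh_def mult.assoc by (intro J_mult_left cont.coeffs_intros Af_cont)

text \<open>A times A^(-sigma-1) is A^(-sigma). With everything written against the common weight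
  A^(-sigma-1), identities between integrals can be checked on the integrands.\<close>

lemma Ph_eq_Mh: "Ph g z = Mh (\<lambda>p. fps_const (g p) * Af z p) z"
  unfolding Ph_def Mh_def by (simp add: fps_mult_negpow mult.assoc)

lemma Ph_derivative:
  assumes g: "continuous_on UNIV g"
  shows "fps_has_derivative (Ph g) (\<lambda>h. Mh (\<lambda>p. fps_const (- (a + b) * g p) * dAf z h p) z) z"
  unfolding fps_has_derivative_def
proof
  fix n
  have "separated (\<lambda>x. (fps_const (g (snd x)) * fps_negpow (a + b) (Af (fst x) (snd x))) $ n)"
    using sep.coeffs_multI[OF sep.coeffs_fps_constI[OF separated_snd[OF g]] sep.coeffs_negpowI[OF Af_separated]]
    unfolding sep.coeffs_in_def by blast
  then have "((\<lambda>z. \<integral>p. (fps_const (g (snd (z, p))) * fps_negpow (a + b) (Af (fst (z, p)) (snd (z, p)))) $ n \<partial>nu2 a b) has_derivative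
      (\<lambda>h. \<integral>p. (fps_const (- (a + b) * g p) * dAf z h p * fps_negpow (a + b + 1) (Af z p)) $ n \<partial>nu2 a b)) (at z)"
  proof (rule separated_has_derivative_integral[OF a b])
    fix p
    have "fps_has_derivative (\<lambda>z. fps_const (g p) * fps_negpow (a + b) (Af z p))
        (\<lambda>h. fps_const (g p) * (fps_const (- (a + b)) * fps_negpow (a + b + 1) (Af z p) * dAf z h p) + 0 * fps_negpow (a + b) (Af z p)) z"
      by (intro fps_has_derivative_mult fps_has_derivative_const fps_has_derivative_negpow Af_derivative) simp
    also have "(\<lambda>h. fps_const (g p) * (fps_const (- (a + b)) * fps_negpow (a + b + 1) (Af z p) * dAf z h p) + 0 * fps_negpow (a + b) (Af z p))
      = (\<lambda>h. fps_const (- (a + b) * g p) * dAf z h p * fps_negpow (a + b + 1) (Af z p))"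
      unfolding fps_const_mult[symmetric] by (simp only: mult_zero_left add_0_right mult_ac)
    finally show "((\<lambda>z. (fps_const (g (snd (z, p))) * fps_negpow (a + b) (Af (fst (z, p)) (snd (z, p)))) $ n) has_derivative
       (\<lambda>h. (fps_const (- (a + b) * g p) * dAf z h p * fps_negpow (a + b + 1) (Af z p)) $ n)) (at z)"
      unfolding fps_has_derivative_def fst_conv snd_conv by blast
  qed
  then show "((\<lambda>y. Ph g y $ n) has_derivative (\<lambda>h. Mh (\<lambda>p. fps_const (- (a + b) * g p) * dAf z h p) z $ n)) (at z)"
    unfolding Ph_def Mh_def fps_integral_nth fst_conv snd_conv .
qed

text \<open>\<open>Af\<close> is affine in u with slope - \<open>qc z\<close> X^k, so the
  u-derivative of A^(-sigma) is sigma \<open>qc z\<close> X^k A^(-sigma-1). Integration by parts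
  trades the factor u for 1 - u^2 and the next weight.\<close>

lemma Ph_by_parts_fst:
  assumes g: "continuous_on UNIV g"
  shows "fps_const (2 * a) * Ph (\<lambda>p. fst p * g (snd p)) z
     = Mh (\<lambda>p. fps_const ((a + b) * qc z * (1 - (fst p)\<^sup>2) * g (snd p)) * fps_X ^ k) z"
proof (rule fps_ext)
  fix n
  let ?G = "\<lambda>p. (fps_const (g (snd p)) * fps_negpow (a + b) (Af z p)) $ n"
  let ?G' = "\<lambda>p. (fps_const ((a + b) * qc z * g (snd p)) * fps_X ^ k * fps_negpow (a + b + 1) (Af z p)) $ n"
  have g': "continuous_on UNIV (\<lambda>p :: real \<times> real. g (snd p))"
    by (rule continuous_on_compose2[OF g]) (auto intro: continuous_intros)
  have c: "cont.coeffs_in (\<lambda>p. fps_const (g (snd p)) * fps_negpow (a + b) (Af z p))"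
    "cont.coeffs_in (\<lambda>p. fps_const ((a + b) * qc z * g (snd p)) * fps_X ^ k * fps_negpow (a + b + 1) (Af z p))"
    by (intro cont.coeffs_intros Af_cont continuous_intros g')+
  have der: "((\<lambda>u. ?G (u, v)) has_real_derivative ?G' (u, v)) (at u)" for u v
    unfolding fst_conv snd_conv
    by (rule fps_negpow_affine_derivative[where P = "Pf z" and d = "v * pc z"]) (simp add: Af_def add.commute, rule Af_nth_0)
  have "(fps_const (2 * a) * Ph (\<lambda>p. fst p * g (snd p)) z) $ n = 2 * a * (\<integral>p. fst p * ?G p \<partial>nu2 a b)"
    by (simp add: Ph_def mult.assoc flip: fps_const_mult)
  also have "\<dots> = (\<integral>p. (1 - (fst p)\<^sup>2) * ?G' p \<partial>nu2 a b)"
    using c der by (intro integral_nu2_by_parts_fst a b) (auto simp: cont.coeffs_in_def)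
  also have "\<dots> = Mh (\<lambda>p. fps_const ((a + b) * qc z * (1 - (fst p)\<^sup>2) * g (snd p)) * fps_X ^ k) z $ n"
    unfolding Mh_def fps_integral_nth
    by (intro Bochner_Integration.integral_cong refl) (simp only: fps_mult_left_const_nth[symmetric] fps_const_mult[symmetric] mult_ac)
  finally show "(fps_const (2 * a) * Ph (\<lambda>p. fst p * g (snd p)) z) $ n = \<dots>" .
qed

lemma Ph_by_parts_snd:
  assumes g: "continuous_on UNIV g"
  shows "fps_const (2 * b) * Ph (\<lambda>p. snd p * g (fst p)) z
     = Mh (\<lambda>p. fps_const ((a + b) * pc z * (1 - (snd p)\<^sup>2) * g (fst p)) * fps_X ^ k) z"
proof (rule fps_ext)
  fix n
  let ?G = "\<lambda>p. (fps_const (g (fst p)) * fps_negpow (a + b) (Af z p)) $ n"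
  let ?G' = "\<lambda>p. (fps_const ((a + b) * pc z * g (fst p)) * fps_X ^ k * fps_negpow (a + b + 1) (Af z p)) $ n"
  have g': "continuous_on UNIV (\<lambda>p :: real \<times> real. g (fst p))"
    by (rule continuous_on_compose2[OF g]) (auto intro: continuous_intros)
  have c: "cont.coeffs_in (\<lambda>p. fps_const (g (fst p)) * fps_negpow (a + b) (Af z p))"
    "cont.coeffs_in (\<lambda>p. fps_const ((a + b) * pc z * g (fst p)) * fps_X ^ k * fps_negpow (a + b + 1) (Af z p))"
    by (intro cont.coeffs_intros Af_cont continuous_intros g')+
  have der: "((\<lambda>v. ?G (u, v)) has_real_derivative ?G' (u, v)) (at v)" for u v
    unfolding fst_conv snd_conv
    by (rule fps_negpow_affine_derivative[where P = "Pf z" and d = "u * qc z"]) (simp add: Af_def add.commute, rule Af_nth_0)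
  have "(fps_const (2 * b) * Ph (\<lambda>p. snd p * g (fst p)) z) $ n = 2 * b * (\<integral>p. snd p * ?G p \<partial>nu2 a b)"
    by (simp add: Ph_def mult.assoc flip: fps_const_mult)
  also have "\<dots> = (\<integral>p. (1 - (snd p)\<^sup>2) * ?G' p \<partial>nu2 a b)"
    using c der by (intro integral_nu2_by_parts_snd a b) (auto simp: cont.coeffs_in_def)
  also have "\<dots> = Mh (\<lambda>p. fps_const ((a + b) * pc z * (1 - (snd p)\<^sup>2) * g (fst p)) * fps_X ^ k) z $ n"
    unfolding Mh_def fps_integral_nth
    by (intro Bochner_Integration.integral_cong refl) (simp only: fps_mult_left_const_nth[symmetric] fps_const_mult[symmetric] mult_ac)
  finally show "(fps_const (2 * b) * Ph (\<lambda>p. snd p * g (fst p)) z) $ n = \<dots>" .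
qed

end

section \<open>The generating series\<close>

text \<open>A single factor F = 1 - c X satisfies X F' = F - 1, hence 1 - X F' / F = 1 / F;
  logarithmic derivatives of the factors add up.\<close>

lemma fps_X_deriv_prod_linear:
  fixes c :: "'i \<Rightarrow> real"
  assumes "finite I"
  shows "of_nat (card I) * (\<Prod>i\<in>I. 1 - fps_const (c i) * fps_X) - fps_X * fps_deriv (\<Prod>i\<in>I. 1 - fps_const (c i) * fps_X)
     = (\<Prod>i\<in>I. 1 - fps_const (c i) * fps_X) * (\<Sum>i\<in>I. inverse (1 - fps_const (c i) * fps_X))"
  using assms
proof (induction I rule: finite_induct)
  case (insert i I)
  define F where "F = 1 - fps_const (c i) * fps_X"
  define P where "P = (\<Prod>i\<in>I. 1 - fps_const (c i) * fps_X)"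
  define S where "S = (\<Sum>i\<in>I. inverse (1 - fps_const (c i) * fps_X))"
  have inv: "F * inverse F = 1" unfolding F_def by (rule inverse_mult_eq_1') simp
  have XF: "fps_X * fps_deriv F = F - 1" unfolding F_def by (simp add: mult.commute)
  have IH: "fps_X * fps_deriv P = of_nat (card I) * P - P * S"
    using insert.IH unfolding P_def S_def by (simp add: algebra_simps)
  have "of_nat (Suc (card I)) * (F * P) - fps_X * fps_deriv (F * P) =
     of_nat (card I) * (F * P) + F * P - F * (fps_X * fps_deriv P) - (fps_X * fps_deriv F) * P"
    by (simp add: algebra_simps)
  also have "\<dots> = F * P * S + (F * inverse F) * P"
    unfolding XF IH inv by (simp add: algebra_simps)
  finally show ?case
    using insert unfolding F_def P_def S_def by (simp add: algebra_simps)
qed auto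

lemma fps_deriv_negpow':
  assumes "A $ 0 = 1"
  shows "fps_deriv (fps_negpow s A) = fps_const (- s) * fps_deriv A * fps_negpow (s + 1) A"
proof -
  have "A * fps_deriv (fps_negpow s A) = A * (fps_const (- s) * fps_deriv A * fps_negpow (s + 1) A)"
    unfolding fps_deriv_negpow[OF assms] using fps_mult_negpow[OF assms, of s] by (metis (no_types, lifting) mult.left_commute)
  moreover have "A \<noteq> 0" using assms by auto
  ultimately show ?thesis by simp
qed

context dihedral_dunkl
begin

definition hf :: "real \<times> real \<Rightarrow> real" where
  "hf p = 1 - (a - b) / (a + b) * fst p + (a - b) / (a + b) * snd p - fst p * snd p"

text \<open>Splits the numerator between the two classes: the products weighted by \<open>a\<close>
  and \<open>b\<close> are those that remain in \<open>Ph_reflect_fst\<close> and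
  \<open>Ph_reflect_snd\<close>.\<close>

lemma hf_scaled: "(a + b) * hf p = a * ((1 - fst p) * (1 + snd p)) + b * ((1 + fst p) * (1 - snd p))"
proof -
  have d: "(a + b) * ((a - b) / (a + b)) = a - b" using a b by simp
  have "(a + b) * hf p = (a + b) - ((a + b) * ((a - b) / (a + b))) * fst p
     + ((a + b) * ((a - b) / (a + b))) * snd p - (a + b) * (fst p * snd p)"
    unfolding hf_def by (simp only: distrib_left right_diff_distrib mult.assoc mult_1_right)
  then show ?thesis unfolding d by (simp add: algebra_simps)
qed

lemma hf_cont: "continuous_on UNIV hf" "continuous_on UNIV (\<lambda>p. hf (- fst p, snd p))" "continuous_on UNIV (\<lambda>p. hf (fst p, - snd p))"
  unfolding hf_def[abs_def] fst_conv snd_conv by (intro continuous_intros)+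

lemma Ph_add: "continuous_on UNIV f \<Longrightarrow> continuous_on UNIV g \<Longrightarrow> Ph (\<lambda>p. f p + g p) z = Ph f z + Ph g z"
  unfolding Ph_def fps_const_add[symmetric] distrib_right by (intro J_add cont.coeffs_intros Af_cont)

lemma Ph_diff: "continuous_on UNIV f \<Longrightarrow> continuous_on UNIV g \<Longrightarrow> Ph (\<lambda>p. f p - g p) z = Ph f z - Ph g z"
  unfolding Ph_def fps_const_sub[symmetric] left_diff_distrib by (intro J_diff cont.coeffs_intros Af_cont)

lemma Ph_cmult: "continuous_on UNIV g \<Longrightarrow> Ph (\<lambda>p. c * g p) z = fps_const c * Ph g z"
  unfolding Ph_def fps_const_mult[symmetric] mult.assoc by (intro J_mult_left cont.coeffs_intros Af_cont)

text \<open>The corner value differs from A at (u, v) by X^k times p (v - e) + q (u + e), with p =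
  \<open>pc z\<close> and q = \<open>qc z\<close>. Multiplied by (1 - e u)(1 + e v), these
  differences acquire the factors 1 - v^2 and 1 - u^2, exactly what integration by parts turns back
  into integrals against A^(-sigma). So a corner value times an integral with weight A^(-sigma-1) is
  again an integral with weight A^(-sigma).\<close>

lemma Ph_corner:
  assumes e: "e = 1 \<or> e = - 1"
  shows "fps_const (a + b) * (Af z (- e, e) * Mh (\<lambda>p. fps_const ((1 - e * fst p) * (1 + e * snd p))) z)
    = Ph (\<lambda>p. (a + b) * (1 + fst p * snd p) + e * (a - b) * (fst p + snd p)) z"
proof -
  let ?X = "fps_X ^ k :: real fps"
  let ?g = "\<lambda>p :: real \<times> real. (1 - e * fst p) * (1 + e * snd p)"
  let ?v = "\<lambda>p :: real \<times> real. snd p * (e * (1 - e * fst p))"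
  let ?u = "\<lambda>p :: real \<times> real. fst p * (e * (1 + e * snd p))"
  have "fps_const (a + b) * (Af z (- e, e) * Mh (\<lambda>p. fps_const (?g p)) z)
    = Mh (\<lambda>p. fps_const (a + b) * Af z (- e, e) * fps_const (?g p)) z"
    unfolding mult.assoc[symmetric] by (intro Mh_mult_left[symmetric] cont.coeffs_intros continuous_intros)
  also have "\<dots> = Mh (\<lambda>p. (fps_const ((a + b) * ?g p) * Af z p
       - fps_const ((a + b) * pc z * (1 - (snd p)\<^sup>2) * (e * (1 - e * fst p))) * ?X)
       + fps_const ((a + b) * qc z * (1 - (fst p)\<^sup>2) * (e * (1 + e * snd p))) * ?X) z"
  proof (rule arg_cong2[where f = Mh, OF _ refl], rule ext)
    fix p :: "real \<times> real"
    \<comment> \<open>From e^2 = 1: (1 + e v)(v - e) = - e (1 - v^2) and (1 - e u)(u + e) = e (1 -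
      u^2).\<close>
    have r: "(a + b) * qc z * (1 - (fst p)\<^sup>2) * (e * (1 + e * snd p)) = (a + b) * pc z * (1 - (snd p)\<^sup>2) * (e * (1 - e * fst p))
      + (a + b) * ?g p * (snd p * pc z + fst p * qc z - (e * pc z + - e * qc z))"
      using e by (auto simp: algebra_simps power2_eq_square)
    show "fps_const (a + b) * Af z (- e, e) * fps_const (?g p) = (fps_const ((a + b) * ?g p) * Af z p
       - fps_const ((a + b) * pc z * (1 - (snd p)\<^sup>2) * (e * (1 - e * fst p))) * ?X)
       + fps_const ((a + b) * qc z * (1 - (fst p)\<^sup>2) * (e * (1 + e * snd p))) * ?X"
      unfolding r Af_def fst_conv snd_conv
      by (simp only: fps_const_mult[symmetric] fps_const_add[symmetric] fps_const_sub[symmetric], algebra)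
  qed
  also have "\<dots> = (Mh (\<lambda>p. fps_const ((a + b) * ?g p) * Af z p) z
       - Mh (\<lambda>p. fps_const ((a + b) * pc z * (1 - (snd p)\<^sup>2) * (e * (1 - e * fst p))) * ?X) z)
       + Mh (\<lambda>p. fps_const ((a + b) * qc z * (1 - (fst p)\<^sup>2) * (e * (1 + e * snd p))) * ?X) z"
    by (subst Mh_add Mh_diff, (intro cont.coeffs_intros continuous_intros Af_cont)+)+ (rule refl)
  also have "\<dots> = Ph (\<lambda>p. (a + b) * ?g p) z - fps_const (2 * b) * Ph ?v z + fps_const (2 * a) * Ph ?u z"
    unfolding Ph_eq_Mh[of "\<lambda>p. (a + b) * ?g p"]
    by (subst Ph_by_parts_snd[of "\<lambda>u. e * (1 - e * u)"], intro continuous_intros,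
        subst Ph_by_parts_fst[of "\<lambda>v. e * (1 + e * v)"], intro continuous_intros) (rule refl)
  also have "\<dots> = Ph (\<lambda>p. (a + b) * ?g p) z - Ph (\<lambda>p. (2 * b) * ?v p) z + Ph (\<lambda>p. (2 * a) * ?u p) z"
    by (intro arg_cong2[where f = "(+)"] arg_cong2[where f = "(-)"] refl Ph_cmult[symmetric] continuous_intros)
  also have "\<dots> = Ph (\<lambda>p. (a + b) * ?g p - (2 * b) * ?v p) z + Ph (\<lambda>p. (2 * a) * ?u p) z"
    by (intro arg_cong2[where f = "(+)"] refl Ph_diff[symmetric] continuous_intros)
  also have "\<dots> = Ph (\<lambda>p. (a + b) * ?g p - (2 * b) * ?v p + (2 * a) * ?u p) z"
    by (intro Ph_add[symmetric] continuous_intros)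
  also have "(\<lambda>p. (a + b) * ?g p - (2 * b) * ?v p + (2 * a) * ?u p)
    = (\<lambda>p. (a + b) * (1 + fst p * snd p) + e * (a - b) * (fst p + snd p))"
    using e by (auto simp: fun_eq_iff algebra_simps)
  finally show ?thesis .
qed

text \<open>Times a + b, the reflected numerator is the integrand on the right of
  \<open>Ph_corner\<close> for e = 1. The factor in front is the product of 1 - <rho z, w> X over
  the even class, ready to cancel the denominators that these reflections create.\<close>

lemma Ph_reflect_fst:
  "Ph (\<lambda>p. hf (- fst p, snd p)) z = Af z (-1, 1) * Mh (\<lambda>p. fps_const ((1 - fst p) * (1 + snd p))) z"
proof -
  have "fps_const (a + b) * Ph (\<lambda>p. hf (- fst p, snd p)) z = Ph (\<lambda>p. (a + b) * hf (- fst p, snd p)) z"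
    by (intro Ph_cmult[symmetric] hf_cont)
  also have "\<dots> = fps_const (a + b) * (Af z (-1, 1) * Mh (\<lambda>p. fps_const ((1 - fst p) * (1 + snd p))) z)"
    using Ph_corner[of 1 z] unfolding hf_scaled by (simp add: algebra_simps)
  finally show ?thesis using a b by (simp del: fps_const_add)
qed

lemma Ph_reflect_snd:
  "Ph (\<lambda>p. hf (fst p, - snd p)) z = Af z (1, -1) * Mh (\<lambda>p. fps_const ((1 + fst p) * (1 - snd p))) z"
proof -
  have "fps_const (a + b) * Ph (\<lambda>p. hf (fst p, - snd p)) z = Ph (\<lambda>p. (a + b) * hf (fst p, - snd p)) z"
    by (intro Ph_cmult[symmetric] hf_cont)
  also have "\<dots> = fps_const (a + b) * (Af z (1, -1) * Mh (\<lambda>p. fps_const ((1 + fst p) * (1 - snd p))) z)"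
    using Ph_corner[of "-1" z] unfolding hf_scaled by (simp add: algebra_simps)
  finally show ?thesis using a b by (simp del: fps_const_add)
qed

definition Rf :: "complex \<Rightarrow> real fps" where "Rf z = of_nat k * Pf z - fps_X * fps_deriv (Pf z)"

text \<open>The operator k - X d/dX annihilates X^k, the one term that carries the dependence on (u,
  v).\<close>

lemma Af_Rf: "of_nat k * Af z p - fps_X * fps_deriv (Af z p) = Rf z"
proof -
  have "fps_X * fps_deriv (fps_const c * fps_X ^ k) = of_nat k * (fps_const c * fps_X ^ k)" for c :: real
    using k by (simp add: fps_deriv_power fps_of_nat power_Suc[symmetric] mult_ac flip: fps_of_nat)
  then show ?thesis unfolding Rf_def Af_def by (simp add: algebra_simps)
qed

lemma X_deriv_Ph:
  "fps_X * fps_deriv (Ph hf z) = Mh (\<lambda>p. fps_const (- (a + b) * hf p) * (fps_X * fps_deriv (Af z p))) z"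
proof -
  have c: "cont.coeffs_in (\<lambda>p. fps_const (- (a + b) * hf p) * fps_deriv (Af z p))"
    using Af_cont[of z] unfolding cont.coeffs_in_def
    by (auto intro!: continuous_intros hf_cont(1))
  have "fps_deriv (Ph hf z) = Mh (\<lambda>p. fps_const (- (a + b) * hf p) * fps_deriv (Af z p)) z"
    unfolding Ph_def Mh_def fps_deriv_integral
    by (rule arg_cong[where f = J], rule ext)
       (simp only: fps_deriv_mult fps_deriv_const fps_deriv_negpow'[OF Af_nth_0] fps_const_mult[symmetric], algebra)
  then have "fps_X * fps_deriv (Ph hf z) = Mh (\<lambda>p. fps_X * (fps_const (- (a + b) * hf p) * fps_deriv (Af z p))) z"
    using Mh_mult_left[OF c, of fps_X] by simp
  then show ?thesis by (simp only: mult.left_commute)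
qed

section \<open>Corner values as products over a reflection class\<close>

lemma cinner_dih_refl_polar:
  assumes "z = of_real (cmod z) * cis \<phi>1" "w = of_real (cmod w) * cis \<phi>2"
  shows "cinner (dih_refl k j z) w = cmod z * cmod w * cos ((- (real k * (\<phi>1 + \<phi>2)) + real j * pi) / real k)"
proof -
  have c: "cis (- \<phi>1) * cis (real j * pi / real k) * cis (- \<phi>2) = cis ((- (real k * (\<phi>1 + \<phi>2)) + real j * pi) / real k)"
    using k by (simp add: cis_mult field_simps)
  have "dih_refl k j z * cnj w = of_real (cmod z * cmod w) * (cis (- \<phi>1) * cis (real j * pi / real k) * cis (- \<phi>2))"
  proof -
    have "dih_refl k j z = cnj z * cis (real j * pi / real k)" by (simp only: dih_refl_def cis_conv_exp)
    also have "cnj z = of_real (cmod z) * cis (- \<phi>1)" by (subst assms(1)) (simp add: cis_cnj)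
    moreover have "cnj w = of_real (cmod w) * cis (- \<phi>2)" by (subst assms(2)) (simp add: cis_cnj)
    ultimately show ?thesis by (simp only: of_real_mult mult_ac)
  qed
  then show ?thesis unfolding cinner_def c by simp
qed

lemma polar_power:
  assumes "z = of_real (cmod z) * cis \<phi>"
  shows "Re (z ^ n) = cmod z ^ n * cos (real n * \<phi>)" "Im (z ^ n) = cmod z ^ n * sin (real n * \<phi>)"
proof -
  have "z ^ n = of_real (cmod z ^ n) * cis (real n * \<phi>)"
    by (subst assms) (simp add: power_mult_distrib Complex.DeMoivre)
  then show "Re (z ^ n) = cmod z ^ n * cos (real n * \<phi>)" "Im (z ^ n) = cmod z ^ n * sin (real n * \<phi>)"
    by simp_all
qed

text \<open>Any angle with the right cosine is allowed, so the factorisation serves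
  \<open>q_uv\<close> on the square as well as explicit angles at the corners.\<close>

lemma Af_eq_prod:
  assumes "z = of_real (cmod z) * cis \<phi>1" "w = of_real (cmod w) * cis \<phi>2"
    and q: "cos q = xi_uv (fst p) (snd p) (real k * \<phi>1) (real k * \<phi>2)"
  shows "Af z p = (\<Prod>l<k. 1 - fps_const (cmod z * cmod w * cos ((q + 2 * pi * real l) / real k)) * fps_X)"
proof -
  have "2 / 2 ^ k * ((cmod z * cmod w) ^ k * cos q) = snd p * pc z + fst p * qc z"
    unfolding q xi_uv_def pc_def qc_def polar_power[OF assms(1)] polar_power[OF assms(2)]
    by (simp add: algebra_simps power_mult_distrib)
  then show ?thesis
    unfolding Af_def Pf_def prod_linear_cos[OF k mult_nonneg_nonneg[OF norm_ge_zero norm_ge_zero]] right_diff_distrib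
    by (simp only: mult.assoc[symmetric] fps_const_mult)
qed

lemma polar_Arg: "z = of_real (cmod z) * cis (Arg z)"
  using rcis_cmod_Arg[of z] by (simp add: rcis_def)

text \<open>Here xi is the cosine of the sum of the two angles, so q = - k (Arg z + Arg w) is
  admissible; the angles (q + 2 pi l) / k are then those of the reflections j = 2 l.\<close>

lemma Af_corner_fst:
  "Af z (-1, 1) = (\<Prod>l<k. 1 - fps_const (cinner (dih_refl k (2 * l) z) w) * fps_X)"
proof -
  let ?q = "- (real k * (Arg z + Arg w))"
  have "cos ?q = xi_uv (fst (-1, 1)) (snd (-1, 1)) (real k * Arg z) (real k * Arg w)"
    unfolding cos_minus distrib_left cos_add xi_uv_def by simp
  from Af_eq_prod[OF polar_Arg polar_Arg this] show ?thesis
    unfolding cinner_dih_refl_polar[OF polar_Arg polar_Arg] by (simp add: mult_ac)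
qed

text \<open>At the opposite corner xi is minus that cosine; the shift of q by pi accounts for the
  sign and selects the odd reflections.\<close>

lemma Af_corner_snd:
  "Af z (1, -1) = (\<Prod>l<k. 1 - fps_const (cinner (dih_refl k (2 * l + 1) z) w) * fps_X)"
proof -
  let ?q = "- (real k * (Arg z + Arg w)) + pi"
  have "cos ?q = xi_uv (fst (1, -1)) (snd (1, -1)) (real k * Arg z) (real k * Arg w)"
    unfolding cos_periodic_pi cos_minus distrib_left unfolding cos_add xi_uv_def by simp
  from Af_eq_prod[OF polar_Arg polar_Arg this] show ?thesis
    unfolding cinner_dih_refl_polar[OF polar_Arg polar_Arg] by (simp add: algebra_simps)
qed

text \<open>The logarithmic derivatives of the two corner products turn the reflection sums of the
  factor \<open>1 / (1 - \<langle>z, w\<rangle> \<tau>)\<close> into derivatives of \<open>Af\<close>.\<close>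

lemma corner_log_derivative:
  assumes A: "\<And>z. Af z p = (\<Prod>l<k. 1 - fps_const (cinner (dih_refl k (j l) z) w) * fps_X)"
  shows "Af z p * (\<Sum>l<k. fps_const (cinner \<xi> w - cinner (dih_refl k (j l) \<xi>) w) * fps_X *
       inverse (1 - fps_const (cinner (dih_refl k (j l) z) w) * fps_X))
     = fps_const (cinner \<xi> w) * fps_X * Rf z + dAf z \<xi> p"
proof -
  let ?F = "\<lambda>l z. 1 - fps_const (cinner (dih_refl k (j l) z) w) * fps_X"
  have der: "fps_has_derivative (?F l) (\<lambda>h. - (fps_const (cinner (dih_refl k (j l) h) w) * fps_X)) z" for l
  proof -
    have "((\<lambda>z. cinner (dih_refl k (j l) z) w) has_derivative (\<lambda>h. cinner (dih_refl k (j l) h) w)) (at z)"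
      unfolding dih_refl_def cinner_def
      by (intro has_derivative_Re has_derivative_mult_left has_derivative_cnj has_derivative_ident)
    then have "fps_has_derivative (?F l) (\<lambda>h. 0 - (fps_const (cinner (dih_refl k (j l) z) w) * 0 + fps_const (cinner (dih_refl k (j l) h) w) * fps_X)) z"
      by (intro fps_has_derivative_diff fps_has_derivative_mult fps_has_derivative_const fps_has_derivative_fps_const)
    then show ?thesis by simp
  qed
  have inv: "?F l z * inverse (?F l z) = 1" for l by (rule inverse_mult_eq_1') simp
  \<comment> \<open>Two derivatives of the same function are compared: the closed form
    \<open>dAf\<close> and the product rule over the linear factors.\<close>
  have "dAf z \<xi> p = (\<Sum>l<k. - (fps_const (cinner (dih_refl k (j l) \<xi>) w) * fps_X) * (\<Prod>i\<in>{..<k} - {l}. ?F i z))"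
    using fps_has_derivative_unique[OF Af_derivative[of p z, unfolded A] fps_has_derivative_prod[OF _ der]] by simp
  also have "\<dots> = (\<Sum>l<k. - (fps_const (cinner (dih_refl k (j l) \<xi>) w) * fps_X) * (Af z p * inverse (?F l z)))"
  proof (intro sum.cong refl arg_cong2[where f = "(*)"])
    fix l assume "l \<in> {..<k}"
    then have "Af z p = ?F l z * (\<Prod>i\<in>{..<k} - {l}. ?F i z)"
      unfolding A by (subst prod.remove[of _ l]) auto
    then have "Af z p * inverse (?F l z) = (?F l z * inverse (?F l z)) * (\<Prod>i\<in>{..<k} - {l}. ?F i z)"
      by (simp only: mult_ac)
    then show "(\<Prod>i\<in>{..<k} - {l}. ?F i z) = Af z p * inverse (?F l z)" unfolding inv by simp
  qed
  finally have d: "dAf z \<xi> p = \<dots>" .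
  \<comment> \<open>\<open>Rf\<close> is independent of the point of the square, so it can be
    computed at the corner, where A is a product.\<close>
  have R: "Rf z = Af z p * (\<Sum>l<k. inverse (?F l z))"
    using Af_Rf[of z p] fps_X_deriv_prod_linear[of "{..<k}" "\<lambda>l. cinner (dih_refl k (j l) z) w"] unfolding A by simp
  show ?thesis unfolding d R sum_distrib_left sum.distrib[symmetric]
    by (intro sum.cong refl) (simp only: fps_const_sub[symmetric], algebra)
qed

text \<open>z^k becomes its conjugate for even j and minus its conjugate for odd j. So an even
  reflection negates Im (z^k), the coefficient of u, and an odd one Re (z^k), the coefficient of
  v.\<close>

lemma Af_dih_refl: "Af (dih_refl k j z) p = (if even j then Af z (- fst p, snd p) else Af z (fst p, - snd p))"
proof -
  have "Re (dih_refl k j z ^ k) = (-1) ^ j * Re (z ^ k)" "Im (dih_refl k j z ^ k) = - ((-1) ^ j * Im (z ^ k))"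
    using k by (cases "even j"; simp add: dih_refl_power flip: complex_cnj_power)+
  moreover have "cmod (dih_refl k j z) = cmod z"
    by (simp add: dih_refl_def norm_mult)
  ultimately show ?thesis by (simp add: Af_def Pf_def pc_def qc_def)
qed

text \<open>The sign flip of u or v in \<open>Af\<close> is undone by the symmetry of the measures
  and reappears in the numerator.\<close>

lemma Ph_dih_refl:
  assumes g: "continuous_on UNIV g"
  shows "Ph g (dih_refl k j z) = Ph (\<lambda>p. if even j then g (- fst p, snd p) else g (fst p, - snd p)) z"
proof (rule fps_ext)
  fix n
  let ?G = "\<lambda>p. (fps_const (if even j then g (- fst p, snd p) else g (fst p, - snd p)) * fps_negpow (a + b) (Af z p)) $ n"
  have "continuous_on UNIV (\<lambda>p. if even j then g (- fst p, snd p) else g (fst p, - snd p))"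
    by (cases "even j") (auto intro!: continuous_on_compose2[OF g] continuous_intros)
  then have "cont.coeffs_in (\<lambda>p. fps_const (if even j then g (- fst p, snd p) else g (fst p, - snd p)) * fps_negpow (a + b) (Af z p))"
    by (intro cont.coeffs_intros Af_cont)
  then have G: "continuous_on UNIV ?G" by (auto simp: cont.coeffs_in_def)
  have "Ph g (dih_refl k j z) $ n = (\<integral>p. ?G (if even j then (- fst p, snd p) else (fst p, - snd p)) \<partial>nu2 a b)"
    unfolding Ph_def fps_integral_nth Af_dih_refl by (cases "even j") simp_all
  also have "\<dots> = (\<integral>p. ?G p \<partial>nu2 a b)"
    using integral_nu2_reflect_fst[OF a b G] integral_nu2_reflect_snd[OF a b G] by (cases "even j") simp_all
  finally show "Ph g (dih_refl k j z) $ n = Ph (\<lambda>p. if even j then g (- fst p, snd p) else g (fst p, - snd p)) z $ n"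
    by (simp add: Ph_def)
qed

end

section \<open>The Dunkl equation for the generating series\<close>

lemma sum_lessThan_even_odd:
  fixes k :: nat and f :: "nat \<Rightarrow> 'a :: comm_monoid_add"
  shows "(\<Sum>j<2 * k. f j) = (\<Sum>l<k. f (2 * l)) + (\<Sum>l<k. f (2 * l + 1))"
  by (induction k) (auto simp: algebra_simps)

lemma of_real_times_diff_cnj_eq: "of_real S * (x - cnj x) = d - cnj d \<Longrightarrow> S * Im x = Im d"
  by (auto simp: complex_eq_iff)

lemma of_real_times_add_cnj_eq: "of_real S * (x + cnj x) = d + cnj d \<Longrightarrow> S * Re x = Re d"
  by (auto simp: complex_eq_iff)

lemma fps_const_sum_distrib: "fps_const (\<Sum>i\<in>I. f i :: real) = (\<Sum>i\<in>I. fps_const (f i))"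
  by (induction I rule: infinite_finite_induct) (auto simp flip: fps_const_add)

lemma sum_linear_factors:
  fixes A D H W :: "'a :: comm_ring_1"
  shows "(\<Sum>i\<in>I. A * ((R i * D + H * t i) * W)) = ((\<Sum>i\<in>I. R i) * (A * D) + A * (H * (\<Sum>i\<in>I. t i))) * W"
proof -
  have "(\<Sum>i\<in>I. A * ((R i * D + H * t i) * W)) = (\<Sum>i\<in>I. R i * (A * D * W) + t i * (A * H * W))"
    by (intro sum.cong refl) (simp only: algebra_simps)
  also have "\<dots> = (\<Sum>i\<in>I. R i) * (A * D * W) + (\<Sum>i\<in>I. t i) * (A * H * W)"
    by (simp only: sum.distrib sum_distrib_right)
  finally show ?thesis by (simp only: algebra_simps)
qed

text \<open>The closing computation in an arbitrary commutative ring, with every series an atom.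
  \<open>D\<close> and \<open>R\<close> are the shapes of \<open>derivative_part\<close> and
  \<open>radial_part\<close>; \<open>W\<close> stands for the inverse of \<open>Bf\<close> and
  \<open>L\<close> for <xi, w> X.\<close>

lemma assemble_ring:
  fixes dP Q P A M1 d1 B M2 d2 K Ph XP Rz L W :: "'a :: comm_ring_1"
  assumes D: "dP - Q + P + A * M1 * d1 + B * M2 * d2 = 0" and R: "K * Ph + XP = Rz * (A * M1 + B * M2)"
  shows "(Ph * (L * (W * W)) + dP * W) + ((- Q + A * M1 * (L * Rz + d1)) * W + (P + B * M2 * (L * Rz + d2)) * W) =
     L * ((K + 1) * (Ph * W) + (XP * W + Ph * (W * W - W)))"
proof -
  have "(Ph * (L * (W * W)) + dP * W) + ((- Q + A * M1 * (L * Rz + d1)) * W + (P + B * M2 * (L * Rz + d2)) * W)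
    = Ph * (L * (W * W)) + (dP - Q + P + A * M1 * d1 + B * M2 * d2) * W + L * (Rz * (A * M1 + B * M2)) * W"
    by (simp add: algebra_simps)
  also have "\<dots> = L * ((K + 1) * (Ph * W) + (XP * W + Ph * (W * W - W)))"
    unfolding D R[symmetric] by (simp add: algebra_simps)
  finally show ?thesis .
qed

context dihedral_dunkl
begin

text \<open>Reflections of one class differ by rotations through multiples of 2 pi / k, so the
  images of z are y times the k-th roots of unity; \<open>e\<close> in {0, 1} selects the
  class.\<close>

lemma prod_minus_dih_refl:
  "(\<Prod>l<k. z - dih_refl k (2 * l + e) z) = z ^ k - (-1) ^ e * cnj (z ^ k)"
proof (cases "z = 0")
  case True
  then show ?thesis using k by (simp add: dih_refl_def zero_power)
next
  case False
  define y where "y = cnj z * cis (real e * pi / real k)"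
  have e: "cis (real e * pi / real k) ^ k = (-1) ^ e"
  proof -
    have "cis (real e * pi / real k) ^ k = cis (real e * pi)" using k unfolding Complex.DeMoivre by simp
    also have "\<dots> = cis pi ^ e" unfolding Complex.DeMoivre ..
    finally show ?thesis by simp
  qed
  have "dih_refl k (2 * l + e) z = y * cis (2 * pi * real l / real k)" for l
  proof -
    have "real (2 * l + e) * pi / real k = real e * pi / real k + 2 * pi * real l / real k"
      using k by (simp add: field_simps)
    then show ?thesis unfolding dih_refl_def y_def cis_conv_exp[symmetric] mult.assoc cis_mult by simp
  qed
  moreover have "y \<noteq> 0" using False by (simp add: y_def)
  ultimately have "(\<Prod>l<k. z - dih_refl k (2 * l + e) z) = z ^ k - y ^ k"
    using prod_minus_roots[OF k, of y z] by simp
  then show ?thesis unfolding y_def power_mult_distrib e by (simp add: mult.commute)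
qed

lemma minus_dih_refl: "x - dih_refl k j x = of_real (2 * cinner (dih_root k j) x) * dih_root k j"
  by (simp only: dih_refl_eq) simp

lemma dih_root_nonzero: "dih_root k j \<noteq> 0"
  by (simp add: dih_root_def)

text \<open>Since z - rho z = 2 <r, z> r, each quotient <r, xi> / <r, z> is the logarithmic
  derivative of z - rho z in direction xi. Their sum is therefore that of the product computed in
  \<open>prod_minus_dih_refl\<close>.\<close>

lemma root_log_derivative:
  fixes \<xi> z :: complex and e :: nat
  assumes z: "\<And>j. j < 2 * k \<Longrightarrow> cinner (dih_root k j) z \<noteq> 0" and e: "e < 2"
  defines "S \<equiv> (\<Sum>l<k. cinner (dih_root k (2 * l + e)) \<xi> / cinner (dih_root k (2 * l + e)) z)"
    and "d \<equiv> of_nat k * z ^ (k - 1) * \<xi>"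
  shows "z ^ k - (-1) ^ e * cnj (z ^ k) \<noteq> 0" "of_real S * (z ^ k - (-1) ^ e * cnj (z ^ k)) = d - (-1) ^ e * cnj d"
proof -
  have nz: "z - dih_refl k (2 * l + e) z \<noteq> 0" if "l < k" for l
    unfolding minus_dih_refl using z[of "2 * l + e"] that e dih_root_nonzero by simp
  show "z ^ k - (-1) ^ e * cnj (z ^ k) \<noteq> 0"
    unfolding prod_minus_dih_refl[symmetric] using nz by simp
  have refl_der: "((\<lambda>z. z - dih_refl k j z) has_derivative (\<lambda>h. h - dih_refl k j h)) (at z)" for j
    unfolding dih_refl_def
    by (intro has_derivative_diff has_derivative_ident has_derivative_mult_left has_derivative_cnj)
  have "((\<lambda>z. \<Prod>l<k. z - dih_refl k (2 * l + e) z) has_derivative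
     (\<lambda>h. \<Sum>l<k. (h - dih_refl k (2 * l + e) h) * (\<Prod>i\<in>{..<k} - {l}. z - dih_refl k (2 * i + e) z))) (at z)"
    by (intro has_derivative_prod refl_der)
  moreover have "((\<lambda>z. z ^ k - (-1) ^ e * cnj (z ^ k)) has_derivative
     (\<lambda>h. of_nat k * z ^ (k - 1) * h - (-1) ^ e * cnj (of_nat k * z ^ (k - 1) * h))) (at z)"
    by (intro has_derivative_diff has_derivative_mult_right has_derivative_cnj has_derivative_power_complex)
  ultimately have "d - (-1) ^ e * cnj d = (\<Sum>l<k. (\<xi> - dih_refl k (2 * l + e) \<xi>) * (\<Prod>i\<in>{..<k} - {l}. z - dih_refl k (2 * i + e) z))"
    unfolding prod_minus_dih_refl d_def using has_derivative_unique by (metis (no_types, lifting))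
  also have "\<dots> = (\<Sum>l<k. of_real (cinner (dih_root k (2 * l + e)) \<xi> / cinner (dih_root k (2 * l + e)) z) *
     (\<Prod>i<k. z - dih_refl k (2 * i + e) z))"
  proof (intro sum.cong refl)
    fix l assume l: "l \<in> {..<k}"
    let ?j = "2 * l + e"
    have "\<xi> - dih_refl k ?j \<xi> = of_real (cinner (dih_root k ?j) \<xi> / cinner (dih_root k ?j) z) * (z - dih_refl k ?j z)"
      unfolding minus_dih_refl using z[of ?j] l e by simp
    moreover have "(\<Prod>i<k. z - dih_refl k (2 * i + e) z) = (z - dih_refl k ?j z) * (\<Prod>i\<in>{..<k} - {l}. z - dih_refl k (2 * i + e) z)"
      using l by (intro prod.remove) auto
    ultimately show "(\<xi> - dih_refl k ?j \<xi>) * (\<Prod>i\<in>{..<k} - {l}. z - dih_refl k (2 * i + e) z) =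
      of_real (cinner (dih_root k ?j) \<xi> / cinner (dih_root k ?j) z) * (\<Prod>i<k. z - dih_refl k (2 * i + e) z)"
      by (simp only: mult.assoc)
  qed
  also have "\<dots> = of_real S * (z ^ k - (-1) ^ e * cnj (z ^ k))"
    unfolding S_def prod_minus_dih_refl of_real_sum sum_distrib_right ..
  finally show "of_real S * (z ^ k - (-1) ^ e * cnj (z ^ k)) = d - (-1) ^ e * cnj d" ..
qed

text \<open>For the even class the product is 2 i Im (z^k), so the sum of quotients is the
  logarithmic derivative of Im (z^k). It is stated multiplied by \<open>qc z\<close>, which may
  vanish through w; the odd class gives Re (z^k) and \<open>pc\<close> in the same way.\<close>

lemma root_sum_even:
  assumes z: "\<And>j. j < 2 * k \<Longrightarrow> cinner (dih_root k j) z \<noteq> 0"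
  shows "(\<Sum>l<k. cinner (dih_root k (2 * l)) \<xi> / cinner (dih_root k (2 * l)) z) * qc z = dqc z \<xi>"
proof -
  let ?S = "\<Sum>l<k. cinner (dih_root k (2 * l)) \<xi> / cinner (dih_root k (2 * l)) z"
  have "of_real ?S * (z ^ k - cnj (z ^ k)) = of_nat k * z ^ (k - 1) * \<xi> - cnj (of_nat k * z ^ (k - 1) * \<xi>)"
    using root_log_derivative(2)[OF z, of 0 \<xi>] by simp
  then have "?S * Im (z ^ k) = Im (of_nat k * z ^ (k - 1) * \<xi>)"
    by (rule of_real_times_diff_cnj_eq)
  moreover have "?S * qc z = 2 / 2 ^ k * (?S * Im (z ^ k)) * Im (w ^ k)"
    unfolding qc_def by (simp only: mult_ac)
  ultimately show ?thesis unfolding dqc_def by (simp only:)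
qed

lemma root_sum_odd:
  assumes z: "\<And>j. j < 2 * k \<Longrightarrow> cinner (dih_root k j) z \<noteq> 0"
  shows "(\<Sum>l<k. cinner (dih_root k (2 * l + 1)) \<xi> / cinner (dih_root k (2 * l + 1)) z) * pc z = dpc z \<xi>"
proof -
  let ?S = "\<Sum>l<k. cinner (dih_root k (2 * l + 1)) \<xi> / cinner (dih_root k (2 * l + 1)) z"
  have "of_real ?S * (z ^ k + cnj (z ^ k)) = of_nat k * z ^ (k - 1) * \<xi> + cnj (of_nat k * z ^ (k - 1) * \<xi>)"
    using root_log_derivative(2)[OF z, of 1 \<xi>] by simp
  then have "?S * Re (z ^ k) = Re (of_nat k * z ^ (k - 1) * \<xi>)"
    by (rule of_real_times_add_cnj_eq)
  moreover have "?S * pc z = 2 / 2 ^ k * (?S * Re (z ^ k)) * Re (w ^ k)"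
    unfolding pc_def by (simp only: mult_ac)
  ultimately show ?thesis unfolding dpc_def by (simp only:)
qed

definition Bf :: "complex \<Rightarrow> real fps" where "Bf z = 1 - fps_const (cinner z w) * fps_X"

definition Cf :: "complex \<Rightarrow> real fps" where "Cf z = Ph hf z * inverse (Bf z)"

definition dPh :: "complex \<Rightarrow> complex \<Rightarrow> real fps" where
  "dPh z h = Mh (\<lambda>p. fps_const (- (a + b) * hf p) * dAf z h p) z"

definition dCf :: "complex \<Rightarrow> complex \<Rightarrow> real fps" where
  "dCf z h = Ph hf z * (fps_const (cinner h w) * fps_X * (inverse (Bf z) * inverse (Bf z))) + dPh z h * inverse (Bf z)"

lemma Bf_nth_0 [simp]: "Bf z $ 0 = 1" by (simp add: Bf_def)

lemma Bf_inverse: "Bf z * inverse (Bf z) = 1" by (rule inverse_mult_eq_1') simp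

lemma inverse_Bf: "inverse (Bf z) = fps_negpow 1 (Bf z)"
  by (simp add: fps_negpow_one_inverse)

lemma negpow_2_Bf: "fps_negpow (1 + 1) (Bf z) = inverse (Bf z) * inverse (Bf z)"
  unfolding inverse_Bf by (rule fps_negpow_add) simp

lemma Cf_derivative: "fps_has_derivative Cf (dCf z) z"
proof -
  have "fps_has_derivative Bf (\<lambda>h. 0 - (fps_const (cinner z w) * 0 + fps_const (cinner h w) * fps_X)) z"
    unfolding Bf_def[abs_def]
    by (intro fps_has_derivative_diff fps_has_derivative_mult fps_has_derivative_const fps_has_derivative_fps_const has_derivative_cinner)
  then have "fps_has_derivative (\<lambda>z. fps_negpow 1 (Bf z)) (\<lambda>h. fps_const (- 1) * fps_negpow (1 + 1) (Bf z) *
     (0 - (fps_const (cinner z w) * 0 + fps_const (cinner h w) * fps_X))) z"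
    by (intro fps_has_derivative_negpow) simp_all
  also have "(\<lambda>h. fps_const (- 1) * fps_negpow (1 + 1) (Bf z) * (0 - (fps_const (cinner z w) * 0 + fps_const (cinner h w) * fps_X)))
    = (\<lambda>h. fps_const (cinner h w) * fps_X * (inverse (Bf z) * inverse (Bf z)))"
    unfolding negpow_2_Bf fps_const_neg[symmetric] fps_const_1_eq_1 by (rule ext) algebra
  finally have "fps_has_derivative (\<lambda>z. inverse (Bf z)) (\<lambda>h. fps_const (cinner h w) * fps_X * (inverse (Bf z) * inverse (Bf z))) z"
    unfolding inverse_Bf[symmetric] .
  from fps_has_derivative_mult[OF Ph_derivative[OF hf_cont(1)] this]
  show ?thesis unfolding Cf_def[abs_def] dCf_def[abs_def] dPh_def .
qed

text \<open>Leibniz rule for the difference quotient. The part that falls on 1 / \<open>Bf\<close>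
  loses its singularity: \<open>Bf\<close> at the reflected point minus \<open>Bf z\<close> is 2 <r,
  z> <r, w> X, which cancels the denominator <r, z>.\<close>

lemma reflection_term:
  fixes \<xi> z :: complex and j :: nat
  assumes z: "cinner (dih_root k j) z \<noteq> 0"
  defines "H \<equiv> (\<lambda>p. if even j then hf (- fst p, snd p) else hf (fst p, - snd p))"
  shows "fps_const (cinner (dih_root k j) \<xi> / cinner (dih_root k j) z) * (Cf z - Cf (dih_refl k j z)) =
     (fps_const (cinner (dih_root k j) \<xi> / cinner (dih_root k j) z) * (Ph hf z - Ph H z)
      + Ph H z * (fps_const (cinner \<xi> w - cinner (dih_refl k j \<xi>) w) * fps_X * inverse (Bf (dih_refl k j z)))) * inverse (Bf z)"
proof -
  let ?r = "\<lambda>x. cinner (dih_root k j) x"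
  define W where "W = inverse (Bf z)"
  define V where "V = inverse (Bf (dih_refl k j z))"
  have BW: "Bf z * W = 1" "Bf (dih_refl k j z) * V = 1"
    unfolding W_def V_def by (rule Bf_inverse)+
  have "Bf (dih_refl k j z) - Bf z = fps_const (2 * ?r z * ?r w) * fps_X"
    unfolding Bf_def cinner_dih_refl by (simp add: algebra_simps flip: fps_const_sub fps_const_add)
  then have "W - V = W * V * (fps_const (2 * ?r z * ?r w) * fps_X)"
    using BW by algebra
  then have "fps_const (?r \<xi> / ?r z) * (W - V) = fps_const (?r \<xi> / ?r z) * fps_const (2 * ?r z * ?r w) * fps_X * (W * V)"
    by (simp only: mult_ac)
  also have "fps_const (?r \<xi> / ?r z) * fps_const (2 * ?r z * ?r w) = fps_const (cinner \<xi> w - cinner (dih_refl k j \<xi>) w)"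
    unfolding fps_const_mult cinner_dih_refl using z by simp
  finally have 1: "fps_const (?r \<xi> / ?r z) * (W - V) = fps_const (cinner \<xi> w - cinner (dih_refl k j \<xi>) w) * fps_X * (W * V)" .
  have 2: "Cf (dih_refl k j z) = Ph H z * V"
    unfolding Cf_def V_def H_def Ph_dih_refl[OF hf_cont(1)] ..
  have "fps_const (?r \<xi> / ?r z) * (Ph hf z * W - Ph H z * V) =
     fps_const (?r \<xi> / ?r z) * (Ph hf z - Ph H z) * W + Ph H z * (fps_const (?r \<xi> / ?r z) * (W - V))"
    by (simp only: algebra_simps)
  then show ?thesis unfolding 2 unfolding Cf_def 1 W_def[symmetric] V_def[symmetric] by (simp only: algebra_simps)
qed

lemma X_deriv_Cf:
  "fps_X * fps_deriv (Cf z) = (fps_X * fps_deriv (Ph hf z)) * inverse (Bf z) + Ph hf z * (inverse (Bf z) * inverse (Bf z) - inverse (Bf z))"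
proof -
  have "fps_deriv (inverse (Bf z)) = fps_const (- 1) * fps_deriv (Bf z) * (inverse (Bf z) * inverse (Bf z))"
    using fps_deriv_negpow'[OF Bf_nth_0, of 1 z] unfolding negpow_2_Bf inverse_Bf[symmetric] .
  moreover have "fps_deriv (Bf z) = - fps_const (cinner z w)" by (simp add: Bf_def)
  ultimately have "fps_X * fps_deriv (inverse (Bf z)) = (1 - Bf z) * (inverse (Bf z) * inverse (Bf z))"
    by (simp add: Bf_def mult_ac flip: fps_const_neg)
  also have "\<dots> = inverse (Bf z) * inverse (Bf z) - inverse (Bf z)"
    using Bf_inverse[of z] by algebra
  finally have W: "fps_X * fps_deriv (inverse (Bf z)) = \<dots>" .
  have "fps_X * fps_deriv (Cf z) = (fps_X * fps_deriv (Ph hf z)) * inverse (Bf z) + Ph hf z * (fps_X * fps_deriv (inverse (Bf z)))"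
    unfolding Cf_def fps_deriv_mult by (simp only: algebra_simps)
  then show ?thesis unfolding W .
qed

text \<open>h(u, v) - h(-u, v) is odd in u, namely - 2 u ((a - b) / (a + b) + v), so integration by
  parts applies and yields a factor \<open>qc z\<close>. That factor is what later absorbs the
  quotients over the even roots.\<close>

lemma Ph_diff_reflect_fst:
  "fps_const a * (Ph hf z - Ph (\<lambda>p. hf (- fst p, snd p)) z)
    = - Mh (\<lambda>p. fps_const (qc z * ((a - b) + (a + b) * snd p) * (1 - (fst p)\<^sup>2)) * fps_X ^ k) z"
proof -
  let ?d = "(a - b) / (a + b)"
  have "Ph hf z - Ph (\<lambda>p. hf (- fst p, snd p)) z = Ph (\<lambda>p. hf p - hf (- fst p, snd p)) z"
    by (intro Ph_diff[symmetric] hf_cont)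
  also have "(\<lambda>p. hf p - hf (- fst p, snd p)) = (\<lambda>p. (- 2) * (fst p * (?d + snd p)))"
    unfolding hf_def fst_conv snd_conv by (rule ext) (simp only: ring_distribs minus_mult_left[symmetric] minus_mult_right[symmetric], simp)
  also have "Ph (\<lambda>p. (- 2) * (fst p * (?d + snd p))) z = fps_const (- 2) * Ph (\<lambda>p. fst p * (?d + snd p)) z"
    using a b by (intro Ph_cmult continuous_intros) auto
  finally have "fps_const a * (Ph hf z - Ph (\<lambda>p. hf (- fst p, snd p)) z) = - (fps_const (2 * a) * Ph (\<lambda>p. fst p * (?d + snd p)) z)"
    by (simp add: mult.assoc[symmetric] mult.commute flip: fps_const_neg)
  also have "fps_const (2 * a) * Ph (\<lambda>p. fst p * (?d + snd p)) z =
     Mh (\<lambda>p. fps_const ((a + b) * qc z * (1 - (fst p)\<^sup>2) * (?d + snd p)) * fps_X ^ k) z"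
    using a b by (intro Ph_by_parts_fst[of "\<lambda>v. ?d + v"] continuous_intros) auto
  also have "(\<lambda>p. (a + b) * qc z * (1 - (fst p)\<^sup>2) * (?d + snd p)) = (\<lambda>p :: real \<times> real. qc z * ((a - b) + (a + b) * snd p) * (1 - (fst p)\<^sup>2))"
    using a b by (auto simp: fun_eq_iff field_simps)
  finally show ?thesis .
qed

lemma Ph_diff_reflect_snd:
  "fps_const b * (Ph hf z - Ph (\<lambda>p. hf (fst p, - snd p)) z)
    = Mh (\<lambda>p. fps_const (pc z * ((a - b) - (a + b) * fst p) * (1 - (snd p)\<^sup>2)) * fps_X ^ k) z"
proof -
  let ?d = "(a - b) / (a + b)"
  have "Ph hf z - Ph (\<lambda>p. hf (fst p, - snd p)) z = Ph (\<lambda>p. hf p - hf (fst p, - snd p)) z"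
    by (intro Ph_diff[symmetric] hf_cont)
  also have "(\<lambda>p. hf p - hf (fst p, - snd p)) = (\<lambda>p. 2 * (snd p * (?d - fst p)))"
    unfolding hf_def fst_conv snd_conv by (rule ext) (simp only: ring_distribs minus_mult_left[symmetric] minus_mult_right[symmetric], simp)
  also have "Ph (\<lambda>p. 2 * (snd p * (?d - fst p))) z = fps_const 2 * Ph (\<lambda>p. snd p * (?d - fst p)) z"
    using a b by (intro Ph_cmult continuous_intros) auto
  finally have "fps_const b * (Ph hf z - Ph (\<lambda>p. hf (fst p, - snd p)) z) = fps_const (2 * b) * Ph (\<lambda>p. snd p * (?d - fst p)) z"
    by (simp add: mult.assoc[symmetric] mult.commute)
  also have "\<dots> = Mh (\<lambda>p. fps_const ((a + b) * pc z * (1 - (snd p)\<^sup>2) * (?d - fst p)) * fps_X ^ k) z"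
    using a b by (intro Ph_by_parts_snd[of "\<lambda>v. ?d - v"] continuous_intros) auto
  also have "(\<lambda>p. (a + b) * pc z * (1 - (snd p)\<^sup>2) * (?d - fst p)) = (\<lambda>p :: real \<times> real. pc z * ((a - b) - (a + b) * fst p) * (1 - (snd p)\<^sup>2))"
    using a b by (auto simp: fun_eq_iff field_simps)
  finally show ?thesis .
qed

text \<open>On integrands the left side is sigma h (k A - X A') = sigma h \<open>Rf z\<close>,
  because gamma = k sigma. \<open>Rf z\<close> is constant on the square and leaves the integral,
  and \<open>hf_scaled\<close> splits sigma h.\<close>

lemma radial_part:
  "fps_const (real k * (a + b)) * Ph hf z + fps_X * fps_deriv (Ph hf z) =
   Rf z * (fps_const a * Mh (\<lambda>p. fps_const ((1 - fst p) * (1 + snd p))) z + fps_const b * Mh (\<lambda>p. fps_const ((1 + fst p) * (1 - snd p))) z)"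
proof -
  let ?g1 = "\<lambda>p :: real \<times> real. fps_const ((1 - fst p) * (1 + snd p))"
  let ?g2 = "\<lambda>p :: real \<times> real. fps_const ((1 + fst p) * (1 - snd p))"
  have XA: "cont.coeffs_in (\<lambda>p. fps_X * fps_deriv (Af z p))"
  proof -
    have "cont.coeffs_in (\<lambda>p. of_nat k * Af z p - Rf z)"
      by (intro cont.coeffs_intros Af_cont)
    moreover have "of_nat k * Af z p - Rf z = fps_X * fps_deriv (Af z p)" for p
      using Af_Rf[of z p] by (simp add: algebra_simps)
    ultimately show ?thesis by simp
  qed
  have "fps_const (real k * (a + b)) * Ph hf z + fps_X * fps_deriv (Ph hf z) =
    Mh (\<lambda>p. fps_const (real k * (a + b)) * (fps_const (hf p) * Af z p) + fps_const (- (a + b) * hf p) * (fps_X * fps_deriv (Af z p))) z"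
  proof -
    have "fps_const (real k * (a + b)) * Ph hf z = Mh (\<lambda>p. fps_const (real k * (a + b)) * (fps_const (hf p) * Af z p)) z"
      unfolding Ph_eq_Mh by (intro Mh_mult_left[symmetric] cont.coeffs_intros Af_cont continuous_intros hf_cont)
    then show ?thesis unfolding X_deriv_Ph
      by (simp only:) (intro Mh_add[symmetric] cont.coeffs_intros Af_cont continuous_intros hf_cont XA)
  qed
  also have "(\<lambda>p. fps_const (real k * (a + b)) * (fps_const (hf p) * Af z p) + fps_const (- (a + b) * hf p) * (fps_X * fps_deriv (Af z p)))
     = (\<lambda>p. Rf z * (fps_const a * ?g1 p + fps_const b * ?g2 p))"
  proof
    fix p
    have "fps_const (real k * (a + b)) * (fps_const (hf p) * Af z p) + fps_const (- (a + b) * hf p) * (fps_X * fps_deriv (Af z p))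
       = fps_const ((a + b) * hf p) * (of_nat k * Af z p - fps_X * fps_deriv (Af z p))"
      unfolding fps_const_mult[symmetric] fps_const_neg[symmetric] fps_of_nat by algebra
    then show "fps_const (real k * (a + b)) * (fps_const (hf p) * Af z p) + fps_const (- (a + b) * hf p) * (fps_X * fps_deriv (Af z p)) =
        Rf z * (fps_const a * ?g1 p + fps_const b * ?g2 p)"
      unfolding Af_Rf hf_scaled fps_const_mult fps_const_add by (simp only: mult.commute)
  qed
  also have "Mh \<dots> z = Rf z * (Mh (\<lambda>p. fps_const a * ?g1 p) z + Mh (\<lambda>p. fps_const b * ?g2 p) z)"
    by (subst Mh_mult_left, (intro cont.coeffs_intros continuous_intros)+,
        subst Mh_add, (intro cont.coeffs_intros continuous_intros)+) (rule refl)
  also have "Mh (\<lambda>p. fps_const a * ?g1 p) z = fps_const a * Mh ?g1 z"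
    by (intro Mh_mult_left cont.coeffs_intros continuous_intros)
  also have "Mh (\<lambda>p. fps_const b * ?g2 p) z = fps_const b * Mh ?g2 z"
    by (intro Mh_mult_left cont.coeffs_intros continuous_intros)
  finally show ?thesis .
qed

text \<open>All terms are integrals against A^(-sigma-1), and the integrands cancel pointwise. By
  \<open>hf_scaled\<close> the terms with \<open>dPf\<close> cancel; the differences between the
  corner values and the value at (u, v) of \<open>dAf\<close> contribute X^k terms with factors 1 -
  u^2 and 1 - v^2, which match the two by-parts terms.\<close>

lemma derivative_part:
  "dPh z \<xi> - Mh (\<lambda>p. fps_const (dqc z \<xi> * ((a - b) + (a + b) * snd p) * (1 - (fst p)\<^sup>2)) * fps_X ^ k) z
    + Mh (\<lambda>p. fps_const (dpc z \<xi> * ((a - b) - (a + b) * fst p) * (1 - (snd p)\<^sup>2)) * fps_X ^ k) z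
    + fps_const a * Mh (\<lambda>p. fps_const ((1 - fst p) * (1 + snd p))) z * dAf z \<xi> (-1, 1)
    + fps_const b * Mh (\<lambda>p. fps_const ((1 + fst p) * (1 - snd p))) z * dAf z \<xi> (1, -1) = 0"
proof -
  let ?g1 = "\<lambda>p :: real \<times> real. fps_const ((1 - fst p) * (1 + snd p))"
  let ?g2 = "\<lambda>p :: real \<times> real. fps_const ((1 + fst p) * (1 - snd p))"
  let ?Q = "\<lambda>p. fps_const (dqc z \<xi> * ((a - b) + (a + b) * snd p) * (1 - (fst p)\<^sup>2)) * fps_X ^ k"
  let ?P = "\<lambda>p. fps_const (dpc z \<xi> * ((a - b) - (a + b) * fst p) * (1 - (snd p)\<^sup>2)) * fps_X ^ k"
  let ?D = "\<lambda>p. fps_const (- (a + b) * hf p) * dAf z \<xi> p"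
  have c: "cont.coeffs_in ?g1" "cont.coeffs_in ?g2" "cont.coeffs_in ?Q" "cont.coeffs_in ?P" "cont.coeffs_in ?D"
    by (intro cont.coeffs_intros dAf_cont continuous_intros hf_cont)+
  have m1: "fps_const a * Mh ?g1 z * dAf z \<xi> (-1, 1) = Mh (\<lambda>p. (fps_const a * dAf z \<xi> (-1, 1)) * ?g1 p) z"
    unfolding Mh_mult_left[OF c(1)] by (simp only: mult_ac)
  have m2: "fps_const b * Mh ?g2 z * dAf z \<xi> (1, -1) = Mh (\<lambda>p. (fps_const b * dAf z \<xi> (1, -1)) * ?g2 p) z"
    unfolding Mh_mult_left[OF c(2)] by (simp only: mult_ac)
  have "dPh z \<xi> - Mh ?Q z + Mh ?P z + fps_const a * Mh ?g1 z * dAf z \<xi> (-1, 1) + fps_const b * Mh ?g2 z * dAf z \<xi> (1, -1)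
    = Mh (\<lambda>p. ?D p - ?Q p + ?P p + (fps_const a * dAf z \<xi> (-1, 1)) * ?g1 p + (fps_const b * dAf z \<xi> (1, -1)) * ?g2 p) z"
    unfolding dPh_def m1 m2
    by (simp only: Mh_add Mh_diff c cont.coeffs_addI cont.coeffs_diffI cont.coeffs_multI cont.coeffs_constI)
  also have "(\<lambda>p. ?D p - ?Q p + ?P p + (fps_const a * dAf z \<xi> (-1, 1)) * ?g1 p + (fps_const b * dAf z \<xi> (1, -1)) * ?g2 p) = (\<lambda>p. 0)"
  proof
    fix p
    have D: "?D p = - (fps_const (a * ((1 - fst p) * (1 + snd p)) + b * ((1 + fst p) * (1 - snd p))) * dAf z \<xi> p)"
      unfolding hf_scaled[symmetric] minus_mult_left[symmetric] fps_const_neg[symmetric] by simp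
    show "?D p - ?Q p + ?P p + (fps_const a * dAf z \<xi> (-1, 1)) * ?g1 p + (fps_const b * dAf z \<xi> (1, -1)) * ?g2 p = 0"
      unfolding D unfolding dAf_def fst_conv snd_conv fps_const_mult[symmetric] fps_const_add[symmetric] fps_const_sub[symmetric]
        power2_eq_square fps_const_neg[symmetric] fps_const_1_eq_1
      by algebra
  qed
  also have "Mh (\<lambda>p. 0) z = 0" by (simp add: Mh_def fps_eq_iff)
  finally show ?thesis .
qed

text \<open>gamma + 1 + X d/dX multiplies the n-th coefficient by gamma + 1 + n, and the outer X
  shifts the degree by one. Reflections of one class share the multiplicity and the mirrored
  numerator, so the sum is treated by parity of j.\<close>

theorem Cf_dunkl_equation:
  assumes z: "\<And>j. j < 2 * k \<Longrightarrow> cinner (dih_root k j) z \<noteq> 0"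
  shows "dCf z \<xi> + (\<Sum>j<2 * k. fps_const (dih_mult a b j * (cinner (dih_root k j) \<xi> / cinner (dih_root k j) z)) * (Cf z - Cf (dih_refl k j z)))
    = fps_const (cinner \<xi> w) * fps_X * (fps_const (real k * (a + b) + 1) * Cf z + fps_X * fps_deriv (Cf z))"
proof -
  define W where "W = inverse (Bf z)"
  define L where "L = fps_const (cinner \<xi> w) * fps_X"
  define H1 where "H1 = Ph (\<lambda>p. hf (- fst p, snd p)) z"
  define H2 where "H2 = Ph (\<lambda>p. hf (fst p, - snd p)) z"
  define M1 where "M1 = Mh (\<lambda>p. fps_const ((1 - fst p) * (1 + snd p))) z"
  define M2 where "M2 = Mh (\<lambda>p. fps_const ((1 + fst p) * (1 - snd p))) z"
  let ?r = "\<lambda>j. cinner (dih_root k j) \<xi> / cinner (dih_root k j) z"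
  let ?t = "\<lambda>j. fps_const (cinner \<xi> w - cinner (dih_refl k j \<xi>) w) * fps_X * inverse (Bf (dih_refl k j z))"
  define Q where "Q = Mh (\<lambda>p. fps_const (dqc z \<xi> * ((a - b) + (a + b) * snd p) * (1 - (fst p)\<^sup>2)) * fps_X ^ k) z"
  define P where "P = Mh (\<lambda>p. fps_const (dpc z \<xi> * ((a - b) - (a + b) * fst p) * (1 - (snd p)\<^sup>2)) * fps_X ^ k) z"
  let ?f = "\<lambda>j. fps_const (dih_mult a b j * ?r j) * (Cf z - Cf (dih_refl k j z))"
  have E: "(\<Sum>l<k. ?f (2 * l)) = (- Q + fps_const a * M1 * (L * Rf z + dAf z \<xi> (-1, 1))) * W"
  proof -
    have "(\<Sum>l<k. ?f (2 * l)) = (\<Sum>l<k. fps_const a * ((fps_const (?r (2 * l)) * (Ph hf z - H1) + H1 * ?t (2 * l)) * W))"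
    proof (intro sum.cong refl)
      fix l assume "l \<in> {..<k}"
      then have "cinner (dih_root k (2 * l)) z \<noteq> 0" using z by auto
      from reflection_term[OF this, of \<xi>]
      have "fps_const (?r (2 * l)) * (Cf z - Cf (dih_refl k (2 * l) z)) = (fps_const (?r (2 * l)) * (Ph hf z - H1) + H1 * ?t (2 * l)) * W"
        unfolding W_def H1_def by simp
      moreover have "dih_mult a b (2 * l) = a" by (simp add: dih_mult_def)
      ultimately show "?f (2 * l) = fps_const a * ((fps_const (?r (2 * l)) * (Ph hf z - H1) + H1 * ?t (2 * l)) * W)"
        by (simp only: fps_const_mult[symmetric] mult.assoc)
    qed
    also have "\<dots> = (fps_const (\<Sum>l<k. ?r (2 * l)) * (fps_const a * (Ph hf z - H1)) + fps_const a * (H1 * (\<Sum>l<k. ?t (2 * l)))) * W"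
      unfolding fps_const_sum_distrib by (rule sum_linear_factors)
    \<comment> \<open>The corner product contained in \<open>H1\<close> absorbs the inverses in
      \<open>?t\<close>.\<close>
    also have "H1 * (\<Sum>l<k. ?t (2 * l)) = M1 * (L * Rf z + dAf z \<xi> (-1, 1))"
      unfolding H1_def Ph_reflect_fst M1_def L_def corner_log_derivative[OF Af_corner_fst, symmetric] Bf_def by (simp only: mult_ac)
    also have "fps_const a * (Ph hf z - H1) = - Mh (\<lambda>p. fps_const (qc z * ((a - b) + (a + b) * snd p) * (1 - (fst p)\<^sup>2)) * fps_X ^ k) z"
      unfolding H1_def by (rule Ph_diff_reflect_fst)
    \<comment> \<open>The singular quotients meet the factor \<open>qc z\<close> and turn it into
      \<open>dqc z \<xi>\<close>.\<close>
    also have "fps_const (\<Sum>l<k. ?r (2 * l)) * \<dots> = - Q"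
    proof -
      have "fps_const (\<Sum>l<k. ?r (2 * l)) * Mh (\<lambda>p. fps_const (qc z * ((a - b) + (a + b) * snd p) * (1 - (fst p)\<^sup>2)) * fps_X ^ k) z
        = Mh (\<lambda>p. fps_const (\<Sum>l<k. ?r (2 * l)) * (fps_const (qc z * ((a - b) + (a + b) * snd p) * (1 - (fst p)\<^sup>2)) * fps_X ^ k)) z"
        by (intro Mh_mult_left[symmetric] cont.coeffs_intros continuous_intros)
      then show ?thesis
        unfolding Q_def by (simp only: mult.assoc[symmetric] fps_const_mult mult_minus_right root_sum_even[OF z])
    qed
    finally show ?thesis by (simp only: mult.assoc)
  qed
  have O: "(\<Sum>l<k. ?f (2 * l + 1)) = (P + fps_const b * M2 * (L * Rf z + dAf z \<xi> (1, -1))) * W"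
  proof -
    have "(\<Sum>l<k. ?f (2 * l + 1)) = (\<Sum>l<k. fps_const b * ((fps_const (?r (2 * l + 1)) * (Ph hf z - H2) + H2 * ?t (2 * l + 1)) * W))"
    proof (intro sum.cong refl)
      fix l assume "l \<in> {..<k}"
      then have "cinner (dih_root k (2 * l + 1)) z \<noteq> 0" using z by auto
      from reflection_term[OF this, of \<xi>]
      have "fps_const (?r (2 * l + 1)) * (Cf z - Cf (dih_refl k (2 * l + 1) z)) = (fps_const (?r (2 * l + 1)) * (Ph hf z - H2) + H2 * ?t (2 * l + 1)) * W"
        unfolding W_def H2_def by simp
      moreover have "dih_mult a b (2 * l + 1) = b" by (simp add: dih_mult_def)
      ultimately show "?f (2 * l + 1) = fps_const b * ((fps_const (?r (2 * l + 1)) * (Ph hf z - H2) + H2 * ?t (2 * l + 1)) * W)"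
        by (simp only: fps_const_mult[symmetric] mult.assoc)
    qed
    also have "\<dots> = (fps_const (\<Sum>l<k. ?r (2 * l + 1)) * (fps_const b * (Ph hf z - H2)) + fps_const b * (H2 * (\<Sum>l<k. ?t (2 * l + 1)))) * W"
      unfolding fps_const_sum_distrib by (rule sum_linear_factors)
    also have "H2 * (\<Sum>l<k. ?t (2 * l + 1)) = M2 * (L * Rf z + dAf z \<xi> (1, -1))"
      unfolding H2_def Ph_reflect_snd M2_def L_def corner_log_derivative[OF Af_corner_snd, symmetric] Bf_def by (simp only: mult_ac)
    also have "fps_const b * (Ph hf z - H2) = Mh (\<lambda>p. fps_const (pc z * ((a - b) - (a + b) * fst p) * (1 - (snd p)\<^sup>2)) * fps_X ^ k) z"
      unfolding H2_def by (rule Ph_diff_reflect_snd)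
    also have "fps_const (\<Sum>l<k. ?r (2 * l + 1)) * \<dots> = P"
    proof -
      have "fps_const (\<Sum>l<k. ?r (2 * l + 1)) * Mh (\<lambda>p. fps_const (pc z * ((a - b) - (a + b) * fst p) * (1 - (snd p)\<^sup>2)) * fps_X ^ k) z
        = Mh (\<lambda>p. fps_const (\<Sum>l<k. ?r (2 * l + 1)) * (fps_const (pc z * ((a - b) - (a + b) * fst p) * (1 - (snd p)\<^sup>2)) * fps_X ^ k)) z"
        by (intro Mh_mult_left[symmetric] cont.coeffs_intros continuous_intros)
      then show ?thesis
        unfolding P_def by (simp only: mult.assoc[symmetric] fps_const_mult root_sum_odd[OF z])
    qed
    finally show ?thesis by (simp only: mult.assoc)
  qed
  have D: "dPh z \<xi> - Q + P + fps_const a * M1 * dAf z \<xi> (-1, 1) + fps_const b * M2 * dAf z \<xi> (1, -1) = 0"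
    unfolding M1_def M2_def Q_def P_def by (rule derivative_part)
  have R: "fps_const (real k * (a + b)) * Ph hf z + fps_X * fps_deriv (Ph hf z) = Rf z * (fps_const a * M1 + fps_const b * M2)"
    unfolding M1_def M2_def by (rule radial_part)
  have "dCf z \<xi> + (\<Sum>j<2 * k. ?f j) = (Ph hf z * (L * (W * W)) + dPh z \<xi> * W) +
     ((- Q + fps_const a * M1 * (L * Rf z + dAf z \<xi> (-1, 1))) * W + (P + fps_const b * M2 * (L * Rf z + dAf z \<xi> (1, -1))) * W)"
    unfolding sum_lessThan_even_odd E O dCf_def W_def[symmetric] L_def[symmetric] ..
  also have "\<dots> = L * ((fps_const (real k * (a + b)) + 1) * (Ph hf z * W) + ((fps_X * fps_deriv (Ph hf z)) * W + Ph hf z * (W * W - W)))"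
    by (rule assemble_ring[OF D R])
  also have "\<dots> = L * (fps_const (real k * (a + b) + 1) * Cf z + fps_X * fps_deriv (Cf z))"
    unfolding X_deriv_Cf unfolding Cf_def W_def[symmetric] fps_const_add[symmetric] fps_const_1_eq_1 ..
  finally show ?thesis unfolding L_def .
qed

end

section \<open>Bounds and the kernel\<close>

text \<open>|cos s cos t| + |sin s sin t| is the larger of |cos (s - t)| and |cos (s + t)|. This
  makes the \<open>arccos\<close> in \<open>q_uv\<close> a genuine inverse on the square.\<close>

lemma abs_xi_uv_le:
  assumes "u \<in> {-1..1}" "v \<in> {-1..1}"
  shows "\<bar>xi_uv u v s t\<bar> \<le> 1"
proof -
  have "\<bar>v * (cos s * cos t)\<bar> \<le> 1 * \<bar>cos s * cos t\<bar>" "\<bar>u * (sin s * sin t)\<bar> \<le> 1 * \<bar>sin s * sin t\<bar>"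
    unfolding abs_mult[of v] abs_mult[of u] using assms by (intro mult_right_mono; auto simp: abs_le_iff)+
  then have "\<bar>xi_uv u v s t\<bar> \<le> \<bar>cos s * cos t\<bar> + \<bar>sin s * sin t\<bar>"
    unfolding xi_uv_def by (simp add: mult.assoc)
  also have "\<dots> \<le> max \<bar>cos (s - t)\<bar> \<bar>cos (s + t)\<bar>"
    by (simp add: cos_add cos_diff abs_if max_def)
  also have "\<dots> \<le> 1" by simp
  finally show ?thesis .
qed

lemma cos_q_uv:
  assumes "p \<in> {-1..1} \<times> {-1..1}"
  shows "cos (q_uv (fst p) (snd p) s t) = xi_uv (fst p) (snd p) s t"
proof -
  have "fst p \<in> {-1..1}" "snd p \<in> {-1..1}" using assms by auto
  then show ?thesis unfolding q_uv_def by (intro cos_arccos_abs abs_xi_uv_le)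
qed

lemma pochhammer_ge_fact: "(x::real) \<ge> 1 \<Longrightarrow> pochhammer x n \<ge> fact n"
proof (induction n)
  case (Suc n)
  then have "fact n * real (Suc n) \<le> pochhammer x n * (x + real n)"
    by (intro mult_mono) (auto intro: order.trans[of 0 "fact n"])
  then show ?case by (simp add: pochhammer_Suc mult.commute del: of_nat_Suc)
qed simp

context dihedral_dunkl
begin

abbreviation gam :: real where "gam \<equiv> real k * (a + b)"

lemma gam_pos: "gam > 0" using k a b by simp

lemma poch_pos: "pochhammer (gam + 1) n > 0" using gam_pos by (intro pochhammer_pos) linarith

lemma negpow_Af_maj:
  assumes p: "p \<in> {-1..1} \<times> {-1..1}" and s: "s \<ge> 0"
  shows "fps_maj (fps_negpow s (Af z p)) (fps_negpow (real k * s) (1 - fps_const (cmod z * cmod w) * fps_X))"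
proof -
  have "Af z p = (\<Prod>l<k. 1 - fps_const (cmod z * cmod w * cos ((q_uv (fst p) (snd p) (real k * Arg z) (real k * Arg w) + 2 * pi * real l) / real k)) * fps_X)"
    by (rule Af_eq_prod[OF polar_Arg polar_Arg cos_q_uv[OF p]])
  moreover have "\<bar>cmod z * cmod w * cos x\<bar> \<le> cmod z * cmod w" for x
    by (simp add: abs_mult mult_left_le)
  ultimately show ?thesis
    using fps_maj_prod_negpow[OF finite_lessThan _ s, of k "\<lambda>l. cmod z * cmod w * cos ((q_uv (fst p) (snd p) (real k * Arg z) (real k * Arg w) + 2 * pi * real l) / real k)" "cmod z * cmod w"]
    by simp
qed

lemma inverse_Bf_maj: "fps_maj (inverse (Bf z)) (fps_negpow 1 (1 - fps_const (cmod z * cmod w) * fps_X))"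
  unfolding inverse_Bf unfolding Bf_def
  using fps_maj_prod_negpow[of "{0::nat}" "\<lambda>_. cinner z w" "cmod z * cmod w" 1] abs_cinner_le[of z w] by simp

definition Gf :: "complex \<Rightarrow> real \<times> real \<Rightarrow> real fps" where
  "Gf z p = fps_negpow (a + b) (Af z p) * inverse (Bf z)"

lemma Gf_cont: "cont.coeffs_in (Gf z)"
  unfolding Gf_def[abs_def] by (intro cont.coeffs_intros Af_cont)

text \<open>The k factors of A with exponent a + b and the factor of \<open>Bf\<close> with exponent
  1 merge into exponent gamma + 1, hence the very Pochhammer symbol by which the kernel
  divides.\<close>

lemma Gf_bound:
  assumes p: "p \<in> {-1..1} \<times> {-1..1}"
  shows "\<bar>Gf z p $ n\<bar> \<le> pochhammer (gam + 1) n / fact n * (cmod z * cmod w) ^ n"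
proof -
  have "fps_maj (Gf z p) (fps_negpow gam (1 - fps_const (cmod z * cmod w) * fps_X) * fps_negpow 1 (1 - fps_const (cmod z * cmod w) * fps_X))"
    unfolding Gf_def using a b by (intro fps_maj_mult negpow_Af_maj[OF p] inverse_Bf_maj) auto
  also have "fps_negpow gam (1 - fps_const (cmod z * cmod w) * fps_X) * fps_negpow 1 (1 - fps_const (cmod z * cmod w) * fps_X)
    = fps_negpow (gam + 1) (1 - fps_const (cmod z * cmod w) * fps_X)"
    by (rule fps_negpow_add[symmetric]) simp
  finally show ?thesis by (simp add: fps_maj_def fps_negpow_linear_nth)
qed

text \<open>Four terms, each of modulus at most 1 on the square because |a - b| <= a + b.\<close>

lemma hf_bound:
  assumes "p \<in> {-1..1} \<times> {-1..1}" shows "\<bar>hf p\<bar> \<le> 4"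
proof -
  have d: "\<bar>(a - b) / (a + b)\<bar> \<le> 1" using a b by (simp add: abs_le_iff field_simps)
  have u: "\<bar>fst p\<bar> \<le> 1" "\<bar>snd p\<bar> \<le> 1" using assms by auto
  have "\<bar>(a - b) / (a + b) * fst p\<bar> \<le> 1 * 1" "\<bar>(a - b) / (a + b) * snd p\<bar> \<le> 1 * 1" "\<bar>fst p * snd p\<bar> \<le> 1 * 1"
    unfolding abs_mult using d u by (intro mult_mono; simp)+
  then show ?thesis unfolding hf_def by linarith
qed

lemma Cf_nth: "Cf z $ n = (\<integral>p. hf p * Gf z p $ n \<partial>nu2 a b)"
proof -
  have "Cf z = J (\<lambda>p. inverse (Bf z) * (fps_const (hf p) * fps_negpow (a + b) (Af z p)))"
    unfolding Cf_def Ph_def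
    by (subst J_mult_left, intro cont.coeffs_intros Af_cont hf_cont) (simp only: mult.commute)
  also have "(\<lambda>p. inverse (Bf z) * (fps_const (hf p) * fps_negpow (a + b) (Af z p))) = (\<lambda>p. fps_const (hf p) * Gf z p)"
    unfolding Gf_def by (simp only: mult_ac)
  finally show ?thesis by simp
qed

lemma hf_Gf_bound:
  assumes p: "p \<in> {-1..1} \<times> {-1..1}"
  shows "\<bar>hf p * Gf z p $ n\<bar> \<le> 4 * (pochhammer (gam + 1) n / fact n * (cmod z * cmod w) ^ n)"
proof -
  have "\<bar>hf p\<bar> * \<bar>Gf z p $ n\<bar> \<le> 4 * (pochhammer (gam + 1) n / fact n * (cmod z * cmod w) ^ n)"
    by (rule mult_mono[OF hf_bound[OF p] Gf_bound[OF p]]) simp_all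
  then show ?thesis by (simp only: abs_mult)
qed

lemma Cf_bound: "\<bar>Cf z $ n\<bar> \<le> 4 * (pochhammer (gam + 1) n / fact n * (cmod z * cmod w) ^ n)"
  unfolding Cf_nth by (rule integral_nu2_bound[OF a b hf_Gf_bound])

text \<open>u, v and u v have mean 0 by symmetry and the total mass is 1; this gives the
  normalisation of the kernel at 0.\<close>

lemma Cf_nth_0: "Cf z $ 0 = 1"
proof -
  interpret finite_measure "nu2 a b" using a b by (rule finite_measure_nu2)
  let ?d = "(a - b) / (a + b)"
  have i: "integrable (nu2 a b) fst" "integrable (nu2 a b) snd" "integrable (nu2 a b) (\<lambda>p. fst p * snd p)"
    using a b by (auto intro!: integrable_nu2_continuous continuous_intros)
  have z: "(\<integral>p. fst p \<partial>nu2 a b) = 0" "(\<integral>p. snd p \<partial>nu2 a b) = 0" "(\<integral>p. fst p * snd p \<partial>nu2 a b) = 0"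
    using integral_nu2_reflect_fst[OF a b, of fst] integral_nu2_reflect_snd[OF a b, of snd]
      integral_nu2_reflect_fst[OF a b, of "\<lambda>p. fst p * snd p"] by (auto simp: continuous_intros)
  have "Cf z $ 0 = (\<integral>p. hf p \<partial>nu2 a b)"
    unfolding Cf_nth by (simp add: Gf_def)
  also have "\<dots> = 1"
    unfolding hf_def using i z emeasure_nu2_UNIV[OF a b] by (simp add: measure_def)
  finally show ?thesis .
qed

section \<open>The kernel series: convergence and derivative bounds\<close>

definition kernel :: "complex \<Rightarrow> real" where
  "kernel z = (\<Sum>n. Cf z $ n / pochhammer (gam + 1) n)"

lemma kernel_term_bound: "\<bar>Cf z $ n / pochhammer (gam + 1) n\<bar> \<le> 4 * ((cmod z * cmod w) ^ n / fact n)"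
proof -
  have "\<bar>Cf z $ n / pochhammer (gam + 1) n\<bar> = \<bar>Cf z $ n\<bar> / pochhammer (gam + 1) n"
    using poch_pos[of n] by simp
  also have "\<dots> \<le> 4 * (pochhammer (gam + 1) n / fact n * (cmod z * cmod w) ^ n) / pochhammer (gam + 1) n"
    using Cf_bound[of z n] poch_pos[of n] by (intro divide_right_mono) auto
  also have "\<dots> = 4 * ((cmod z * cmod w) ^ n / fact n)"
    using poch_pos[of n] by simp
  finally show ?thesis .
qed

lemma kernel_abs_summable: "summable (\<lambda>n. \<bar>Cf z $ n / pochhammer (gam + 1) n\<bar>)"
proof (rule summable_comparison_test'[where N = 0])
  show "summable (\<lambda>n. 4 * ((cmod z * cmod w) ^ n / fact n))"
    using summable_exp[of "cmod z * cmod w"] by (intro summable_mult) (simp add: field_simps)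
  show "norm \<bar>Cf z $ n / pochhammer (gam + 1) n\<bar> \<le> 4 * ((cmod z * cmod w) ^ n / fact n)" for n
    unfolding real_norm_def abs_idempotent by (rule kernel_term_bound)
qed

lemma kernel_sums: "(\<lambda>n. Cf z $ n / pochhammer (gam + 1) n) sums kernel z"
  unfolding kernel_def by (rule summable_sums[OF summable_rabs_cancel[OF kernel_abs_summable]])

lemma kernel_0: "kernel 0 = 1"
proof -
  have "Cf 0 $ n / pochhammer (gam + 1) n = (if n = 0 then 1 else 0)" for n
    using Cf_nth_0[of 0] Cf_bound[of 0 n] by (cases "n = 0") (auto simp: power_0_left)
  then have "kernel 0 = (\<Sum>n. if n = 0 then 1 else 0)" unfolding kernel_def by simp
  also have "\<dots> = 1" using sums_single[of 0 "\<lambda>_. 1::real"] by (simp add: sums_iff)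
  finally show ?thesis .
qed

lemma geo_bounded_integral:
  assumes "geo_bounded (S \<times> ({-1..1} \<times> {-1..1})) (\<lambda>x. G (fst x) (snd x))"
  shows "geo_bounded S (\<lambda>i. J (G i))"
proof -
  obtain C r where C: "C \<ge> 0" "r \<ge> 0" "\<And>i p n. i \<in> S \<Longrightarrow> p \<in> {-1..1} \<times> {-1..1} \<Longrightarrow> \<bar>G i p $ n\<bar> \<le> C * r ^ n"
    using assms unfolding geo_bounded_def by fastforce
  have "\<bar>J (G i) $ n\<bar> \<le> C * r ^ n" if "i \<in> S" for i n
    unfolding fps_integral_nth using a b C(3)[OF that] by (intro integral_nu2_bound) auto
  then show ?thesis unfolding geo_bounded_def using C(1,2) by blast
qed

text \<open>Uniformity over bounded z and over directions in the unit ball is what differentiation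
  of the kernel series term by term requires.\<close>

lemma geo_bounded_dCf: "geo_bounded {(z, h). cmod z \<le> R \<and> cmod h \<le> 1} (\<lambda>(z, h). dCf z h)"
proof (cases "R \<ge> 0")
  case True
  define S where "S = {(z, h). cmod z \<le> R \<and> cmod h \<le> 1}"
  define T where "T = S \<times> ({-1..1::real} \<times> {-1..1::real})"
  define M where "M = R * cmod w"
  have M: "M \<ge> 0" "\<And>x. x \<in> S \<Longrightarrow> cmod (fst x) * cmod w \<le> M"
    using True by (auto simp: M_def S_def intro: mult_right_mono)
  have S: "\<And>x. x \<in> S \<Longrightarrow> cmod (fst x) \<le> R" "\<And>x. x \<in> S \<Longrightarrow> cmod (snd x) \<le> 1" by (auto simp: S_def)
  have TS: "\<And>x. x \<in> T \<Longrightarrow> fst x \<in> S" "\<And>x. x \<in> T \<Longrightarrow> snd x \<in> {-1..1} \<times> {-1..1}" by (auto simp: T_def)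
  have pw: "geo_bounded T (\<lambda>x. fps_negpow s (Af (fst (fst x)) (snd x)))" if s: "s \<ge> 0" for s
  proof (rule geo_bounded_maj[of "real k * s" _ "\<lambda>x. cmod (fst (fst x)) * cmod w" M])
    show "fps_maj (fps_negpow s (Af (fst (fst x)) (snd x))) (fps_negpow (real k * s) (1 - fps_const (cmod (fst (fst x)) * cmod w) * fps_X))"
      if "x \<in> T" for x by (rule negpow_Af_maj[OF TS(2)[OF that] s])
  qed (use M TS s in auto)
  have hfb: "geo_bounded T (\<lambda>x. fps_const (hf (snd x)))"
    by (rule geo_bounded_const[of _ _ 4]) (use TS(2) hf_bound in auto)
  have iB: "geo_bounded S (\<lambda>x. inverse (Bf (fst x)))"
    by (rule geo_bounded_maj[of 1 _ "\<lambda>x. cmod (fst x) * cmod w" M]) (use M inverse_Bf_maj in auto)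
  have Phb: "geo_bounded S (\<lambda>x. Ph hf (fst x))"
    unfolding Ph_def
    by (rule geo_bounded_integral, fold T_def) (intro geo_bounded_mult pw hfb, use a b in auto)
  have dP: "geo_bounded S (\<lambda>x. dPf (fst x) (snd x))"
    unfolding dPf_def
  proof (intro geo_bounded_mult geo_bounded_cheb)
    show "geo_bounded S (\<lambda>x. fps_const (2 / 2 ^ k))" by (rule geo_bounded_const[of _ _ "2 / 2 ^ k"]) simp
    show "\<bar>(cmod (fst x) * cmod w)\<^sup>2\<bar> \<le> M\<^sup>2" if "x \<in> S" for x
      using M(2)[OF that] by (simp add: power_mono)
    show "geo_bounded S (\<lambda>x. fps_const (2 * (fst x \<bullet> snd x) * (cmod w)\<^sup>2))"
    proof (rule geo_bounded_const[of _ _ "2 * (R * 1) * (cmod w)\<^sup>2"])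
      fix x assume x: "x \<in> S"
      have "\<bar>fst x \<bullet> snd x\<bar> \<le> cmod (fst x) * cmod (snd x)" by (rule Cauchy_Schwarz_ineq2)
      also have "\<dots> \<le> R * 1" using S[OF x] True by (intro mult_mono) auto
      finally have "2 * \<bar>fst x \<bullet> snd x\<bar> * (cmod w)\<^sup>2 \<le> 2 * (R * 1) * (cmod w)\<^sup>2"
        by (intro mult_right_mono mult_left_mono) auto
      then show "\<bar>2 * (fst x \<bullet> snd x) * (cmod w)\<^sup>2\<bar> \<le> 2 * (R * 1) * (cmod w)\<^sup>2"
        by (simp add: abs_mult)
    qed
  qed
  define K where "K = real k * R ^ (k - 1) * cmod (w ^ k)"
  have pw1: "cmod (of_nat k * fst x ^ (k - 1) * snd x) \<le> real k * R ^ (k - 1)" if "x \<in> S" for x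
  proof -
    have "cmod (of_nat k * fst x ^ (k - 1) * snd x) = real k * cmod (fst x) ^ (k - 1) * cmod (snd x)"
      by (simp add: norm_mult norm_power)
    also have "\<dots> \<le> real k * R ^ (k - 1) * 1"
      using S[OF that] True by (intro mult_mono power_mono) auto
    finally show ?thesis by simp
  qed
  have c2: "2 / 2 ^ k \<le> (1::real)"
    using k power_increasing[of 1 k "2::real"] by (simp add: Suc_leI)
  have c2': "\<bar>2 / 2 ^ k :: real\<bar> = 2 / 2 ^ k" by simp
  have gen: "2 / 2 ^ k * \<bar>x\<bar> * \<bar>y\<bar> \<le> K" if "\<bar>x\<bar> \<le> real k * R ^ (k - 1)" "\<bar>y\<bar> \<le> cmod (w ^ k)" for x y
  proof -
    have "2 / 2 ^ k * \<bar>x\<bar> * \<bar>y\<bar> \<le> 1 * (real k * R ^ (k - 1)) * cmod (w ^ k)"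
      using that c2 True by (intro mult_mono) auto
    then show ?thesis by (simp add: K_def)
  qed
  have dpcb: "\<bar>dpc (fst x) (snd x)\<bar> \<le> K" "\<bar>dqc (fst x) (snd x)\<bar> \<le> K" if "x \<in> S" for x
  proof -
    have r: "\<bar>Re (of_nat k * fst x ^ (k - 1) * snd x)\<bar> \<le> real k * R ^ (k - 1)" "\<bar>Im (of_nat k * fst x ^ (k - 1) * snd x)\<bar> \<le> real k * R ^ (k - 1)"
      using pw1[OF that] abs_Re_le_cmod abs_Im_le_cmod order_trans by blast+
    show "\<bar>dpc (fst x) (snd x)\<bar> \<le> K"
      unfolding dpc_def abs_mult c2' by (rule gen[OF r(1) abs_Re_le_cmod])
    show "\<bar>dqc (fst x) (snd x)\<bar> \<le> K"
      unfolding dqc_def abs_mult c2' by (rule gen[OF r(2) abs_Im_le_cmod])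
  qed
  have dA: "geo_bounded T (\<lambda>x. dAf (fst (fst x)) (snd (fst x)) (snd x))"
    unfolding dAf_def
  proof (intro geo_bounded_diff geo_bounded_mult geo_bounded_X_power)
    show "geo_bounded T (\<lambda>x. dPf (fst (fst x)) (snd (fst x)))"
      using dP TS(1) unfolding geo_bounded_def by meson
    show "geo_bounded T (\<lambda>x. fps_const (snd (snd x) * dpc (fst (fst x)) (snd (fst x)) + fst (snd x) * dqc (fst (fst x)) (snd (fst x))))"
    proof (rule geo_bounded_const[of _ _ "1 * K + 1 * K"])
      fix x assume x: "x \<in> T"
      have "\<bar>snd (snd x) * dpc (fst (fst x)) (snd (fst x))\<bar> \<le> 1 * K" "\<bar>fst (snd x) * dqc (fst (fst x)) (snd (fst x))\<bar> \<le> 1 * K"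
        unfolding abs_mult using TS[OF x] dpcb[of "fst x"] by (intro mult_mono; auto)+
      then show "\<bar>snd (snd x) * dpc (fst (fst x)) (snd (fst x)) + fst (snd x) * dqc (fst (fst x)) (snd (fst x))\<bar> \<le> 1 * K + 1 * K"
        by linarith
    qed
  qed
  have dPhb: "geo_bounded S (\<lambda>x. dPh (fst x) (snd x))"
    unfolding dPh_def Mh_def fps_const_mult[symmetric]
    by (rule geo_bounded_integral, fold T_def)
       (intro geo_bounded_mult pw hfb dA geo_bounded_const[of _ _ "\<bar>- (a + b)\<bar>"], use a b in auto)
  have ci: "geo_bounded S (\<lambda>x. fps_const (cinner (snd x) w))"
  proof (rule geo_bounded_const[of _ _ "1 * cmod w"])
    fix x assume "x \<in> S"
    then have "cmod (snd x) * cmod w \<le> 1 * cmod w" using S by (intro mult_right_mono) auto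
    then show "\<bar>cinner (snd x) w\<bar> \<le> 1 * cmod w" using abs_cinner_le[of "snd x" w] by linarith
  qed
  have "geo_bounded S (\<lambda>x. dCf (fst x) (snd x))"
    unfolding dCf_def by (intro geo_bounded_add geo_bounded_mult Phb ci geo_bounded_X iB dPhb)
  then show ?thesis unfolding S_def case_prod_unfold .
next
  case False
  \<comment> \<open>For negative \<open>R\<close> the index set is empty.\<close>
  then have "\<not> cmod z \<le> R" for z using norm_ge_zero[of z] by linarith
  then show ?thesis unfolding geo_bounded_def by (intro exI[of _ 0]) auto
qed

end

section \<open>Eigenfunction property and Laplace transform\<close>

text \<open>Shaped for \<open>has_derivative_series\<close>: the remainder is proportional to
  \<open>c\<close>, which will be the norm of the direction.\<close>

lemma suminf_tail_bound:
  fixes f T :: "nat \<Rightarrow> real"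
  assumes f: "\<And>i. \<bar>f i\<bar> \<le> T i * c" and T: "summable T"
  shows "\<bar>(\<Sum>i<N. f i) - (\<Sum>i. f i)\<bar> \<le> (\<Sum>i. T (i + N)) * c"
proof -
  have Tc: "summable (\<lambda>i. T i * c)" using T by (rule summable_mult2)
  then have sf: "summable f" by (rule summable_comparison_test'[where N = 0]) (use f in auto)
  have "(\<Sum>i. f i) = (\<Sum>i. f (i + N)) + (\<Sum>i<N. f i)" by (rule suminf_split_initial_segment[OF sf])
  then have "\<bar>(\<Sum>i<N. f i) - (\<Sum>i. f i)\<bar> = \<bar>\<Sum>i. f (i + N)\<bar>" by simp
  also have "\<dots> \<le> (\<Sum>i. \<bar>f (i + N)\<bar>)"
  proof (rule summable_rabs)
    show "summable (\<lambda>i. \<bar>f (i + N)\<bar>)"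
      by (rule summable_comparison_test'[OF summable_ignore_initial_segment[OF Tc, of N], where N = 0]) (use f in auto)
  qed
  also have "\<dots> \<le> (\<Sum>i. T (i + N) * c)"
  proof (rule suminf_le)
    show "summable (\<lambda>i. \<bar>f (i + N)\<bar>)"
      by (rule summable_comparison_test'[OF summable_ignore_initial_segment[OF Tc, of N], where N = 0]) (use f in auto)
    show "summable (\<lambda>i. T (i + N) * c)" by (rule summable_ignore_initial_segment[OF Tc])
  qed (rule f)
  also have "\<dots> = (\<Sum>i. T (i + N)) * c"
    by (rule suminf_mult2[symmetric, OF summable_ignore_initial_segment[OF T]])
  finally show ?thesis .
qed

context dihedral_dunkl
begin

definition dkernel :: "complex \<Rightarrow> complex \<Rightarrow> real" where
  "dkernel z h = (\<Sum>n. dCf z h $ n / pochhammer (gam + 1) n)"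

text \<open>Linearity in h extends the bound from the unit ball to all directions, and (gamma + 1)_n
  >= n! supplies the factorial.\<close>

lemma dCf_bound:
  obtains C r where "C \<ge> 0" "r \<ge> 0"
    "\<And>z h n. cmod z \<le> R \<Longrightarrow> \<bar>dCf z h $ n / pochhammer (gam + 1) n\<bar> \<le> (C * (r ^ n / fact n)) * cmod h"
proof -
  obtain C r where C: "C \<ge> 0" "r \<ge> 0"
    and bd: "\<And>z h n. cmod z \<le> R \<Longrightarrow> cmod h \<le> 1 \<Longrightarrow> \<bar>dCf z h $ n\<bar> \<le> C * r ^ n"
    using geo_bounded_dCf[of R] unfolding geo_bounded_def by fastforce
  have "\<bar>dCf z h $ n / pochhammer (gam + 1) n\<bar> \<le> (C * (r ^ n / fact n)) * cmod h" if z: "cmod z \<le> R" for z h n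
  proof -
    have lin: "linear (\<lambda>h. dCf z h $ n)"
      using Cf_derivative[of z] unfolding fps_has_derivative_def by (intro has_derivative_linear) blast
    have h: "\<bar>dCf z h $ n\<bar> \<le> C * r ^ n * cmod h"
    proof (cases "h = 0")
      case True
      then show ?thesis using linear_0[OF lin] by simp
    next
      case False
      have "dCf z h $ n = dCf z (cmod h *\<^sub>R (h /\<^sub>R cmod h)) $ n" using False by simp
      also have "\<dots> = cmod h * dCf z (h /\<^sub>R cmod h) $ n" using linear_cmul[OF lin] by (metis real_scaleR_def)
      finally have "\<bar>dCf z h $ n\<bar> = cmod h * \<bar>dCf z (h /\<^sub>R cmod h) $ n\<bar>" by (simp add: abs_mult)
      also have "\<dots> \<le> cmod h * (C * r ^ n)"
        using z False by (intro mult_left_mono bd) auto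
      finally show ?thesis by (simp add: mult_ac)
    qed
    have f: "fact n \<le> pochhammer (gam + 1) n" using gam_pos by (intro pochhammer_ge_fact) linarith
    have "\<bar>dCf z h $ n / pochhammer (gam + 1) n\<bar> = \<bar>dCf z h $ n\<bar> / pochhammer (gam + 1) n"
      using poch_pos[of n] by simp
    also have "\<dots> \<le> (C * r ^ n * cmod h) / fact n"
      using h f C by (intro frac_le) auto
    finally show ?thesis by simp
  qed
  with C show ?thesis using that by blast
qed

lemma Cf_nth_derivative: "((\<lambda>x. Cf x $ n) has_derivative (\<lambda>h. dCf x h $ n)) (at x)"
  using Cf_derivative[of x] by (simp add: fps_has_derivative_def)

lemma kernel_derivative:
  "(kernel has_derivative dkernel z) (at z)" "(\<lambda>n. dCf z h $ n / pochhammer (gam + 1) n) sums dkernel z h"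
proof -
  \<comment> \<open>A ball around 0 that contains z in its interior; the derivative bounds are
    uniform on it.\<close>
  define R where "R = cmod z + 1"
  obtain C r where C: "C \<ge> 0" "r \<ge> 0"
    and bd: "\<And>z h n. cmod z \<le> R \<Longrightarrow> \<bar>dCf z h $ n / pochhammer (gam + 1) n\<bar> \<le> (C * (r ^ n / fact n)) * cmod h"
    using dCf_bound[of R] by blast
  let ?T = "\<lambda>n. C * (r ^ n / fact n)"
  have T: "summable ?T" using summable_exp[of r] by (intro summable_mult) (simp add: field_simps)
  have "summable (\<lambda>n. dCf z h $ n / pochhammer (gam + 1) n)"
    by (rule summable_comparison_test'[OF summable_mult2[OF T, of "cmod h"], where N = 0]) (use bd[of z h] in \<open>auto simp: R_def\<close>)
  then show "(\<lambda>n. dCf z h $ n / pochhammer (gam + 1) n) sums dkernel z h"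
    unfolding dkernel_def by (rule summable_sums)
  have z: "z \<in> ball 0 R" by (simp add: R_def)
  have "\<exists>g. \<forall>x\<in>ball 0 R. (\<lambda>n. Cf x $ n / pochhammer (gam + 1) n) sums g x \<and> (g has_derivative dkernel x) (at x within ball 0 R)"
  proof (rule has_derivative_series[where f' = "\<lambda>n x h. dCf x h $ n / pochhammer (gam + 1) n", OF _ _ _ z kernel_sums])
    show "((\<lambda>x. Cf x $ n / pochhammer (gam + 1) n) has_derivative (\<lambda>h. dCf x h $ n / pochhammer (gam + 1) n)) (at x within ball 0 R)" for n x
      unfolding divide_inverse by (rule has_derivative_at_withinI[OF has_derivative_mult_left[OF Cf_nth_derivative]])
    show "\<forall>\<^sub>F N in sequentially. \<forall>x\<in>ball 0 R. \<forall>h. norm ((\<Sum>i<N. dCf x h $ i / pochhammer (gam + 1) i) - dkernel x h) \<le> e * norm h"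
      if e: "e > 0" for e
    proof -
      obtain N0 where N0: "\<And>N. N \<ge> N0 \<Longrightarrow> norm (\<Sum>i. ?T (i + N)) < e"
        using suminf_exist_split[OF e T] by blast
      show ?thesis
        unfolding eventually_sequentially
      proof (intro exI[of _ N0] allI impI ballI)
        fix N and x h :: complex assume N: "N \<ge> N0" and x: "x \<in> ball 0 R"
        have "\<bar>(\<Sum>i<N. dCf x h $ i / pochhammer (gam + 1) i) - dkernel x h\<bar> \<le> (\<Sum>i. ?T (i + N)) * cmod h"
          unfolding dkernel_def by (rule suminf_tail_bound[OF bd T]) (use x in auto)
        also have "\<dots> \<le> e * cmod h"
          using N0[OF N] by (intro mult_right_mono) auto
        finally show "norm ((\<Sum>i<N. dCf x h $ i / pochhammer (gam + 1) i) - dkernel x h) \<le> e * norm h" by simp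
      qed
    qed
  qed auto
  then obtain g where g: "\<And>x. x \<in> ball 0 R \<Longrightarrow> (\<lambda>n. Cf x $ n / pochhammer (gam + 1) n) sums g x"
    "\<And>x. x \<in> ball 0 R \<Longrightarrow> (g has_derivative dkernel x) (at x within ball 0 R)" by blast
  have "(kernel has_derivative dkernel z) (at z within ball 0 R)"
    by (rule has_derivative_transform[OF z _ g(2)[OF z]]) (use g(1) kernel_sums sums_unique2 in blast)
  then show "(kernel has_derivative dkernel z) (at z)"
    using z at_within_open[OF z open_ball] by simp
qed

text \<open>Coefficient comparison in \<open>Cf_dunkl_equation\<close>: dividing by (gamma +
  1)_(n+1) = (gamma + 1)_n (gamma + 1 + n) removes exactly the factor gamma + 1 + n, so the series
  on the right is the kernel shifted by one.\<close>

lemma kernel_dunkl_equation: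
  assumes z: "\<And>j. j < 2 * k \<Longrightarrow> cinner (dih_root k j) z \<noteq> 0"
  shows "dkernel z \<xi> + (\<Sum>j<2*k. dih_mult a b j * (cinner (dih_root k j) \<xi> / cinner (dih_root k j) z) * (kernel z - kernel (dih_refl k j z)))
     = cinner \<xi> w * kernel z"
proof -
  let ?c = "\<lambda>j. dih_mult a b j * (cinner (dih_root k j) \<xi> / cinner (dih_root k j) z)"
  let ?p = "\<lambda>n. pochhammer (gam + 1) n"
  define t where "t = (\<lambda>n. dCf z \<xi> $ n / ?p n + (\<Sum>j<2*k. ?c j * (Cf z $ n / ?p n - Cf (dih_refl k j z) $ n / ?p n)))"
  have 1: "t sums (dkernel z \<xi> + (\<Sum>j<2*k. ?c j * (kernel z - kernel (dih_refl k j z))))"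
    unfolding t_def by (intro sums_add sums_sum sums_mult sums_diff kernel_sums kernel_derivative)
  have t: "t n = (fps_const (cinner \<xi> w) * fps_X * (fps_const (gam + 1) * Cf z + fps_X * fps_deriv (Cf z))) $ n / ?p n" for n
  proof -
    have "t n = (dCf z \<xi> + (\<Sum>j<2 * k. fps_const (?c j) * (Cf z - Cf (dih_refl k j z)))) $ n / ?p n"
      unfolding t_def fps_add_nth fps_sum_nth fps_mult_left_const_nth fps_sub_nth add_divide_distrib sum_divide_distrib
      by (simp only: diff_divide_distrib[symmetric] times_divide_eq_right)
    then show ?thesis by (simp only: Cf_dunkl_equation[OF z])
  qed
  \<comment> \<open>The factor X leaves nothing in degree 0, so the index shift loses no
    term.\<close>
  have t0: "t 0 = 0" unfolding t by simp
  have tS: "t (Suc n) = cinner \<xi> w * (Cf z $ n / ?p n)" for n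
  proof -
    have "(fps_X * fps_deriv (Cf z)) $ n = real n * Cf z $ n" by (cases n) simp_all
    then have "(fps_const (cinner \<xi> w) * fps_X * (fps_const (gam + 1) * Cf z + fps_X * fps_deriv (Cf z))) $ Suc n
      = cinner \<xi> w * ((gam + 1 + real n) * Cf z $ n)"
      by (simp add: mult.assoc algebra_simps)
    moreover have "gam + 1 + real n \<noteq> 0" using gam_pos by linarith
    ultimately show ?thesis unfolding t by (simp add: pochhammer_Suc)
  qed
  have "(\<lambda>n. t (Suc n)) sums (cinner \<xi> w * kernel z)"
    unfolding tS by (intro sums_mult kernel_sums)
  then have "t sums (cinner \<xi> w * kernel z)" using t0 by (simp add: sums_Suc_iff)
  from sums_unique2[OF 1 this] show ?thesis .
qed

theorem kernel_eigenfunction: "dunkl_eigenfunction k a b w kernel"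
  unfolding dunkl_eigenfunction_def
proof (intro conjI allI kernel_0)
  fix x
  show "\<exists>D. (kernel has_derivative D) (at x) \<and>
        ((\<forall>j<2*k. cinner (dih_root k j) x \<noteq> 0) \<longrightarrow>
          (\<forall>\<xi>. D \<xi> + (\<Sum>j<2*k. dih_mult a b j * cinner (dih_root k j) \<xi> *
                 (kernel x - kernel (dih_refl k j x)) / cinner (dih_root k j) x)
               = cinner \<xi> w * kernel x))"
  proof (intro exI[of _ "dkernel x"] conjI impI allI kernel_derivative)
    fix \<xi> assume "\<forall>j<2*k. cinner (dih_root k j) x \<noteq> 0"
    then show "dkernel x \<xi> + (\<Sum>j<2*k. dih_mult a b j * cinner (dih_root k j) \<xi> *
                 (kernel x - kernel (dih_refl k j x)) / cinner (dih_root k j) x) = cinner \<xi> w * kernel x"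
      using kernel_dunkl_equation[of x \<xi>] by simp
  qed
qed

lemma dunkl_kernel_eq: "dunkl_kernel k a b z w = kernel z"
proof -
  have "(THE f. dunkl_eigenfunction k a b w f) = kernel"
    using kernel_eigenfunction dunkl_eigenfunction_unique[OF k a b] by blast
  then show ?thesis by (simp add: dunkl_kernel_def)
qed

text \<open>Scaling z by t amounts to the substitution of t X for X; it makes the n-th coefficient
  of \<open>Cf\<close> homogeneous of degree n.\<close>

lemma Af_scale: "Af (of_real t * z) p = Af z p oo (fps_const t * fps_X)"
proof -
  have "(cmod (of_real t * z) * cmod w)\<^sup>2 = t\<^sup>2 * (cmod z * cmod w)\<^sup>2"
    by (simp add: norm_mult power_mult_distrib)
  then have "Pf (of_real t * z) = Pf z oo (fps_const t * fps_X)"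
    unfolding Pf_def by (simp add: cheb_scale fps_compose_mult_distrib)
  moreover have "pc (of_real t * z) = t ^ k * pc z" "qc (of_real t * z) = t ^ k * qc z"
    by (simp_all add: pc_def qc_def power_mult_distrib flip: of_real_power)
  moreover have "(fps_const c * fps_X ^ k) oo (fps_const t * fps_X) = fps_const (t ^ k * c) * fps_X ^ k" for c :: real
    by (simp add: fps_compose_mult_distrib fps_compose_power[symmetric] fps_scale_X power_mult_distrib fps_const_power mult_ac flip: fps_const_mult)
  ultimately show ?thesis
    unfolding Af_def fps_compose_sub_distrib by (simp only: distrib_left mult.left_commute)
qed

lemma Cf_scale: "Cf (of_real t * z) $ n = t ^ n * Cf z $ n"
proof -
  have "Bf (of_real t * z) = Bf z oo (fps_const t * fps_X)"
    unfolding Bf_def cinner_of_real_mult_left by (simp add: fps_compose_sub_distrib fps_compose_mult_distrib fps_scale_X mult_ac flip: fps_const_mult)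
  then have "Gf (of_real t * z) p = Gf z p oo (fps_const t * fps_X)" for p
    unfolding Gf_def inverse_Bf Af_scale by (simp add: fps_negpow_scale fps_compose_mult_distrib)
  then have "Gf (of_real t * z) p $ n = t ^ n * Gf z p $ n" for p
    by (simp add: fps_compose_linear)
  then show ?thesis unfolding Cf_nth by (simp add: mult.left_commute)
qed

lemma kernel_of_real_mult_sums: "(\<lambda>n. t ^ n * (Cf z $ n / pochhammer (gam + 1) n)) sums kernel (of_real t * z)"
  using kernel_sums[of "of_real t * z"] by (simp add: Cf_scale)

end

section \<open>The Laplace transform, term by term\<close>

lemma has_bochner_integral_Gamma_scaled:
  fixes s x :: real
  assumes "s > 0" "x > 0"
  shows "has_bochner_integral lborel (\<lambda>t. indicator {0..} t * (exp (- s * t) * t powr (x - 1))) (Gamma x / s powr x)"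
proof -
  let ?f = "\<lambda>t :: real. indicator {0..} t * (exp (- t) * t powr (x - 1))"
  have nn: "?f t \<ge> 0" for t by auto
  have "(\<integral>\<^sup>+t. ennreal (?f t) \<partial>lborel) = ennreal (Gamma x)"
    unfolding Gamma_conv_nn_integral_real[OF assms(2)]
    by (intro nn_integral_cong) (auto simp: exp_minus field_simps)
  then have "has_bochner_integral lborel ?f (Gamma x)"
    using nn less_imp_le[OF Gamma_real_pos[OF assms(2)]] by (intro has_bochner_integral_nn_integral) auto
  then have "has_bochner_integral lborel (\<lambda>t. ?f (0 + s * t)) (Gamma x /\<^sub>R \<bar>s\<bar>)"
    using assms(1) lborel_has_bochner_integral_real_affine_iff[of s ?f "Gamma x" 0] by simp
  then have "has_bochner_integral lborel (\<lambda>t. ?f (0 + s * t) * (1 / s powr (x - 1))) (Gamma x /\<^sub>R \<bar>s\<bar> * (1 / s powr (x - 1)))"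
    by (rule has_bochner_integral_mult_left)
  moreover have "?f (0 + s * t) * (1 / s powr (x - 1)) = indicator {0..} t * (exp (- s * t) * t powr (x - 1))" for t
    using assms(1) by (auto simp: indicator_def zero_le_mult_iff powr_mult)
  moreover have "Gamma x /\<^sub>R \<bar>s\<bar> * (1 / s powr (x - 1)) = Gamma x / s powr x"
    using assms(1) powr_mult_base[of s "x - 1"] by (simp add: field_simps)
  ultimately show ?thesis by simp
qed

context dihedral_dunkl
begin

text \<open>The majorant is the binomial series with exponent gamma + 1 at |z| |w| / s; here the
  condition on s enters.\<close>

lemma Cf_abs_summable:
  assumes "s > cmod z * cmod w"
  shows "summable (\<lambda>n. 4 * (pochhammer (gam + 1) n / fact n * (cmod z * cmod w) ^ n) * (1 / s) ^ n)"
proof -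
  have s: "s > 0" using assms by (meson mult_nonneg_nonneg norm_ge_zero order.strict_trans1)
  have "\<bar>cmod z * cmod w * (1 / s)\<bar> < 1" using assms s by (simp add: abs_mult)
  from fps_abs_sums_negpow_linear[OF this, of "gam + 1"]
  have "summable (\<lambda>n. pochhammer (gam + 1) n / fact n * (cmod z * cmod w) ^ n * (1 / s) ^ n)"
    unfolding fps_abs_sums_def fps_negpow_linear_nth by (blast intro: sums_summable)
  from summable_mult[OF this, of 4] show ?thesis by (simp add: mult.assoc)
qed

text \<open>Sum and integral are exchanged because the integrals of the absolute values are
  dominated by the majorant of \<open>Cf_abs_summable\<close>, multiplied by a constant.\<close>

lemma laplace_kernel:
  assumes s: "s > cmod z * cmod w"
  shows "set_integrable lborel {0..} (\<lambda>t. exp (- s * t) * (t powr gam * kernel (of_real t * z)))"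
    and "(\<lambda>n. Gamma (gam + 1) / s powr (gam + 1) * (Cf z $ n * (1 / s) ^ n)) sums
       (LINT t:{0..}|lborel. exp (- s * t) * (t powr gam * kernel (of_real t * z)))"
proof -
  have s0: "s > 0" using assms by (meson mult_nonneg_nonneg norm_ge_zero order.strict_trans1)
  let ?p = "\<lambda>n. pochhammer (gam + 1) n"
  define g where "g = (\<lambda>n t. indicator {0..} t * (exp (- s * t) * t powr (gam + 1 + real n - 1)))"
  define f where "f = (\<lambda>n t. Cf z $ n / ?p n * g n t)"
  have G: "has_bochner_integral lborel (g n) (?p n * (Gamma (gam + 1) / s powr (gam + 1) * (1 / s) ^ n))" for n
  proof -
    have "has_bochner_integral lborel (g n) (Gamma (gam + 1 + real n) / s powr (gam + 1 + real n))"
      unfolding g_def using gam_pos by (intro has_bochner_integral_Gamma_scaled s0) linarith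
    \<comment> \<open>The Pochhammer symbol produced by the Gamma integral cancels the divisor in
      the kernel.\<close>
    moreover have "Gamma (gam + 1 + real n) = ?p n * Gamma (gam + 1)"
    proof -
      have "gam + 1 \<notin> \<int>\<^sub>\<le>\<^sub>0" using gam_pos by (auto elim!: nonpos_Ints_cases)
      moreover have "Gamma (gam + 1) > 0" using gam_pos by (intro Gamma_real_pos) linarith
      ultimately show ?thesis using pochhammer_Gamma[of "gam + 1" n] by (simp add: field_simps)
    qed
    moreover have "s powr (gam + 1 + real n) = s powr (gam + 1) * s ^ n"
      using s0 by (simp add: powr_add powr_realpow)
    ultimately show ?thesis by (simp add: power_divide)
  qed
  have int_f: "integrable lborel (f n)" for n
    unfolding f_def using G[of n] by (intro integrable_mult_right) (auto simp: has_bochner_integral_iff)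
  have val_f: "integral\<^sup>L lborel (f n) = Gamma (gam + 1) / s powr (gam + 1) * (Cf z $ n * (1 / s) ^ n)" for n
    unfolding f_def using G[of n] poch_pos[of n] by (simp add: has_bochner_integral_iff)
  have g_nn: "g n t \<ge> 0" for n t by (auto simp: g_def)
  have g_eq: "g n t = indicator {0..} t * (exp (- s * t) * t powr gam) * t ^ n" for n t
  proof (cases "t > 0")
    case True
    have "t powr (gam + 1 + real n - 1) = t powr gam * t powr real n" by (simp flip: powr_add)
    then show ?thesis using True by (simp add: g_def powr_realpow)
  next
    \<comment> \<open>At t = 0 both sides vanish because \<open>0 powr x = 0\<close>; for t < 0 the
      indicator is 0.\<close>
    case False
    then show ?thesis using gam_pos by (cases "t = 0") (auto simp: g_def)
  qed
  have sums_t: "(\<lambda>n. f n t) sums (indicator {0..} t * (exp (- s * t) * (t powr gam * kernel (of_real t * z))))" for t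
  proof -
    have "(\<lambda>n. indicator {0..} t * (exp (- s * t) * t powr gam) * (t ^ n * (Cf z $ n / ?p n))) sums
       (indicator {0..} t * (exp (- s * t) * t powr gam) * kernel (of_real t * z))"
      by (intro sums_mult kernel_of_real_mult_sums)
    moreover have "indicator {0..} t * (exp (- s * t) * t powr gam) * (t ^ n * (Cf z $ n / ?p n)) = f n t" for n
      unfolding f_def g_eq by simp
    ultimately show ?thesis by (simp add: mult.assoc)
  qed
  have abs_sum: "summable (\<lambda>n. norm (f n t))" for t
  proof -
    have "summable (\<lambda>n. indicator {0..} t * (exp (- s * t) * t powr gam) * \<bar>Cf (of_real t * z) $ n / ?p n\<bar>)"
      by (intro summable_mult kernel_abs_summable)
    moreover have "norm (f n t) = indicator {0..} t * (exp (- s * t) * t powr gam) * \<bar>Cf (of_real t * z) $ n / ?p n\<bar>" for n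
      unfolding f_def g_eq Cf_scale by (simp add: abs_mult)
    ultimately show ?thesis by simp
  qed
  have int_abs: "summable (\<lambda>n. \<integral>t. norm (f n t) \<partial>lborel)"
  proof (rule summable_comparison_test'[where N = 0])
    show "summable (\<lambda>n. Gamma (gam + 1) / s powr (gam + 1) * (4 * (?p n / fact n * (cmod z * cmod w) ^ n) * (1 / s) ^ n))"
      by (intro summable_mult Cf_abs_summable s)
    fix n
    have "(\<integral>t. norm (f n t) \<partial>lborel) = (\<integral>t. \<bar>Cf z $ n / ?p n\<bar> * g n t \<partial>lborel)"
      using g_nn by (intro Bochner_Integration.integral_cong) (auto simp: f_def abs_mult)
    also have "\<dots> = \<bar>Cf z $ n / ?p n\<bar> * (?p n * (Gamma (gam + 1) / s powr (gam + 1) * (1 / s) ^ n))"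
      using G[of n] by (simp add: has_bochner_integral_iff)
    also have "\<dots> = Gamma (gam + 1) / s powr (gam + 1) * (\<bar>Cf z $ n\<bar> * (1 / s) ^ n)"
      using poch_pos[of n] by simp
    also have "\<dots> \<le> Gamma (gam + 1) / s powr (gam + 1) * (4 * (?p n / fact n * (cmod z * cmod w) ^ n) * (1 / s) ^ n)"
      using s0 gam_pos by (intro mult_left_mono mult_right_mono Cf_bound divide_nonneg_nonneg less_imp_le[OF Gamma_real_pos]) auto
    finally show "norm (\<integral>t. norm (f n t) \<partial>lborel) \<le> Gamma (gam + 1) / s powr (gam + 1) * (4 * (?p n / fact n * (cmod z * cmod w) ^ n) * (1 / s) ^ n)"
      by simp
  qed
  have eq: "(\<lambda>t. \<Sum>n. f n t) = (\<lambda>t. indicator {0..} t * (exp (- s * t) * (t powr gam * kernel (of_real t * z))))"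
    using sums_t by (auto simp: sums_iff)
  show "set_integrable lborel {0..} (\<lambda>t. exp (- s * t) * (t powr gam * kernel (of_real t * z)))"
    using integrable_suminf[OF int_f _ int_abs] abs_sum unfolding eq set_integrable_def by simp
  show "(\<lambda>n. Gamma (gam + 1) / s powr (gam + 1) * (Cf z $ n * (1 / s) ^ n)) sums
       (LINT t:{0..}|lborel. exp (- s * t) * (t powr gam * kernel (of_real t * z)))"
    using sums_integral[OF int_f _ int_abs] abs_sum unfolding eq val_f set_lebesgue_integral_def by simp
qed

end

text \<open>Outside [-1, 1] the defining description is unsatisfiable, so \<open>arccos\<close>
  takes one fixed unspecified value there. Global measurability is wanted because the integrand is
  formed on the whole plane although the measure lives on the square.\<close>

lemma borel_measurable_arccos [measurable]: "arccos \<in> borel_measurable borel"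
proof -
  have out: "arccos x = (THE y. False)" if "x \<notin> {-1..1}" for x
    unfolding arccos_def using that cos_le_one cos_ge_minus_one
    by (intro arg_cong[where f = The] ext) auto
  have "(\<lambda>x. indicator {-1..1} x *\<^sub>R arccos x) \<in> borel_measurable borel"
    by (intro borel_measurable_continuous_on_indicator continuous_on_arccos') auto
  then have "(\<lambda>x. indicator {-1..1} x *\<^sub>R arccos x + indicator (- {-1..1}) x * (THE y. False)) \<in> borel_measurable borel"
    by measurable
  moreover have "(\<lambda>x. indicator {-1..1} x *\<^sub>R arccos x + indicator (- {-1..1}) x * (THE y. False)) = arccos"
    using out by (auto simp: fun_eq_iff indicator_def)
  ultimately show ?thesis by simp
qed

context dihedral_dunkl
begin

section \<open>The right-hand side as a series in 1/s\<close>

definition resolvent :: "real \<Rightarrow> complex \<Rightarrow> real \<Rightarrow> real \<Rightarrow> real \<times> real \<Rightarrow> real" where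
  "resolvent s z \<phi>1 \<phi>2 p = ((1 + fst p) * (1 + snd p) - 2 / (a + b) * (a * fst p * (1 + snd p) + b * snd p * (1 + fst p)))
      / (B_fun s z w * (A_fun k s (cmod (z * w)) (q_uv (fst p) (snd p) (real k * \<phi>1) (real k * \<phi>2))) powr (a + b))"

lemma resolvent_measurable: "resolvent s z \<phi>1 \<phi>2 \<in> borel_measurable borel"
proof -
  have "resolvent s z \<phi>1 \<phi>2 \<in> borel_measurable (borel \<Otimes>\<^sub>M borel)"
    unfolding resolvent_def[abs_def] A_fun_def q_uv_def xi_uv_def by measurable
  then show ?thesis by (simp add: borel_prod)
qed

text \<open>Evaluates the series at X = 1/s. The k factors of A each release one s, which gives
  s^gamma after raising to the power sigma, and B releases one more; hence the prefactor. The angles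
  are arbitrary polar angles of z and w, as in the theorem.\<close>

lemma resolvent_sums:
  assumes s: "s > cmod z * cmod w" and p: "p \<in> {-1..1} \<times> {-1..1}"
    and z: "z = of_real (cmod z) * cis \<phi>1" and w: "w = of_real (cmod w) * cis \<phi>2"
  shows "(\<lambda>n. hf p * Gf z p $ n * (1 / s) ^ n) sums (s powr (gam + 1) * resolvent s z \<phi>1 \<phi>2 p)"
proof -
  have s0: "s > 0" using s by (meson mult_nonneg_nonneg norm_ge_zero order.strict_trans1)
  define c where "c = (\<lambda>l. cmod z * cmod w * cos ((q_uv (fst p) (snd p) (real k * \<phi>1) (real k * \<phi>2) + 2 * pi * real l) / real k))"
  have cb: "\<bar>c l\<bar> \<le> cmod z * cmod w" for l by (simp add: c_def abs_mult mult_left_le)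
  have small: "\<bar>x * (1 / s)\<bar> < 1" if "\<bar>x\<bar> \<le> cmod z * cmod w" for x
    using that s s0 by (simp add: abs_mult)
  have A: "Af z p = (\<Prod>l<k. 1 - fps_const (c l) * fps_X)"
    unfolding c_def by (rule Af_eq_prod[OF z w cos_q_uv[OF p]])
  have "fps_abs_sums (fps_negpow (a + b) (Af z p)) (1 / s) ((\<Prod>l<k. 1 - c l * (1 / s)) powr (- (a + b)))"
    unfolding A by (intro fps_abs_sums_negpow_prod small cb finite_lessThan)
  moreover have "fps_abs_sums (inverse (Bf z)) (1 / s) ((1 - cinner z w * (1 / s)) powr (- 1))"
    unfolding inverse_Bf unfolding Bf_def by (intro fps_abs_sums_negpow_linear small abs_cinner_le)
  ultimately have "fps_abs_sums (Gf z p) (1 / s) ((\<Prod>l<k. 1 - c l * (1 / s)) powr (- (a + b)) * (1 - cinner z w * (1 / s)) powr (- 1))"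
    unfolding Gf_def by (rule fps_abs_sums_mult)
  then have "(\<lambda>n. hf p * (Gf z p $ n * (1 / s) ^ n)) sums
      (hf p * ((\<Prod>l<k. 1 - c l * (1 / s)) powr (- (a + b)) * (1 - cinner z w * (1 / s)) powr (- 1)))"
    unfolding fps_abs_sums_def by (intro sums_mult) blast
  moreover have "hf p * ((\<Prod>l<k. 1 - c l * (1 / s)) powr (- (a + b)) * (1 - cinner z w * (1 / s)) powr (- 1)) = s powr (gam + 1) * resolvent s z \<phi>1 \<phi>2 p"
  proof -
    define P where "P = (\<Prod>l<k. 1 - c l * (1 / s))"
    define B where "B = 1 - cinner z w * (1 / s)"
    have pos: "1 - c l * (1 / s) > 0" for l using small[OF cb[of l]] by linarith
    have P: "P > 0" unfolding P_def using pos by (intro prod_pos) auto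
    have B: "B > 0" unfolding B_def using small[OF abs_cinner_le[of z w]] by linarith
    have "A_fun k s (cmod (z * w)) (q_uv (fst p) (snd p) (real k * \<phi>1) (real k * \<phi>2)) = (\<Prod>l<k. s * (1 - c l * (1 / s)))"
      unfolding A_fun_def c_def using s0 by (intro prod.cong refl) (simp add: norm_mult right_diff_distrib)
    also have "\<dots> = s ^ k * P" unfolding prod.distrib P_def by simp
    finally have Ae: "A_fun k s (cmod (z * w)) (q_uv (fst p) (snd p) (real k * \<phi>1) (real k * \<phi>2)) powr (a + b) = s powr gam * P powr (a + b)"
      using s0 by (simp add: powr_mult powr_powr flip: powr_realpow)
    have Be: "B_fun s z w = s * B" unfolding B_fun_def B_def cinner_def using s0 by (simp add: right_diff_distrib)
    \<comment> \<open>The numerator of the theorem is \<open>hf\<close>, checked after clearing the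
      denominator a + b.\<close>
    have hfe: "(1 + fst p) * (1 + snd p) - 2 / (a + b) * (a * fst p * (1 + snd p) + b * snd p * (1 + fst p)) = hf p"
    proof -
      have "(a + b) * ((1 + fst p) * (1 + snd p) - 2 / (a + b) * (a * fst p * (1 + snd p) + b * snd p * (1 + fst p))) =
        (a + b) * ((1 + fst p) * (1 + snd p)) - 2 * (a * fst p * (1 + snd p) + b * snd p * (1 + fst p))"
        using a b by (simp add: right_diff_distrib)
      also have "\<dots> = (a + b) * hf p" unfolding hf_scaled by (simp add: algebra_simps)
      finally show ?thesis using a b by simp
    qed
    have "s powr (gam + 1) * resolvent s z \<phi>1 \<phi>2 p = s powr (gam + 1) * (hf p / (s * B * (s powr gam * P powr (a + b))))"
      unfolding resolvent_def hfe Ae Be ..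
    also have "\<dots> = s powr gam * s * (hf p / (s * B * (s powr gam * P powr (a + b))))"
      using s0 by (simp add: powr_add)
    also have "s powr gam * s * (hf p / (s * B * (s powr gam * P powr (a + b)))) = hf p * (P powr (- (a + b)) * B powr (- 1))"
    proof -
      have "P powr (- (a + b)) = inverse (P powr (a + b))" "B powr (- 1) = inverse B" "P powr (a + b) > 0"
        using P B by (auto simp only: powr_minus powr_one powr_gt_zero)
      then show ?thesis using s0 B by (simp add: field_simps)
    qed
    finally show ?thesis unfolding P_def B_def ..
  qed
  ultimately show ?thesis by (simp add: mult.assoc)
qed

text \<open>Integrates \<open>resolvent_sums\<close> term by term. Its closed form and the
  coefficient bounds are available on the square, which has full measure, so the statements are made
  almost everywhere.\<close>

lemma resolvent_integral:
  assumes s: "s > cmod z * cmod w"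
    and z: "z = of_real (cmod z) * cis \<phi>1" and w: "w = of_real (cmod w) * cis \<phi>2"
  shows "(\<lambda>n. Cf z $ n * (1 / s) ^ n) sums (s powr (gam + 1) * (\<integral>u. (\<integral>v. resolvent s z \<phi>1 \<phi>2 (u, v) \<partial>nu b) \<partial>nu a))"
proof -
  have s0: "s > 0" using s by (meson mult_nonneg_nonneg norm_ge_zero order.strict_trans1)
  define f where "f = (\<lambda>n p. hf p * Gf z p $ n * (1 / s) ^ n)"
  define T where "T = (\<lambda>n. 4 * (pochhammer (gam + 1) n / fact n * (cmod z * cmod w) ^ n) * (1 / s) ^ n)"
  have T: "summable T" unfolding T_def by (rule Cf_abs_summable[OF s])
  have cont: "continuous_on UNIV (\<lambda>p. hf p * Gf z p $ n)" for n
    using Gf_cont[of z] unfolding cont.coeffs_in_def by (intro continuous_intros hf_cont) blast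
  have int_f: "integrable (nu2 a b) (f n)" for n
    unfolding f_def by (intro integrable_mult_left integrable_nu2_continuous a b cont)
  have val: "integral\<^sup>L (nu2 a b) (f n) = Cf z $ n * (1 / s) ^ n" for n
    unfolding f_def Cf_nth by simp
  have fT: "\<bar>f n p\<bar> \<le> T n" if "p \<in> {-1..1} \<times> {-1..1}" for n p
    unfolding f_def T_def abs_mult[of _ "(1 / s) ^ n"] using hf_Gf_bound[OF that, of z n] s0
    by (intro mult_mono) auto
  have AE: "AE p in nu2 a b. summable (\<lambda>n. norm (f n p))"
    using AE_nu2[OF a b]
  proof eventually_elim
    case (elim p)
    show ?case by (rule summable_comparison_test'[OF T, where N = 0]) (use fT[OF elim] in simp)
  qed
  have int_abs: "summable (\<lambda>n. \<integral>p. norm (f n p) \<partial>nu2 a b)"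
  proof (rule summable_comparison_test'[OF T, where N = 0])
    fix n
    show "norm (\<integral>p. norm (f n p) \<partial>nu2 a b) \<le> T n"
      unfolding real_norm_def by (rule integral_nu2_bound[OF a b]) (use fT in simp)
  qed
  let ?R = "\<lambda>p. s powr (gam + 1) * resolvent s z \<phi>1 \<phi>2 p"
  have eq: "AE p in nu2 a b. (\<Sum>n. f n p) = ?R p"
    using AE_nu2[OF a b]
  proof eventually_elim
    case (elim p)
    show ?case using resolvent_sums[OF s elim z w] unfolding f_def by (simp add: sums_iff)
  qed
  have intS: "integrable (nu2 a b) (\<lambda>p. \<Sum>n. f n p)"
    by (rule integrable_suminf[OF int_f AE int_abs])
  have mR: "?R \<in> borel_measurable (nu2 a b)"
    using resolvent_measurable[of s z \<phi>1 \<phi>2] by simp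
  have intR: "integrable (nu2 a b) ?R"
    by (rule integrable_cong_AE_imp[OF intS mR]) (use eq in \<open>auto elim: eventually_mono\<close>)
  have "(\<lambda>n. Cf z $ n * (1 / s) ^ n) sums (\<integral>p. (\<Sum>n. f n p) \<partial>nu2 a b)"
    using sums_integral[OF int_f AE int_abs] unfolding val .
  also have "(\<integral>p. (\<Sum>n. f n p) \<partial>nu2 a b) = (\<integral>p. ?R p \<partial>nu2 a b)"
    by (rule integral_cong_AE[OF borel_measurable_integrable[OF intS] mR eq])
  also have "\<dots> = s powr (gam + 1) * (\<integral>u. (\<integral>v. resolvent s z \<phi>1 \<phi>2 (u, v) \<partial>nu b) \<partial>nu a)"
    unfolding integral_nu2_fst[OF a b intR] by simp
  finally show ?thesis .
qed

theorem laplace_kernel_eq: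
  assumes s: "s > cmod z * cmod w"
    and z: "z = of_real (cmod z) * cis \<phi>1" and w: "w = of_real (cmod w) * cis \<phi>2"
  shows "(LINT t:{0..}|lborel. exp (- s * t) * (t powr gam * kernel (of_real t * z)))
     = Gamma (gam + 1) * (\<integral>u. (\<integral>v. resolvent s z \<phi>1 \<phi>2 (u, v) \<partial>nu b) \<partial>nu a)"
proof -
  have s0: "s > 0" using s by (meson mult_nonneg_nonneg norm_ge_zero order.strict_trans1)
  have "(\<lambda>n. Gamma (gam + 1) / s powr (gam + 1) * (Cf z $ n * (1 / s) ^ n)) sums
     (Gamma (gam + 1) / s powr (gam + 1) * (s powr (gam + 1) * (\<integral>u. (\<integral>v. resolvent s z \<phi>1 \<phi>2 (u, v) \<partial>nu b) \<partial>nu a)))"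
    by (intro sums_mult resolvent_integral s z w)
  from sums_unique2[OF laplace_kernel(2)[OF s] this] show ?thesis using s0 by simp
qed

end

theorem mainTheorem12:
  fixes k :: nat and a b s \<phi>1 \<phi>2 :: real and z w :: complex
  assumes "k \<ge> 1" and "a > 0" and "b > 0"
    and "z = of_real (cmod z) * exp (\<i> * of_real \<phi>1)"
    and "w = of_real (cmod w) * exp (\<i> * of_real \<phi>2)"
    and "s > cmod z * cmod w"
  shows "set_integrable lborel {0..}
           (\<lambda>t. exp (- s * t) * (t powr (real k * (a + b)) * dunkl_kernel k a b (of_real t * z) w))
       \<and> (LINT t:{0..}|lborel. exp (- s * t) * (t powr (real k * (a + b)) * dunkl_kernel k a b (of_real t * z) w))
         = Gamma (real k * (a + b) + 1) *
           (\<integral>u. (\<integral>v. ((1 + u) * (1 + v) - 2 / (a + b) * (a * u * (1 + v) + b * v * (1 + u)))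
                 / (B_fun s z w * (A_fun k s (cmod (z * w)) (q_uv u v (real k * \<phi>1) (real k * \<phi>2))) powr (a + b))
               \<partial>nu b) \<partial>nu a)"
proof -
  interpret dihedral_dunkl k a b w
    using assms by unfold_locales auto
  have "z = of_real (cmod z) * cis \<phi>1" "w = of_real (cmod w) * cis \<phi>2"
    using assms(4,5) by (simp_all only: cis_conv_exp)
  from laplace_kernel_eq[OF assms(6) this] laplace_kernel(1)[OF assms(6)] show ?thesis
    unfolding dunkl_kernel_eq resolvent_def fst_conv snd_conv by blast
qed

end
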